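(* Suppose that for every $n$ and every $k\in\{3,\ldots,n\}$ there do not exist a Druzkowski $n\times n$ matrix $A$ and a vector $y\in\mathbb{C}^n$ such that $(y,Z_k,A)\in V_n$, where $Z_k=(1,\ldots,1,0,\ldots,0)^t\in\mathbb{C}^n$ is the vector whose first $k$ coordinates are $1$ and whose last $n-k$ coordinates are $0$. Then $JC(\infty)$ holds.
   Context: $JC(n)$ is the statement: every polynomial map $F:\mathbb{C}^n\to\mathbb{C}^n$ whose Jacobian matrix is invertible at every point has a polynomial inverse. $JC(\infty)$ is the statement that $JC(n)$ holds for every $n$. For $u,v\in\mathbb{C}^n$, $u*v=(u_1v_1,\ldots,u_nv_n)$ is the coordinatewise product, $u^k$ is the coordinatewise $k$-th power, and $\Delta[u]$ is the diagonal $n\times n$ matrix with $(i,i)$ entry $u_i$. $\mathcal{M}_n$ is the set of complex $n\times n$ matrices. A matrix $A\in\mathcal{M}_n$ is called Druzkowski if the map $F_A(x)=x+(A.x)^3:\mathbb{C}^n\to\mathbb{C}^n$ has Jacobian determinant identically equal to $1$. Define $$V_n=\{(y,z,A)\in\mathbb{C}^n\times\mathbb{C}^n\times\mathcal{M}_n:\ \det(Id+\Delta[(sz+ty)^2].A)=1\ \forall s,t\in\mathbb{C},\ z+A.(z^3+z*y^2)=0\}.$$ *)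

theory Defs
  imports "HOL-Analysis.Derivative" "Jordan_Normal_Form.Determinant"
begin

text \<open>
  The dimension \<open>n\<close> has to be quantified inside statements, so the points of \<open>n\<close>-dimensional complex
  space are the elements of \<open>carrier_vec n\<close> and maps between such spaces are functions on \<open>complex vec\<close>,
  constrained on the carrier only. Indices run over \<open>{0..<n}\<close>.
\<close>

unbundle no vec_syntax

definition polynomial_fun :: "nat \<Rightarrow> (complex vec \<Rightarrow> complex) \<Rightarrow> bool" where
  "polynomial_fun n f \<longleftrightarrow>
     (\<exists>(M :: (nat \<Rightarrow> nat) set) c. finite M \<and>
        (\<forall>x\<in>carrier_vec n. f x = (\<Sum>m\<in>M. c m * (\<Prod>i<n. (x $ i) ^ m i))))"

definition polynomial_map :: "nat \<Rightarrow> (complex vec \<Rightarrow> complex vec) \<Rightarrow> bool" where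
  "polynomial_map n F \<longleftrightarrow>
     F \<in> carrier_vec n \<rightarrow> carrier_vec n \<and> (\<forall>i<n. polynomial_fun n (\<lambda>x. F x $ i))"

definition jacobian :: "nat \<Rightarrow> (complex vec \<Rightarrow> complex vec) \<Rightarrow> complex vec \<Rightarrow> complex mat" where
  "jacobian n F x = mat n n (\<lambda>(i, j). deriv (\<lambda>t. F (x |\<^sub>v j \<mapsto> t) $ i) (x $ j))"

definition JC :: "nat \<Rightarrow> bool" where
  "JC n \<longleftrightarrow>
     (\<forall>F. polynomial_map n F \<and> (\<forall>x\<in>carrier_vec n. invertible_mat (jacobian n F x)) \<longrightarrow>
        (\<exists>G. polynomial_map n G \<and> (\<forall>x\<in>carrier_vec n. G (F x) = x \<and> F (G x) = x)))"

definition JC_infinity :: bool where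
  "JC_infinity \<longleftrightarrow> (\<forall>n. JC n)"

definition vec_times :: "complex vec \<Rightarrow> complex vec \<Rightarrow> complex vec" (infixl \<open>*\<^sub>c\<close> 70) where
  "u *\<^sub>c v = vec (dim_vec u) (\<lambda>i. u $ i * v $ i)"

definition vec_power :: "complex vec \<Rightarrow> nat \<Rightarrow> complex vec" (infixr \<open>^\<^sub>c\<close> 80) where
  "u ^\<^sub>c k = map_vec (\<lambda>a. a ^ k) u"

definition Diag :: "complex vec \<Rightarrow> complex mat" where
  "Diag u = mat_diag (dim_vec u) (\<lambda>i. u $ i)"

definition cubic_map :: "complex mat \<Rightarrow> complex vec \<Rightarrow> complex vec" where
  "cubic_map A x = x + (A *\<^sub>v x) ^\<^sub>c 3"

definition druzkowski :: "nat \<Rightarrow> complex mat \<Rightarrow> bool" where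
  "druzkowski n A \<longleftrightarrow>
     A \<in> carrier_mat n n \<and> (\<forall>x\<in>carrier_vec n. det (jacobian n (cubic_map A) x) = 1)"

definition V :: "nat \<Rightarrow> (complex vec \<times> complex vec \<times> complex mat) set" where
  "V n = {(y, z, A). y \<in> carrier_vec n \<and> z \<in> carrier_vec n \<and> A \<in> carrier_mat n n \<and>
     (\<forall>s t. det (1\<^sub>m n + Diag ((s \<cdot>\<^sub>v z + t \<cdot>\<^sub>v y) ^\<^sub>c 2) * A) = 1) \<and>
     z + A *\<^sub>v (z ^\<^sub>c 3 + z *\<^sub>c y ^\<^sub>c 2) = 0\<^sub>v n}"

definition Z :: "nat \<Rightarrow> nat \<Rightarrow> complex vec" where
  "Z n k = vec n (\<lambda>i. if i < k then 1 else 0)"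

end

theory Submission
  imports "HOL-Complex_Analysis.Complex_Analysis" "HOL-Computational_Algebra.Computational_Algebra"
    "HOL-Computational_Algebra.Field_as_Ring" Defs
begin

text \<open>
  If a map \<open>F\<^sub>A(x) = x + (A x)\<^sup>3\<close> with invertible Jacobians identifies two points \<open>p \<noteq> q\<close>, then
  \<open>z = A(p - q)/2\<close> and \<open>y = \<surd>3 A(p + q)/2\<close> satisfy \<open>z + A(z\<^sup>3 + z y\<^sup>2) = 0\<close> with \<open>z \<noteq> 0\<close>; three diagonal copies of
  \<open>A\<close> give \<open>z\<close> at least three nonzero entries, and a diagonal rescaling turns \<open>z\<close> into \<open>Z\<^sub>k\<close>. So the hypothesis
  makes all these maps injective.

  An injective \<open>F = F\<^sub>A\<close> has a polynomial inverse \<open>G\<close>. Every \<open>x\<^sub>i\<close> is algebraic over \<open>F\<^sub>1, \<dots>, F\<^sub>n\<close>, so on a generic line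
  through 0 the map \<open>G\<close> extends meromorphically with polynomial growth, and Liouville's theorem makes it
  rational: \<open>P(F(x)) = D(F(x)) x\<^sub>i\<close> with polynomials \<open>P\<close>, \<open>D\<close>. To see that \<open>G\<close> has no poles, reduce the fraction
  \<open>P/D\<close> at \<open>t F(s u)\<close> to \<open>R/Q\<close> in \<open>\<complex>[s, t]\<close>. Near points of the image of \<open>F\<close> the quotient is bounded, hence \<open>Q \<noteq> 0\<close>
  there; in particular \<open>Q(s, 0)\<close>, \<open>Q(s, 1)\<close> and \<open>Q(0, t)\<close> are nonvanishing polynomials, that is, one constant. Along a
  line on which the reduced denominator \<open>q\<close> has maximal degree this forces \<open>q\<close> to be constant.

  Finally, an arbitrary Keller map is reduced to the maps \<open>F\<^sub>A\<close> by lowering the degree to 3, homogenising, and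
  writing cubic forms as sums of cubes (Bass, Connell, Wright; Yagzhev; Druzkowski).
\<close>

text \<open>Along every ray \<open>t v\<close> the local inverse at 0 has Taylor coefficients that
  are polynomials in \<open>v\<close>, because comparing coefficients in
  \<open>F(g(t)) = t v\<close> gives a recursion. A polynomial inverse exists as soon as these
  coefficients vanish beyond one degree valid for all \<open>v\<close>; rationality and absence of
  poles serve to produce that bound.

  The obstacle is to control poles without divisibility theory in n variables. Polynomials in many
  variables are therefore restricted to rays and to the surfaces \<open>t F(s u)\<close>, and
  factorisation takes place in \<complex>[t] and \<complex>[s][t]. These surfaces contain rays (s
  fixed) as well as curves lying in the image (t = 1). Passing to a ray may lower the degree of a
  reduced denominator, hence the choice of a ray where it is maximal.

  The local estimates are uniform on balls because an everywhere nonsingular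
  \<open>x + (A x)^3\<close> has Jacobian determinant 1: the inverse Jacobian is the adjugate, so
  the radius of local invertibility depends only on the size of the preimage.\<close>

unbundle no vec_syntax

section \<open>Polynomial functions\<close>

text \<open>Closure under ring operations instead of coefficient lists: each fact becomes an
  induction, and the variables may be indexed by any type. Only coordinates in \<open>I\<close>
  matter (\<open>polyf_cong\<close>).\<close>

inductive polyf :: "'i set \<Rightarrow> (('i \<Rightarrow> complex) \<Rightarrow> complex) \<Rightarrow> bool" for I where
  const [intro, simp]: "polyf I (\<lambda>x. c)"
| var [intro]: "i \<in> I \<Longrightarrow> polyf I (\<lambda>x. x i)"
| add [intro]: "polyf I f \<Longrightarrow> polyf I g \<Longrightarrow> polyf I (\<lambda>x. f x + g x)"
| mult [intro]: "polyf I f \<Longrightarrow> polyf I g \<Longrightarrow> polyf I (\<lambda>x. f x * g x)"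

lemma polyf_sum [intro]: "(\<And>k. k \<in> A \<Longrightarrow> polyf I (f k)) \<Longrightarrow> polyf I (\<lambda>x. \<Sum>k\<in>A. f k x)"
  by (induction A rule: infinite_finite_induct) auto

lemma polyf_prod [intro]: "(\<And>k. k \<in> A \<Longrightarrow> polyf I (f k)) \<Longrightarrow> polyf I (\<lambda>x. \<Prod>k\<in>A. f k x)"
  by (induction A rule: infinite_finite_induct) auto

lemma polyf_power [intro]: "polyf I f \<Longrightarrow> polyf I (\<lambda>x. f x ^ k)"
  by (induction k) auto

lemma polyf_minus [intro]: "polyf I f \<Longrightarrow> polyf I (\<lambda>x. - f x)"
  using polyf.mult[OF polyf.const[of I "-1"]] by auto

lemma polyf_diff [intro]: "polyf I f \<Longrightarrow> polyf I g \<Longrightarrow> polyf I (\<lambda>x. f x - g x)"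
  using polyf.add[OF _ polyf_minus, of I f g] by auto

lemma polyf_cong: "polyf I f \<Longrightarrow> (\<And>i. i \<in> I \<Longrightarrow> x i = y i) \<Longrightarrow> f x = f y"
  by (induction rule: polyf.induct) auto

lemma polyf_comp:
  assumes "polyf I f" "\<And>i. i \<in> I \<Longrightarrow> polyf J (g i)"
  shows "polyf J (\<lambda>x. f (\<lambda>i. g i x))"
  using assms(1) by induction (use assms(2) in auto)

lemma polyf_along:
  assumes "polyf I f"
  shows "\<exists>q. \<forall>t. poly q t = f (\<lambda>i. poly (p i) t)"
  using assms
proof induction
  case (const c)
  show ?case by (rule exI[of _ "[:c:]"]) simp
next
  case (add f g)
  then obtain q r where "\<forall>t. poly q t = f (\<lambda>i. poly (p i) t)" "\<forall>t. poly r t = g (\<lambda>i. poly (p i) t)"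
    by blast
  then show ?case by (intro exI[of _ "q + r"]) simp
next
  case (mult f g)
  then obtain q r where "\<forall>t. poly q t = f (\<lambda>i. poly (p i) t)" "\<forall>t. poly r t = g (\<lambda>i. poly (p i) t)"
    by blast
  then show ?case by (intro exI[of _ "q * r"]) simp
qed blast

text \<open>Joining a point where \<open>f\<close> is nonzero to one where \<open>g\<close> is
  nonzero by a line reduces the claim to \<complex>[t] having no zero divisors.\<close>

lemma polyf_mult_eq_0:
  assumes "polyf I f" "polyf I g" "\<And>x. f x * g x = 0"
  shows "(\<forall>x. f x = 0) \<or> (\<forall>x. g x = 0)"
proof (rule ccontr)
  assume "\<not> ?thesis"
  then obtain x y where xy: "f x \<noteq> 0" "g y \<noteq> 0" by auto
  obtain q where q: "\<And>t. poly q t = f (\<lambda>i. poly [:x i, y i - x i:] t)"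
    using polyf_along[OF assms(1), of "\<lambda>i. [:x i, y i - x i:]"] by auto
  obtain r where r: "\<And>t. poly r t = g (\<lambda>i. poly [:x i, y i - x i:] t)"
    using polyf_along[OF assms(2), of "\<lambda>i. [:x i, y i - x i:]"] by auto
  have "poly (q * r) = poly 0" by (rule ext) (simp add: q r assms(3))
  then have "q * r = 0" using poly_eq_poly_eq_iff by blast
  moreover have "poly q 0 \<noteq> 0" "poly r 1 \<noteq> 0" using xy by (simp_all add: q r)
  ultimately show False by auto
qed

section \<open>Restriction to lines through the origin\<close>

abbreviation ray :: "complex \<Rightarrow> ('i \<Rightarrow> complex) \<Rightarrow> 'i \<Rightarrow> complex" where
  "ray t v \<equiv> \<lambda>i. t * v i"

text \<open>\<open>coeff (H v) k\<close> is the homogeneous part of degree k of \<open>f\<close>,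
  evaluated at \<open>v\<close>. This makes the coefficients polynomial in \<open>v\<close> and the
  degree bound \<open>M\<close> independent of \<open>v\<close>.\<close>

lemma polyf_line:
  assumes "polyf I f"
  shows "\<exists>M H. \<forall>v. degree (H v) \<le> M \<and> (\<forall>t. poly (H v) t = f (ray t v)) \<and>
           (\<forall>k. polyf I (\<lambda>v. coeff (H v) k))"
  using assms
proof induction
  case (const c)
  show ?case
  proof (intro exI[of _ 0] exI[of _ "\<lambda>v. [:c:]"], intro allI conjI)
    show "polyf I (\<lambda>v. coeff [:c:] k)" for k by simp
  qed simp_all
next
  case (var i)
  show ?case
  proof (intro exI[of _ 1] exI[of _ "\<lambda>v. [:0, v i:]"], intro allI conjI)
    show "polyf I (\<lambda>v. coeff [:0, v i:] k)" for k
      using var by (cases k rule: nat.exhaust; cases "k - 1") (auto simp: coeff_pCons split: nat.splits)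
  qed (simp_all)
next
  case (add f g)
  then obtain M H M' H' where h: "\<And>v. degree (H v) \<le> M" "\<And>v t. poly (H v) t = f (ray t v)"
    "\<And>k. polyf I (\<lambda>v. coeff (H v) k)" "\<And>v. degree (H' v) \<le> M'" "\<And>v t. poly (H' v) t = g (ray t v)"
    "\<And>k. polyf I (\<lambda>v. coeff (H' v) k)"
    by metis
  show ?case
    by (rule exI[of _ "max M M'"], rule exI[of _ "\<lambda>v. H v + H' v"])
      (use h in \<open>auto intro!: order.trans[OF degree_add_le_max] max.mono\<close>)
next
  case (mult f g)
  then obtain M H M' H' where h: "\<And>v. degree (H v) \<le> M" "\<And>v t. poly (H v) t = f (ray t v)"
    "\<And>k. polyf I (\<lambda>v. coeff (H v) k)" "\<And>v. degree (H' v) \<le> M'" "\<And>v t. poly (H' v) t = g (ray t v)"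
    "\<And>k. polyf I (\<lambda>v. coeff (H' v) k)"
    by metis
  show ?case
  proof (intro exI[of _ "M + M'"] exI[of _ "\<lambda>v. H v * H' v"], intro allI conjI)
    show "degree (H v * H' v) \<le> M + M'" for v
      by (rule order.trans[OF degree_mult_le]) (intro add_mono h)
    show "polyf I (\<lambda>v. coeff (H v * H' v) k)" for k
      unfolding coeff_mult by (intro polyf_sum polyf.mult h)
  qed (simp add: h)
qed

section \<open>Quotients of polynomials in two variables\<close>

text \<open>Convention for \<complex>[s][t]: the inner polynomials are in s, the outer variable is
  t, and \<open>sec\<close> substitutes for s.\<close>

definition sec :: "complex poly poly \<Rightarrow> complex \<Rightarrow> complex poly" where
  "sec Q s = map_poly (\<lambda>p. poly p s) Q"

lemma coeff_sec [simp]: "coeff (sec Q s) k = poly (coeff Q k) s"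
  by (simp add: sec_def coeff_map_poly)

lemma sec_0 [simp]: "sec 0 s = 0"
  by (rule poly_eqI) simp

lemma sec_add: "sec (P + Q) s = sec P s + sec Q s"
  by (rule poly_eqI) simp

lemma sec_mult: "sec (P * Q) s = sec P s * sec Q s"
  by (rule poly_eqI) (simp add: coeff_mult poly_sum)

lemma sec_const [simp]: "sec [:p:] s = [:poly p s:]"
  by (rule poly_eqI) (simp add: coeff_pCons split: nat.split)

lemma degree_sec_le: "degree (sec Q s) \<le> degree Q"
  by (rule degree_le) (simp add: coeff_eq_0)

lemma degree_sec_eq: "poly (lead_coeff Q) s \<noteq> 0 \<Longrightarrow> degree (sec Q s) = degree Q"
  by (intro antisym degree_sec_le le_degree) simp

lemma poly_sec: "poly (sec Q s) t = (\<Sum>k\<le>degree Q. poly (coeff Q k) s * t ^ k)"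
proof -
  have "poly (sec Q s) t = (\<Sum>k\<le>degree (sec Q s). coeff (sec Q s) k * t ^ k)"
    by (rule poly_altdef)
  also have "\<dots> = (\<Sum>k\<le>degree Q. coeff (sec Q s) k * t ^ k)"
    by (rule sum.mono_neutral_left)
      (use degree_sec_le[of Q s] in \<open>auto simp: coeff_eq_0 simp del: coeff_sec\<close>)
  finally show ?thesis by simp
qed

text \<open>The other order of substitution, for viewing \<open>Q\<close> as a polynomial in s with
  t fixed.\<close>

lemma poly_sec_swap: "poly (sec Q s) t = poly (poly Q [:t:]) s"
proof (induction Q)
  case (pCons a Q)
  have "sec (pCons a Q) s = pCons (poly a s) (sec Q s)"
    by (rule poly_eqI) (simp add: coeff_pCons split: nat.split)
  then show ?case using pCons by simp
qed simp

lemma sec_eq_0_imp_dvd: "sec Q s = 0 \<Longrightarrow> [:[:-s, 1:]:] dvd Q"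
proof -
  assume "sec Q s = 0"
  then have "poly (coeff Q k) s = 0" for k
    by (metis coeff_0 coeff_sec)
  then show ?thesis unfolding const_poly_dvd_iff poly_eq_0_iff_dvd[symmetric] by blast
qed

lemma finite_sec_eq_0: "Q \<noteq> 0 \<Longrightarrow> finite {s. sec Q s = 0}"
proof (rule finite_subset)
  show "{s. sec Q s = 0} \<subseteq> {s. poly (lead_coeff Q) s = 0}"
    by (metis (mono_tags, lifting) Collect_mono coeff_0 coeff_sec)
  show "Q \<noteq> 0 \<Longrightarrow> finite {s. poly (lead_coeff Q) s = 0}"
    by (rule poly_roots_finite) simp
qed

lemma eventually_at_not_finite:
  fixes a :: complex
  assumes "finite S" shows "\<forall>\<^sub>F x in at a. x \<notin> S"
  using islimpt_finite[OF assms, of a] by (simp add: islimpt_iff_eventually)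

section \<open>Gauss's lemma and a Bezout identity in \<complex>[s][t]\<close>

lemma dvd_of_dvd_smult_primitive:
  fixes R P :: "complex poly poly"
  assumes "Polynomial.content R = 1" "R dvd Polynomial.smult a P" "a \<noteq> 0"
  shows "R dvd P"
proof (rule fract_poly_dvdD[OF _ assms(1)])
  have "fract_poly R dvd Polynomial.smult (to_fract a) (fract_poly P)"
    using fract_poly_dvd[OF assms(2)] by simp
  then show "fract_poly R dvd fract_poly P"
    by (rule dvd_smult_cancel) (use assms(3) in simp)
qed

text \<open>Takes the place of a resultant: common zeros of \<open>P\<close> and \<open>Q\<close>
  lie over the finitely many roots of \<open>r\<close>. An element \<open>R\<close> of least
  t-degree in the ideal of \<open>P\<close> and \<open>Q\<close> pseudo-divides every element with
  remainder 0. By Gauss its primitive part divides \<open>P\<close> and \<open>Q\<close>, is a unit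
  by coprimality, and so \<open>R\<close> is free of t.\<close>

lemma coprime_imp_bezout_const:
  fixes P Q :: "complex poly poly"
  assumes cop: "coprime P Q" and Q: "Q \<noteq> 0"
  shows "\<exists>a b r. r \<noteq> 0 \<and> a * P + b * Q = [:r:]"
proof -
  define J where "J = {R. \<exists>a b. R = a * P + b * Q}"
  have QJ: "Q \<in> J" unfolding J_def by (intro CollectI, rule exI[of _ 0], rule exI[of _ 1]) simp
  have PJ: "P \<in> J" unfolding J_def by (intro CollectI, rule exI[of _ 1], rule exI[of _ 0]) simp
  obtain R where R: "R \<in> J" "R \<noteq> 0" and min: "\<And>S. S \<in> J \<Longrightarrow> S \<noteq> 0 \<Longrightarrow> degree R \<le> degree S"
    using ex_has_least_nat[of "\<lambda>R. R \<in> J \<and> R \<noteq> 0" Q degree] QJ Q by blast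
  have *: "primitive_part R dvd S" if S: "S \<in> J" for S
  proof -
    obtain a q where aq: "a \<noteq> 0" "Polynomial.smult a S = R * q + pseudo_mod S R"
      and deg: "pseudo_mod S R = 0 \<or> degree (pseudo_mod S R) < degree R"
      using pseudo_mod[OF R(2), of S] by blast
    obtain u v u' v' where uv: "S = u * P + v * Q" "R = u' * P + v' * Q"
      using S R(1) unfolding J_def by blast
    have "pseudo_mod S R = Polynomial.smult a S - R * q" unfolding aq(2) by (rule add_diff_cancel_left'[symmetric])
    also have "\<dots> = ([:a:] * u - u' * q) * P + ([:a:] * v - v' * q) * Q"
      unfolding uv by (simp add: algebra_simps smult_add_right)
    finally have "pseudo_mod S R \<in> J" unfolding J_def by blast
    from min[OF this] deg have "pseudo_mod S R = 0" by (meson leD)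
    then have "R dvd Polynomial.smult a S" unfolding aq(2) by simp
    moreover have "primitive_part R dvd R"
      using dvd_smult[OF dvd_refl, of "primitive_part R" "Polynomial.content R"]
      by (simp add: content_times_primitive_part)
    ultimately have "primitive_part R dvd Polynomial.smult a S" by (rule dvd_trans[rotated])
    then show ?thesis 
      by (rule dvd_of_dvd_smult_primitive[rotated]) (use aq(1) R(2) in auto)
  qed
  have "is_unit (primitive_part R)"
    using cop *[OF PJ] *[OF QJ] by (rule coprime_common_divisor)
  then have "degree (primitive_part R) = 0"
    by (elim is_unit_polyE) simp
  then have "degree R = 0" by simp
  then obtain r where "R = [:r:]" by (rule degree_eq_zeroE)
  moreover obtain a b where "R = a * P + b * Q" using R(1) unfolding J_def by blast
  ultimately have "r \<noteq> 0 \<and> a * P + b * Q = [:r:]" using R(2) by auto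
  then show ?thesis by blast
qed

lemma uniform_limit_sum:
  fixes f :: "'k \<Rightarrow> 'a \<Rightarrow> 'b \<Rightarrow> 'c :: real_normed_vector"
  assumes "\<And>k. k \<in> I \<Longrightarrow> uniform_limit S (f k) (g k) F"
  shows "uniform_limit S (\<lambda>n x. \<Sum>k\<in>I. f k n x) (\<lambda>x. \<Sum>k\<in>I. g k x) F"
  using assms
  by (induction I rule: infinite_finite_induct) (auto intro!: uniform_limit_add uniform_limit_const)

text \<open>Two coprime curves meet only in isolated points, whereas zeros of \<open>Q\<close> are
  never isolated; boundedness of the quotient would make every zero of \<open>Q\<close> near the
  point a zero of \<open>P\<close> as well. The common factor \<open>h\<close> may vanish there and
  is removed by continuity.\<close>

lemma quotient_bounded_imp_nonzero:
  fixes h P Q :: "complex poly poly"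
  assumes cop: "coprime P Q" and Q0: "Q \<noteq> 0" and h0: "h \<noteq> 0" and e: "e > 0"
    and bd: "\<And>s t. norm (s - s0) < e \<Longrightarrow> norm (t - t0) < e \<Longrightarrow>
      norm (poly (sec (h * P) s) t) \<le> C * norm (poly (sec (h * Q) s) t)"
  shows "poly (sec Q s0) t0 \<noteq> 0"
proof
  assume zero: "poly (sec Q s0) t0 = 0"
  have cont1: "((\<lambda>s. poly (sec R s) t) \<longlongrightarrow> poly (sec R s') t) (at s')" for R t s'
    unfolding poly_sec by (intro tendsto_intros)
  have cont2: "((\<lambda>t. poly (sec R s) t) \<longlongrightarrow> poly (sec R s) t') (at t')" for R s t'
    by (intro tendsto_intros)
  \<comment> \<open>Cancel \<open>h\<close> by continuity: first in t, for those s where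
    \<open>sec h s\<close> is not the zero polynomial, then in s, where only finitely many values
    were left out.\<close>
  have bd1: "norm (poly (sec P s) t) \<le> C * norm (poly (sec Q s) t)"
    if st: "norm (s - s0) < e" "norm (t - t0) < e" "sec h s \<noteq> 0" for s t
  proof (rule tendsto_le[OF _ _ _ ])
    show "((\<lambda>t. C * norm (poly (sec Q s) t)) \<longlongrightarrow> C * norm (poly (sec Q s) t)) (at t)"
      "((\<lambda>t. norm (poly (sec P s) t)) \<longlongrightarrow> norm (poly (sec P s) t)) (at t)"
      by (intro tendsto_intros cont2)+
    have "\<forall>\<^sub>F t' in at t. t' \<notin> {t. poly (sec h s) t = 0}"
      by (intro eventually_at_not_finite poly_roots_finite st)
    moreover have "\<forall>\<^sub>F t' in at t. t' \<in> ball t0 e"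
      using st by (intro eventually_at_in_open') (auto simp: dist_norm norm_minus_commute)
    ultimately show "\<forall>\<^sub>F t' in at t. norm (poly (sec P s) t') \<le> C * norm (poly (sec Q s) t')"
    proof eventually_elim
      case (elim t')
      then have n: "norm (poly (sec h s) t') > 0" "norm (t' - t0) < e"
        by (auto simp: dist_norm norm_minus_commute)
      have "norm (poly (sec h s) t') * norm (poly (sec P s) t')
          \<le> norm (poly (sec h s) t') * (C * norm (poly (sec Q s) t'))"
        using bd[OF st(1) n(2)] by (simp add: sec_mult norm_mult mult_ac)
      then show ?case using n(1) by simp
    qed
  qed simp
  have bd2: "norm (poly (sec P s) t) \<le> C * norm (poly (sec Q s) t)"
    if st: "norm (s - s0) < e" "norm (t - t0) < e" for s t
  proof (rule tendsto_le)
    show "((\<lambda>s. C * norm (poly (sec Q s) t)) \<longlongrightarrow> C * norm (poly (sec Q s) t)) (at s)"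
      "((\<lambda>s. norm (poly (sec P s) t)) \<longlongrightarrow> norm (poly (sec P s) t)) (at s)"
      by (intro tendsto_intros cont1)+
    have "\<forall>\<^sub>F s' in at s. s' \<notin> {s. sec h s = 0}"
      by (intro eventually_at_not_finite finite_sec_eq_0 h0)
    moreover have "\<forall>\<^sub>F s' in at s. s' \<in> ball s0 e"
      using st by (intro eventually_at_in_open') (auto simp: dist_norm norm_minus_commute)
    ultimately show "\<forall>\<^sub>F s' in at s. norm (poly (sec P s') t) \<le> C * norm (poly (sec Q s') t)"
      by eventually_elim (use st in \<open>auto intro!: bd1 simp: dist_norm norm_minus_commute\<close>)
  qed simp
  have inf: "infinite (ball t0 e)"
    using e uncountable_ball countable_finite by blast
  have secQ: "sec Q s0 \<noteq> 0"
  proof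
    assume q: "sec Q s0 = 0"
    have "ball t0 e \<subseteq> {t. poly (sec P s0) t = 0}"
      using bd2[of s0] e q by (auto simp: dist_norm norm_minus_commute)
    then have "sec P s0 = 0" using inf poly_roots_finite finite_subset by blast
    then have "is_unit [:[:-s0, 1:]:]"
      using cop q by (meson coprime_common_divisor sec_eq_0_imp_dvd)
    then show False by (auto simp: is_unit_const_poly_iff is_unit_iff_degree)
  qed
  obtain a b r where r: "r \<noteq> 0" "a * P + b * Q = [:r:]"
    using coprime_imp_bezout_const[OF cop Q0] by blast
  have nz: "poly (sec Q s) t \<noteq> 0"
    if "norm (s - s0) < e" "norm (t - t0) < e" "poly r s \<noteq> 0" for s t
  proof
    assume q: "poly (sec Q s) t = 0"
    then have "poly (sec P s) t = 0" using bd2[OF that(1,2)] by simp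
    then have "poly (sec (a * P + b * Q) s) t = 0" using q by (simp add: sec_add sec_mult)
    then show False using that(3) by (simp add: r)
  qed
  have "\<forall>\<^sub>F s in at s0. s \<notin> {s. poly r s = 0}"
    by (intro eventually_at_not_finite poly_roots_finite r)
  moreover have "\<forall>\<^sub>F s in at s0. s \<in> ball s0 e"
    using e by (intro eventually_at_in_open') auto
  ultimately have ev: "\<forall>\<^sub>F s in at s0. poly r s \<noteq> 0 \<and> norm (s - s0) < e"
    by eventually_elim (auto simp: dist_norm norm_minus_commute)
  then obtain d where d: "d > 0" "\<And>s. s \<noteq> s0 \<Longrightarrow> dist s s0 < d \<Longrightarrow> poly r s \<noteq> 0 \<and> norm (s - s0) < e"
    unfolding eventually_at by auto
  \<comment> \<open>The denominator n + 2 keeps every \<open>X n\<close> strictly inside the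
    punctured disc of radius \<open>d\<close>.\<close>
  define X where "X = (\<lambda>n. s0 + complex_of_real (d * inverse (real (Suc (Suc n)))))"
  have X: "poly r (X n) \<noteq> 0 \<and> norm (X n - s0) < e" for n
  proof (rule d(2))
    have "d * inverse (real (Suc (Suc n))) \<noteq> 0" using d(1) by simp
    then show "X n \<noteq> s0" unfolding X_def by (metis add_cancel_left_right of_real_eq_0_iff)
    have "dist (X n) s0 = d * inverse (real (Suc (Suc n)))"
      using d(1) by (simp only: X_def dist_norm add_diff_cancel_left' norm_of_real) simp
    also have "\<dots> < d * 1" using d(1) by (intro mult_strict_left_mono) (auto simp: field_simps)
    also have "\<dots> = d" by simp
    finally show "dist (X n) s0 < d" .
  qed
  have Xlim: "X \<longlonglongrightarrow> s0"
  proof -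
    have "(\<lambda>n. d * inverse (real (Suc (Suc n)))) \<longlonglongrightarrow> d * 0"
      by (intro tendsto_intros LIMSEQ_Suc[OF LIMSEQ_inverse_real_of_nat])
    from tendsto_add[OF tendsto_const[of s0] tendsto_of_real[OF this]]
    show ?thesis unfolding X_def by simp
  qed
  \<comment> \<open>Hurwitz: the zero-free functions \<open>Q(X n, t)\<close> converge locally
    uniformly to \<open>Q(s0, t)\<close>, which is not constant on the disc since it vanishes at
    \<open>t0\<close> without being the zero polynomial.\<close>
  have "poly (sec Q s0) t0 \<noteq> 0"
  proof (rule Hurwitz_no_zeros[of "ball t0 e" "\<lambda>n. poly (sec Q (X n))" "poly (sec Q s0)"])
    fix K :: "complex set" assume K: "compact K" "K \<subseteq> ball t0 e"
    have "uniform_limit K (\<lambda>n t. \<Sum>k\<le>degree Q. poly (coeff Q k) (X n) * t ^ k)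
        (\<lambda>t. \<Sum>k\<le>degree Q. poly (coeff Q k) s0 * t ^ k) sequentially"
    proof (rule uniform_limit_sum)
      fix k
      have lim: "(\<lambda>n. poly (coeff Q k) (X n)) \<longlonglongrightarrow> poly (coeff Q k) s0"
        by (intro tendsto_intros Xlim)
      show "uniform_limit K (\<lambda>n t. poly (coeff Q k) (X n) * t ^ k)
          (\<lambda>t. poly (coeff Q k) s0 * t ^ k) sequentially"
      proof (rule uniform_lim_mult)
        show "uniform_limit K (\<lambda>n t. poly (coeff Q k) (X n)) (\<lambda>t. poly (coeff Q k) s0) sequentially"
          using lim unfolding uniform_limit_iff tendsto_iff by (auto elim: eventually_mono)
        show "uniform_limit K (\<lambda>n t. t ^ k) (\<lambda>t. t ^ k) sequentially"
          by (rule uniform_limit_const)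
        show "bounded ((\<lambda>t. poly (coeff Q k) s0) ` K)"
          using K(1) by (intro compact_imp_bounded compact_continuous_image continuous_intros)
        show "bounded ((\<lambda>t. t ^ k) ` K)"
          using K(1) by (intro compact_imp_bounded compact_continuous_image continuous_intros)
      qed
    qed
    then show "uniform_limit K (\<lambda>n. poly (sec Q (X n))) (poly (sec Q s0)) sequentially"
      by (simp add: poly_sec[abs_def])
  next
    show "\<not> poly (sec Q s0) constant_on ball t0 e"
    proof
      assume "poly (sec Q s0) constant_on ball t0 e"
      then have "poly (sec Q s0) t = 0" if "t \<in> ball t0 e" for t
        using that zero e unfolding constant_on_def by (metis centre_in_ball)
      then have "ball t0 e \<subseteq> {t. poly (sec Q s0) t = 0}" by blast
      then show False using inf secQ poly_roots_finite finite_subset by blast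
    qed
  qed (use e X nz in \<open>auto intro!: holomorphic_intros simp: dist_norm norm_minus_commute\<close>)
  then show False using zero by simp
qed

lemma polyf_along2:
  assumes "polyf I f"
  shows "\<exists>q. \<forall>s t. poly (sec q s) t = f (\<lambda>i. poly (sec (p i) s) t)"
  using assms
proof induction
  case (const c)
  show ?case by (rule exI[of _ "[:[:c:]:]"]) simp
next
  case (add f g)
  then obtain q r where "\<forall>s t. poly (sec q s) t = f (\<lambda>i. poly (sec (p i) s) t)"
    "\<forall>s t. poly (sec r s) t = g (\<lambda>i. poly (sec (p i) s) t)"
    by blast
  then show ?case by (intro exI[of _ "q + r"]) (simp add: sec_add)
next
  case (mult f g)
  then obtain q r where "\<forall>s t. poly (sec q s) t = f (\<lambda>i. poly (sec (p i) s) t)"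
    "\<forall>s t. poly (sec r s) t = g (\<lambda>i. poly (sec (p i) s) t)"
    by blast
  then show ?case by (intro exI[of _ "q * r"]) (simp add: sec_mult)
qed blast

section \<open>Algebraic dependence\<close>

definition monof :: "nat \<Rightarrow> (nat \<Rightarrow> nat) \<Rightarrow> (nat \<Rightarrow> complex) \<Rightarrow> complex" where
  "monof n m x = (\<Prod>i<n. x i ^ m i)"

text \<open>Extensional functions count each exponent vector once. Bounding each exponent
  separately, not the total degree, makes the number of monomials a pure power.\<close>

definition expbox :: "nat \<Rightarrow> nat \<Rightarrow> (nat \<Rightarrow> nat) set" where
  "expbox n E = PiE {..<n} (\<lambda>_. {..E})"

lemma finite_expbox [simp]: "finite (expbox n E)"
  by (simp add: expbox_def finite_PiE)

lemma card_expbox: "card (expbox n E) = (E + 1) ^ n"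
  by (simp add: expbox_def card_PiE)

lemma expbox_le: "m \<in> expbox n E \<Longrightarrow> i < n \<Longrightarrow> m i \<le> E"
  by (auto simp: expbox_def PiE_def Pi_def)

lemma monof_mult: "monof n m x * monof n m' x = monof n (\<lambda>i. m i + m' i) x"
  by (simp add: monof_def power_add prod.distrib)

text \<open>Degree at most \<open>E\<close> in each variable separately, built up by one monomial at
  a time so that \<open>pdg_coeffs\<close> is an induction.\<close>

inductive pdg :: "nat \<Rightarrow> nat \<Rightarrow> ((nat \<Rightarrow> complex) \<Rightarrow> complex) \<Rightarrow> bool" for n E where
  zero: "pdg n E (\<lambda>x. 0)"
| step: "pdg n E f \<Longrightarrow> (\<And>i. i < n \<Longrightarrow> m i \<le> E) \<Longrightarrow> pdg n E (\<lambda>x. f x + c * monof n m x)"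

lemma pdg_mono: "(\<And>i. i < n \<Longrightarrow> m i \<le> E) \<Longrightarrow> pdg n E (\<lambda>x. c * monof n m x)"
  using pdg.step[OF pdg.zero, of n m E c] by simp

lemma pdg_le: "pdg n E f \<Longrightarrow> E \<le> E' \<Longrightarrow> pdg n E' f"
  by (induction rule: pdg.induct) (auto intro!: pdg.intros intro: order.trans)

lemma pdg_add: "pdg n E g \<Longrightarrow> pdg n E f \<Longrightarrow> pdg n E (\<lambda>x. f x + g x)"
proof (induction rule: pdg.induct)
  case (step g m c)
  have "pdg n E (\<lambda>x. (f x + g x) + c * monof n m x)"
    by (rule pdg.step) (use step in auto)
  then show ?case by (simp add: add.assoc)
qed simp

lemma pdg_mult_mono:
  assumes "pdg n E f" "\<And>i. i < n \<Longrightarrow> m i \<le> E'"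
  shows "pdg n (E + E') (\<lambda>x. f x * (c * monof n m x))"
  using assms(1)
proof (induction rule: pdg.induct)
  case (step f m' c')
  have "pdg n (E + E') (\<lambda>x. f x * (c * monof n m x) + (c' * c) * monof n (\<lambda>i. m' i + m i) x)"
    by (rule pdg.step) (use step assms(2) in \<open>auto intro: add_mono\<close>)
  then show ?case by (simp add: monof_mult[symmetric] algebra_simps)
qed (simp add: pdg.zero)

lemma pdg_mult: "pdg n E' g \<Longrightarrow> pdg n E f \<Longrightarrow> pdg n (E + E') (\<lambda>x. f x * g x)"
proof (induction rule: pdg.induct)
  case zero
  show ?case by (simp add: pdg.zero)
next
  case (step g m c)
  have "pdg n (E + E') (\<lambda>x. f x * g x + f x * (c * monof n m x))"
    using step by (intro pdg_add pdg_mult_mono) auto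
  then show ?case by (simp add: algebra_simps)
qed

lemma pdg_const: "pdg n E (\<lambda>x. c)"
  using pdg_mono[of n "\<lambda>_. 0" E c] by (simp add: monof_def)

lemma pdg_var: "i < n \<Longrightarrow> pdg n (Suc E) (\<lambda>x. x i)"
proof -
  assume i: "i < n"
  have "monof n (\<lambda>j. if j = i then 1 else 0) x = x i" for x
  proof -
    have "monof n (\<lambda>j. if j = i then 1 else 0) x = (\<Prod>j<n. if j = i then x j else 1)"
      unfolding monof_def by (intro prod.cong) auto
    then show ?thesis using i by simp
  qed
  then show ?thesis using pdg_mono[of n "\<lambda>j. if j = i then 1 else 0" "Suc E" 1] by simp
qed

lemma pdg_power: "pdg n E f \<Longrightarrow> pdg n (k * E) (\<lambda>x. f x ^ k)"
proof (induction k)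
  case (Suc k)
  then have "pdg n (E + k * E) (\<lambda>x. f x * f x ^ k)" by (intro pdg_mult)
  then show ?case by simp
qed (simp add: pdg_const)

lemma pdg_prod: "finite A \<Longrightarrow> (\<And>i. i \<in> A \<Longrightarrow> pdg n E (f i)) \<Longrightarrow> pdg n (card A * E) (\<lambda>x. \<Prod>i\<in>A. f i x)"
proof (induction A rule: finite_induct)
  case (insert a A)
  then have "pdg n (E + card A * E) (\<lambda>x. f a x * (\<Prod>i\<in>A. f i x))" by (intro pdg_mult) auto
  then show ?case using insert by simp
qed (simp add: pdg_const)

lemma pdg_sum: "(\<And>i. i \<in> A \<Longrightarrow> pdg n E (f i)) \<Longrightarrow> pdg n E (\<lambda>x. \<Sum>i\<in>A. f i x)"
  by (induction A rule: infinite_finite_induct) (auto intro!: pdg_add pdg.zero)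

lemma pdg_coeffs:
  "pdg n E f \<Longrightarrow> \<exists>c. \<forall>x. f x = (\<Sum>m\<in>expbox n E. c m * monof n m x)"
proof (induction rule: pdg.induct)
  case zero
  show ?case by (rule exI[of _ "\<lambda>_. 0"]) simp
next
  case (step f m c)
  then obtain d where d: "\<And>x. f x = (\<Sum>m\<in>expbox n E. d m * monof n m x)" by blast
  define m' where "m' = restrict m {..<n}"
  have m': "m' \<in> expbox n E" using step by (auto simp: m'_def expbox_def)
  have "f x + c * monof n m x = (\<Sum>k\<in>expbox n E. (d k + (if k = m' then c else 0)) * monof n k x)" for x
  proof -
    have "c * monof n m x = c * monof n m' x"
      by (simp add: m'_def monof_def)
    also have "\<dots> = (\<Sum>k\<in>expbox n E. if k = m' then c * monof n k x else 0)"
      using m' by simp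
    finally have e: "c * monof n m x = (\<Sum>k\<in>expbox n E. if k = m' then c * monof n k x else 0)" .
    show ?thesis unfolding d e sum.distrib[symmetric]
      by (intro sum.cong) (auto simp: algebra_simps)
  qed
  then show ?case by (intro exI[of _ "\<lambda>k. d k + (if k = m' then c else 0)"]) blast
qed

text \<open>Gaussian elimination: column \<open>y\<close> is cleared with the pivot row
  \<open>x0\<close>, whose coefficient is then read off from the relation among the other
  rows.\<close>

lemma ex_linear_relation:
  fixes M :: "'x \<Rightarrow> 'y \<Rightarrow> complex"
  assumes "finite Y" "finite X" "card Y < card X"
  shows "\<exists>c. (\<exists>x\<in>X. c x \<noteq> 0) \<and> (\<forall>y\<in>Y. (\<Sum>x\<in>X. c x * M x y) = 0)"
  using assms
proof (induction Y arbitrary: X M rule: finite_induct)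
  case empty
  then have "X \<noteq> {}" by auto
  then show ?case by (intro exI[of _ "\<lambda>_. 1"]) auto
next
  case (insert y Y)
  show ?case
  proof (cases "\<forall>x\<in>X. M x y = 0")
    case True
    obtain c where "\<exists>x\<in>X. c x \<noteq> 0" "\<forall>y\<in>Y. (\<Sum>x\<in>X. c x * M x y) = 0"
      using insert.IH[of X M] insert.prems insert.hyps by auto
    then show ?thesis using True by (intro exI[of _ c]) auto
  next
    case False
    then obtain x0 where x0: "x0 \<in> X" "M x0 y \<noteq> 0" by blast
    define X' where "X' = X - {x0}"
    define M' where "M' = (\<lambda>x z. M x z - M x y / M x0 y * M x0 z)"
    have X': "finite X'" "card Y < card X'" using insert x0 by (auto simp: X'_def)
    obtain c where c: "\<exists>x\<in>X'. c x \<noteq> 0" "\<And>z. z \<in> Y \<Longrightarrow> (\<Sum>x\<in>X'. c x * M' x z) = 0"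
      using insert.IH[OF X', of M'] by blast
    define S where "S = (\<Sum>x\<in>X'. c x * M x y / M x0 y)"
    define c' where "c' = c(x0 := - S)"
    have sum: "(\<Sum>x\<in>X. c' x * M x z) = (\<Sum>x\<in>X'. c x * M' x z)" for z
    proof -
      have "(\<Sum>x\<in>X. c' x * M x z) = c' x0 * M x0 z + (\<Sum>x\<in>X'. c' x * M x z)"
        using x0 insert.prems unfolding X'_def by (intro sum.remove) auto
      also have "(\<Sum>x\<in>X'. c' x * M x z) = (\<Sum>x\<in>X'. c x * M x z)"
        by (intro sum.cong) (auto simp: c'_def X'_def)
      also have "c' x0 * M x0 z = - (\<Sum>x\<in>X'. c x * M x y / M x0 y * M x0 z)"
        by (simp add: c'_def S_def sum_distrib_right)
      finally show ?thesis by (simp add: M'_def algebra_simps sum_subtractf)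
    qed
    have "\<exists>x\<in>X. c' x \<noteq> 0" using c(1) by (auto simp: c'_def X'_def)
    moreover have "(\<Sum>x\<in>X. c' x * M x z) = 0" if "z \<in> insert y Y" for z
    proof (cases "z = y")
      case True
      then show ?thesis using x0 by (simp add: sum M'_def)
    next
      case False
      then show ?thesis using that c(2) by (simp add: sum)
    qed
    ultimately show ?thesis by blast
  qed
qed

text \<open>With the first \<open>n\<close> variables fixed, the sum is a polynomial in the last one
  that vanishes everywhere, so each of its coefficients vanishes and the induction hypothesis
  applies to them.\<close>

lemma monomials_independent:
  "(\<And>x. (\<Sum>m\<in>expbox n E. c m * monof n m x) = 0) \<Longrightarrow> m \<in> expbox n E \<Longrightarrow> c m = 0"
proof (induction n arbitrary: c m)
  case 0
  then show ?case by (simp add: expbox_def monof_def)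
next
  case (Suc n)
  have inj: "inj_on (\<lambda>(k, g). g(n := k)) ({..E} \<times> expbox n E)"
  proof (rule inj_onI, clarify)
    fix k g k' g' assume g: "g \<in> expbox n E" "g' \<in> expbox n E" and eq: "g(n := k) = g'(n := k')"
    have "g i = g' i" for i
    proof (cases "i = n")
      case True
      then show ?thesis using g by (simp add: expbox_def PiE_def extensional_def)
    next
      case False
      then show ?thesis using eq by (metis fun_upd_other)
    qed
    then show "k = k' \<and> g = g'" using eq by (auto dest: fun_cong[of _ _ n])
  qed
  have expbox: "expbox (Suc n) E = (\<lambda>(k, g). g(n := k)) ` ({..E} \<times> expbox n E)"
    unfolding expbox_def lessThan_Suc by (rule PiE_insert_eq)
  have "(\<Sum>g\<in>expbox n E. c (g(n := k)) * monof n g x) = 0" if k: "k \<le> E" for x k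
  proof -
    define p where "p = (\<Sum>k\<le>E. monom (\<Sum>g\<in>expbox n E. c (g(n := k)) * monof n g x) k)"
    have "poly p t = 0" for t
    proof -
      have m: "monof (Suc n) (g(n := k)) (x(n := t)) = monof n g x * t ^ k" for g k
        by (simp add: monof_def)
      have "0 = (\<Sum>m\<in>expbox (Suc n) E. c m * monof (Suc n) m (x(n := t)))" using Suc.prems(1) by simp
      also have "\<dots> = (\<Sum>(k, g)\<in>{..E} \<times> expbox n E. c (g(n := k)) * (monof n g x * t ^ k))"
        unfolding expbox sum.reindex[OF inj] by (intro sum.cong) (auto simp: m)
      also have "\<dots> = (\<Sum>k\<le>E. \<Sum>g\<in>expbox n E. c (g(n := k)) * (monof n g x * t ^ k))"
        by (rule sum.cartesian_product[symmetric])
      also have "\<dots> = poly p t"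
        by (simp add: p_def poly_sum poly_monom sum_distrib_right mult.assoc)
      finally show ?thesis by simp
    qed
    then have "p = 0" by (metis poly_all_0_iff_0)
    then have "coeff p k = 0" by simp
    moreover have "coeff p k = (\<Sum>g\<in>expbox n E. c (g(n := k)) * monof n g x)"
      using k by (simp add: p_def coeff_sum)
    ultimately show ?thesis by simp
  qed
  moreover obtain k g where "k \<le> E" "g \<in> expbox n E" "m = g(n := k)"
    using Suc.prems(2) unfolding expbox by auto
  ultimately show ?case using Suc.IH[of "\<lambda>g. c (g(n := k))" g] by blast
qed

lemma polyf_monof: "polyf {..<n} (monof n m)"
  unfolding monof_def by (intro polyf_prod polyf_power polyf.var) auto

text \<open>Counting: there are \<open>(K + 1) ^ (n + 1)\<close> products of powers of the
  \<open>F i\<close> and \<open>g\<close> with exponents at most \<open>K\<close>, but they all lie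
  in the span of \<open>(E + 1) ^ n\<close> monomials.\<close>

lemma algebraic_dependence:
  assumes F: "\<And>i. i < n \<Longrightarrow> pdg n D (\<lambda>x. F x i)" and g: "pdg n D g"
  shows "\<exists>d a. (\<forall>j. polyf {..<n} (a j)) \<and> (\<exists>y. a d y \<noteq> 0) \<and> (\<forall>x. (\<Sum>j\<le>d. a j (F x) * g x ^ j) = 0)"
proof -
  \<comment> \<open>\<open>E\<close> bounds the degree of the products in each variable, and
    \<open>E + 1 \<le> c * (K + 1)\<close>. With \<open>K = c ^ n\<close> this gives
    \<open>(E + 1) ^ n \<le> K * (K + 1) ^ n\<close>, which is below the number of products.\<close>
  define c where "c = (n + 1) * D + 1"
  define K where "K = c ^ n"
  define E where "E = n * (K * D) + K * D"
  have pd: "pdg n E (\<lambda>x. monof n (fst m) (F x) * g x ^ snd m)" if m: "m \<in> expbox n K \<times> {..K}" for m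
  proof -
    have "pdg n (card {..<n} * (K * D)) (\<lambda>x. \<Prod>i<n. F x i ^ fst m i)"
    proof (rule pdg_prod)
      fix i assume "i \<in> {..<n}"
      then have "fst m i \<le> K" using m expbox_le[of "fst m" n K i] by (simp add: mem_Times_iff)
      then have "fst m i * D \<le> K * D" by (rule mult_right_mono) simp
      then show "pdg n (K * D) (\<lambda>x. F x i ^ fst m i)"
        using \<open>i \<in> {..<n}\<close> by (intro pdg_le[OF pdg_power[OF F, of i "fst m i"]]) auto
    qed simp
    moreover have "pdg n (K * D) (\<lambda>x. g x ^ snd m)"
      by (rule pdg_le[OF pdg_power[OF g]]) (use m in \<open>simp add: mem_Times_iff mult_right_mono\<close>)
    ultimately show ?thesis
      using pdg_mult[of n "K * D" "\<lambda>x. g x ^ snd m" "n * (K * D)" "\<lambda>x. \<Prod>i<n. F x i ^ fst m i"]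
      by (simp add: E_def monof_def)
  qed
  have "\<exists>w. \<forall>x. monof n (fst m) (F x) * g x ^ snd m = (\<Sum>k\<in>expbox n E. w k * monof n k x)"
    if "m \<in> expbox n K \<times> {..K}" for m
    using pdg_coeffs[OF pd[OF that]] .
  then obtain w where w: "\<And>m x. m \<in> expbox n K \<times> {..K} \<Longrightarrow>
      monof n (fst m) (F x) * g x ^ snd m = (\<Sum>k\<in>expbox n E. w m k * monof n k x)"
    by metis
  have "E + 1 \<le> c * (K + 1)" by (simp add: E_def c_def algebra_simps)
  then have "(E + 1) ^ n \<le> (c * (K + 1)) ^ n" by (rule power_mono) simp
  also have "\<dots> = K * (K + 1) ^ n" by (simp only: power_mult_distrib K_def)
  also have "\<dots> < (K + 1) * (K + 1) ^ n" by simp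
  finally have card: "card (expbox n E) < card (expbox n K \<times> {..K})"
    by (simp add: card_expbox card_cartesian_product mult.commute)
  have "finite (expbox n K \<times> {..K})" by simp
  from ex_linear_relation[OF finite_expbox this card, of w]
  obtain r where r: "\<exists>m\<in>expbox n K \<times> {..K}. r m \<noteq> 0"
    "\<And>k. k \<in> expbox n E \<Longrightarrow> (\<Sum>m\<in>expbox n K \<times> {..K}. r m * w m k) = 0" by blast
  define a where "a = (\<lambda>j y. \<Sum>m\<in>expbox n K. r (m, j) * monof n m y)"
  have rel: "(\<Sum>j\<le>K. a j (F x) * g x ^ j) = 0" for x
  proof -
    have "(\<Sum>j\<le>K. a j (F x) * g x ^ j) = (\<Sum>j\<le>K. \<Sum>m\<in>expbox n K. r (m, j) * (monof n m (F x) * g x ^ j))"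
      by (simp add: a_def sum_distrib_right mult.assoc)
    also have "\<dots> = (\<Sum>m\<in>expbox n K. \<Sum>j\<le>K. r (m, j) * (monof n m (F x) * g x ^ j))"
      by (rule sum.swap)
    also have "\<dots> = (\<Sum>m\<in>expbox n K \<times> {..K}. r m * (monof n (fst m) (F x) * g x ^ snd m))"
      by (simp add: sum.cartesian_product split_def)
    also have "\<dots> = (\<Sum>m\<in>expbox n K \<times> {..K}. \<Sum>k\<in>expbox n E. r m * w m k * monof n k x)"
      by (intro sum.cong refl) (simp add: w sum_distrib_left mult.assoc del: mem_Sigma_iff)
    also have "\<dots> = (\<Sum>k\<in>expbox n E. \<Sum>m\<in>expbox n K \<times> {..K}. r m * w m k * monof n k x)"
      by (rule sum.swap)
    also have "\<dots> = (\<Sum>k\<in>expbox n E. (\<Sum>m\<in>expbox n K \<times> {..K}. r m * w m k) * monof n k x)"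
      by (simp only: sum_distrib_right)
    also have "\<dots> = 0" by (intro sum.neutral ballI) (simp only: r(2) mult_zero_left)
    finally show ?thesis .
  qed
  \<comment> \<open>The powers of \<open>g\<close> that really occur. By independence of monomials a
    nontrivial relation leaves some coefficient function nonzero; the largest such power is taken as
    the degree.\<close>
  define J where "J = {j. j \<le> K \<and> (\<exists>y. a j y \<noteq> 0)}"
  have "J \<noteq> {}"
  proof
    assume "J = {}"
    then have "a j y = 0" if "j \<le> K" for j y using that by (auto simp: J_def)
    then have "r (m, j) = 0" if "m \<in> expbox n K" "j \<le> K" for m j
      using that unfolding a_def by (intro monomials_independent[where n = n and E = K and c = "\<lambda>m. r (m, j)" and m = m]) blast+
    then show False using r(1) by auto
  qed
  moreover have "finite J" by (simp add: J_def)
  ultimately have J: "Max J \<in> J" "\<And>j. j \<in> J \<Longrightarrow> j \<le> Max J" by auto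
  have "(\<Sum>j\<le>Max J. a j (F x) * g x ^ j) = 0" for x
  proof -
    have "(\<Sum>j\<le>Max J. a j (F x) * g x ^ j) = (\<Sum>j\<le>K. a j (F x) * g x ^ j)"
    proof (rule sum.mono_neutral_left)
      show "{..Max J} \<subseteq> {..K}" using J(1) by (simp add: J_def)
      show "\<forall>j\<in>{..K} - {..Max J}. a j (F x) * g x ^ j = 0"
      proof
        fix j assume j: "j \<in> {..K} - {..Max J}"
        then have "j \<notin> J" using J(2) by auto
        then show "a j (F x) * g x ^ j = 0" using j by (simp add: J_def)
      qed
    qed simp
    then show ?thesis using rel by simp
  qed
  moreover have "polyf {..<n} (a j)" for j
    unfolding a_def by (intro polyf_sum polyf.mult polyf.const polyf_monof)
  ultimately show ?thesis using J(1) unfolding J_def by blast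
qed

section \<open>Local inversion of cubic linear maps\<close>

definition lin :: "nat \<Rightarrow> (nat \<Rightarrow> nat \<Rightarrow> complex) \<Rightarrow> (nat \<Rightarrow> complex) \<Rightarrow> nat \<Rightarrow> complex" where
  "lin N a x i = (\<Sum>j<N. a i j * x j)"

definition cubic :: "nat \<Rightarrow> (nat \<Rightarrow> nat \<Rightarrow> complex) \<Rightarrow> (nat \<Rightarrow> complex) \<Rightarrow> nat \<Rightarrow> complex" where
  "cubic N a x i = x i + lin N a x i ^ 3"

definition nrm :: "nat \<Rightarrow> (nat \<Rightarrow> complex) \<Rightarrow> real" where
  "nrm N x = (\<Sum>i<N. cmod (x i))"

text \<open>The derivative of \<open>cubic N a\<close> at \<open>x\<close> in the direction
  \<open>v\<close>.\<close>

definition jac :: "nat \<Rightarrow> (nat \<Rightarrow> nat \<Rightarrow> complex) \<Rightarrow> (nat \<Rightarrow> complex) \<Rightarrow> (nat \<Rightarrow> complex) \<Rightarrow> nat \<Rightarrow> complex" where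
  "jac N a x v i = v i + 3 * lin N a x i ^ 2 * lin N a v i"

text \<open>Invertibility of all Jacobians, put as triviality of kernels, a form that passes through
  changes of variables without determinants.\<close>

definition keller_cubic :: "nat \<Rightarrow> (nat \<Rightarrow> nat \<Rightarrow> complex) \<Rightarrow> bool" where
  "keller_cubic N a \<longleftrightarrow>
     (\<forall>x v. (\<forall>i<N. jac N a x v i = 0) \<longrightarrow> (\<forall>i<N. v i = 0))"

lemma lin_add: "lin N a (\<lambda>j. x j + y j) i = lin N a x i + lin N a y i"
  by (simp add: lin_def algebra_simps sum.distrib)

lemma lin_diff: "lin N a (\<lambda>j. x j - y j) i = lin N a x i - lin N a y i"
  by (simp add: lin_def algebra_simps sum_subtractf)

lemma lin_scale: "lin N a (ray c x) i = c * lin N a x i"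
  by (simp add: lin_def algebra_simps sum_distrib_left)

lemma lin_cong: "(\<And>j. j < N \<Longrightarrow> x j = y j) \<Longrightarrow> lin N a x i = lin N a y i"
  by (simp add: lin_def)

lemma nrm_nonneg [simp]: "nrm N x \<ge> 0"
  by (simp add: nrm_def sum_nonneg)

lemma nrm_triangle: "nrm N (\<lambda>i. x i + y i) \<le> nrm N x + nrm N y"
  unfolding nrm_def sum.distrib[symmetric] by (intro sum_mono norm_triangle_ineq)

lemma nrm_cong: "(\<And>j. j < N \<Longrightarrow> x j = y j) \<Longrightarrow> nrm N x = nrm N y"
  by (simp add: nrm_def)

lemma nrm_minus: "nrm N (\<lambda>i. x i - y i) = nrm N (\<lambda>i. y i - x i)"
  by (simp add: nrm_def norm_minus_commute)

lemma nrm_scale: "nrm N (ray c x) = cmod c * nrm N x"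
  by (simp add: nrm_def norm_mult sum_distrib_left)

lemma norm_le_nrm: "i < N \<Longrightarrow> cmod (x i) \<le> nrm N x"
  unfolding nrm_def by (rule member_le_sum) auto

lemma nrm_le: "(\<And>i. i < N \<Longrightarrow> cmod (x i) \<le> c) \<Longrightarrow> nrm N x \<le> real N * c"
  unfolding nrm_def using sum_bounded_above[of "{..<N}" "\<lambda>i. cmod (x i)" c] by simp

lemma norm_matvec_le:
  assumes "\<And>i j. i < N \<Longrightarrow> j < N \<Longrightarrow> cmod (b i j) \<le> K" "i < N"
  shows "cmod (lin N b x i) \<le> K * nrm N x"
proof -
  have "cmod (lin N b x i) \<le> (\<Sum>j<N. cmod (b i j * x j))"
    unfolding lin_def by (rule norm_sum)
  also have "\<dots> \<le> (\<Sum>j<N. K * cmod (x j))"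
    using assms by (intro sum_mono) (auto simp: norm_mult intro!: mult_right_mono)
  finally show ?thesis by (simp add: nrm_def sum_distrib_left)
qed

lemma ex_entry_bound:
  fixes a :: "nat \<Rightarrow> nat \<Rightarrow> complex"
  shows "\<exists>C>0. \<forall>i<N. \<forall>j<N. cmod (a i j) \<le> C"
proof (intro exI[of _ "1 + (\<Sum>i<N. \<Sum>j<N. cmod (a i j))"] conjI allI impI)
  show "0 < 1 + (\<Sum>i<N. \<Sum>j<N. cmod (a i j))"
    by (intro add_pos_nonneg sum_nonneg) auto
  fix i j assume "i < N" "j < N"
  then have "cmod (a i j) \<le> (\<Sum>j<N. cmod (a i j))" "(\<Sum>j<N. cmod (a i j)) \<le> (\<Sum>i<N. \<Sum>j<N. cmod (a i j))"
    by (auto intro!: member_le_sum[of _ "{..<N}"] sum_nonneg)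
  then show "cmod (a i j) \<le> 1 + (\<Sum>i<N. \<Sum>j<N. cmod (a i j))" by linarith
qed

text \<open>Picard iteration from 0. Since steps halve, the iterates stay within
  \<open>2 * c * (1 - (1/2) ^ k)\<close>, hence inside the ball of radius \<open>d\<close> on which
  \<open>T\<close> contracts. Limits are taken coordinatewise, as only the first \<open>N\<close>
  entries are controlled.\<close>

lemma contraction_fixed_point:
  assumes d: "d > 0" and contr: "\<And>u u'. nrm N u \<le> d \<Longrightarrow> nrm N u' \<le> d \<Longrightarrow>
      nrm N (\<lambda>i. T u i - T u' i) \<le> nrm N (\<lambda>i. u i - u' i) / 2"
    and T0: "2 * nrm N (T (\<lambda>i. 0)) \<le> d"
  shows "\<exists>u. nrm N u \<le> 2 * nrm N (T (\<lambda>i. 0)) \<and> (\<forall>i<N. T u i = u i)"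
proof -
  define c where "c = nrm N (T (\<lambda>i. 0))"
  have c0: "c \<ge> 0" by (simp add: c_def)
  define u where "u = rec_nat (\<lambda>i. 0) (\<lambda>_. T)"
  have u0: "u 0 = (\<lambda>i. 0)" and uS: "u (Suc k) = T (u k)" for k by (simp_all add: u_def)
  have *: "nrm N (u k) \<le> 2 * c * (1 - (1/2) ^ k) \<and> nrm N (\<lambda>i. u (Suc k) i - u k i) \<le> c * (1/2) ^ k" for k
  proof (induction k)
    case 0
    show ?case by (simp add: u0 uS c_def) (simp add: nrm_def)
  next
    case (Suc k)
    have "nrm N (u (Suc k)) = nrm N (\<lambda>i. u k i + (u (Suc k) i - u k i))" by simp
    also have "\<dots> \<le> nrm N (u k) + nrm N (\<lambda>i. u (Suc k) i - u k i)" by (rule nrm_triangle)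
    also have "\<dots> \<le> 2 * c * (1 - (1/2) ^ Suc k)" using Suc by (simp add: algebra_simps)
    finally have 1: "nrm N (u (Suc k)) \<le> 2 * c * (1 - (1/2) ^ Suc k)" .
    have le: "2 * c * (1 - (1/2) ^ m) \<le> d" for m
    proof -
      have "2 * c * (1 - (1/2) ^ m) \<le> 2 * c * 1" using c0 by (intro mult_left_mono) auto
      then show ?thesis using T0 by (simp add: c_def)
    qed
    have "nrm N (\<lambda>i. T (u (Suc k)) i - T (u k) i) \<le> nrm N (\<lambda>i. u (Suc k) i - u k i) / 2"
      using 1 le[of "Suc k"] le[of k] Suc by (intro contr) linarith+
    then show ?case using 1 Suc by (simp add: uS)
  qed
  have conv: "convergent (\<lambda>k. u k i)" if "i < N" for i
  proof -
    have "summable (\<lambda>k. u (Suc k) i - u k i)"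
    proof (rule summable_comparison_test')
      show "summable (\<lambda>k. c * (1/2) ^ k)" by (intro summable_mult summable_geometric) simp
      show "norm (u (Suc k) i - u k i) \<le> c * (1/2) ^ k" for k
        using norm_le_nrm[OF that, of "\<lambda>i. u (Suc k) i - u k i"] *[of k] by linarith
    qed
    then have "convergent (\<lambda>n. \<Sum>k<n. u (Suc k) i - u k i)" by (simp add: summable_iff_convergent)
    then show ?thesis unfolding sum_lessThan_telescope[of "\<lambda>k. u k i"] by (simp add: u0)
  qed
  define v where "v = (\<lambda>i. lim (\<lambda>k. u k i))"
  have lim: "(\<lambda>k. u k i) \<longlonglongrightarrow> v i" if "i < N" for i
    using conv[OF that] by (simp add: v_def convergent_LIMSEQ_iff)
  have le_c: "nrm N (u k) \<le> 2 * c" for k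
  proof -
    have "2 * c * (1 - (1/2) ^ k) \<le> 2 * c * 1" using c0 by (intro mult_left_mono) auto
    then show ?thesis using *[of k] by simp
  qed
  have "(\<lambda>k. nrm N (u k)) \<longlonglongrightarrow> nrm N v"
    unfolding nrm_def by (intro tendsto_intros lim) auto
  then have v: "nrm N v \<le> 2 * c"
    by (rule LIMSEQ_le_const2) (use le_c in auto)
  have lim0: "(\<lambda>k. nrm N (\<lambda>i. u k i - v i)) \<longlonglongrightarrow> 0"
  proof -
    have "(\<lambda>k. \<Sum>i<N. cmod (u k i - v i)) \<longlonglongrightarrow> (\<Sum>i<N. cmod (v i - v i))"
      by (intro tendsto_intros lim) auto
    then show ?thesis by (simp add: nrm_def)
  qed
  have "nrm N (\<lambda>i. T v i - v i) \<le> nrm N (\<lambda>i. u k i - v i) / 2 + nrm N (\<lambda>i. u (Suc k) i - v i)" for k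
  proof -
    have "nrm N (\<lambda>i. T v i - v i) = nrm N (\<lambda>i. (T v i - T (u k) i) + (u (Suc k) i - v i))"
      by (simp add: uS)
    also have "\<dots> \<le> nrm N (\<lambda>i. T v i - T (u k) i) + nrm N (\<lambda>i. u (Suc k) i - v i)"
      by (rule nrm_triangle)
    also have "nrm N (\<lambda>i. T v i - T (u k) i) \<le> nrm N (\<lambda>i. v i - u k i) / 2"
      using v le_c[of k] T0 by (intro contr) (auto simp: c_def)
    finally show ?thesis by (simp add: nrm_minus[of N v])
  qed
  moreover have "(\<lambda>k. nrm N (\<lambda>i. u k i - v i) / 2 + nrm N (\<lambda>i. u (Suc k) i - v i)) \<longlonglongrightarrow> 0"
    using tendsto_add[OF tendsto_divide_zero[OF lim0] LIMSEQ_Suc[OF lim0]] by simp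
  ultimately have "nrm N (\<lambda>i. T v i - v i) \<le> 0"
    using LIMSEQ_le_const by blast
  then have "cmod (T v i - v i) \<le> 0" if "i < N" for i
    using norm_le_nrm[OF that, of "\<lambda>i. T v i - v i"] by linarith
  then show ?thesis using v by (auto simp: c_def)
qed

text \<open>The determinant of 1 + c m is a polynomial in c without zeros, hence constant by the
  fundamental theorem of algebra, and equals 1 at c = 0.\<close>

lemma det_eq_1_if_kernels_trivial:
  fixes m :: "nat \<Rightarrow> nat \<Rightarrow> complex"
  assumes ker: "\<And>c v. (\<And>i. i < N \<Longrightarrow> v i + c * lin N m v i = 0) \<Longrightarrow> \<forall>i<N. v i = 0"
  shows "det (mat N N (\<lambda>(i, j). (if i = j then 1 else 0) + m i j)) = 1"
proof -
  define M where "M = (\<lambda>c. mat N N (\<lambda>(i, j). (if i = j then 1 else 0) + c * m i j))"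
  define P where "P = mat N N (\<lambda>(i, j). [:if i = j then 1 else 0, m i j:])"
  have MP: "poly (det P) c = det (M c)" for c
  proof -
    have s: "poly (signof p) c = signof p" for p :: "nat \<Rightarrow> nat" by (simp add: sign_def)
    have "poly (det P) c = (\<Sum>p\<in>{p. p permutes {0..<N}}. signof p * (\<Prod>i = 0..<N. poly (P $$ (i, p i)) c))"
    proof -
      have "P \<in> carrier_mat N N" by (simp add: P_def)
      from det_def'[OF this] show ?thesis by (simp only: poly_sum poly_mult poly_prod s)
    qed
    also have "\<dots> = (\<Sum>p\<in>{p. p permutes {0..<N}}. signof p * (\<Prod>i = 0..<N. M c $$ (i, p i)))"
    proof (intro sum.cong prod.cong refl arg_cong2[of _ _ _ _ "(*)"])
      fix p i assume "p \<in> {p. p permutes {0..<N}}" "i \<in> {0..<N}"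
      then have "i < N" "p i < N" using permutes_in_image[of p "{0..<N}" i] by auto
      then show "poly (P $$ (i, p i)) c = M c $$ (i, p i)" by (simp add: P_def M_def)
    qed
    also have "\<dots> = det (M c)" by (rule det_def'[symmetric]) (simp add: M_def)
    finally show ?thesis .
  qed
  have nz: "det (M c) \<noteq> 0" for c
  proof
    assume "det (M c) = 0"
    moreover have carr: "M c \<in> carrier_mat N N" by (simp add: M_def)
    ultimately obtain v where v: "v \<in> carrier_vec N" "v \<noteq> 0\<^sub>v N" "M c *\<^sub>v v = 0\<^sub>v N"
      using det_0_iff_vec_prod_zero by blast
    have "v $ i + c * lin N m (($) v) i = 0" if i: "i < N" for i
    proof -
      have "0 = (M c *\<^sub>v v) $ i" using v(3) i by simp
      also have "\<dots> = (\<Sum>j<N. ((if i = j then 1 else 0) + c * m i j) * v $ j)"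
        using i v(1) by (simp add: M_def scalar_prod_def atLeast0LessThan)
      also have "\<dots> = (\<Sum>j<N. if i = j then v $ j else 0) + c * lin N m (($) v) i"
        unfolding lin_def sum_distrib_left sum.distrib[symmetric]
        by (intro sum.cong) (auto simp: algebra_simps)
      also have "(\<Sum>j<N. if i = j then v $ j else 0) = v $ i" using i by simp
      finally show ?thesis by simp
    qed
    from ker[of "($) v" c, OF this] have "v = 0\<^sub>v N" using v(1) by auto
    then show False using v(2) by simp
  qed
  have "constant (poly (det P))"
    using fundamental_theorem_of_algebra nz by (metis MP)
  then have "poly (det P) 1 = poly (det P) 0" by (auto simp: constant_def)
  then have "det (M 1) = det (M 0)" by (simp add: MP)
  also have "M 0 = 1\<^sub>m N" by (rule eq_matI) (auto simp: M_def)
  finally show ?thesis by (simp add: M_def)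
qed

lemma norm_det_le:
  fixes A :: "complex mat"
  assumes A: "A \<in> carrier_mat n n" and C: "\<And>i j. i < n \<Longrightarrow> j < n \<Longrightarrow> cmod (A $$ (i, j)) \<le> C"
  shows "cmod (det A) \<le> fact n * C ^ n"
proof -
  have "cmod (det A) \<le> (\<Sum>p\<in>{p. p permutes {0..<n}}. cmod (signof p * (\<Prod>i = 0..<n. A $$ (i, p i))))"
    unfolding det_def'[OF A] by (rule norm_sum)
  also have "\<dots> \<le> (\<Sum>p\<in>{p. p permutes {0..<n}}. C ^ n)"
  proof (rule sum_mono)
    fix p assume p: "p \<in> {p. p permutes {0..<n}}"
    have "cmod (signof p * (\<Prod>i = 0..<n. A $$ (i, p i))) = (\<Prod>i = 0..<n. cmod (A $$ (i, p i)))"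
      by (simp add: norm_mult prod_norm sign_def)
    also have "\<dots> \<le> (\<Prod>i = 0..<n. C)"
      using p permutes_in_image[of p "{0..<n}"] by (intro prod_mono) (fastforce intro!: C)
    finally show "cmod (signof p * (\<Prod>i = 0..<n. A $$ (i, p i))) \<le> C ^ n" by simp
  qed
  also have "\<dots> = fact n * C ^ n" by (simp add: card_permutations)
  finally show ?thesis .
qed

text \<open>Determinant 1 makes the adjugate the inverse; its entries are cofactors up to sign and
  therefore bounded uniformly on the ball of radius \<open>B\<close>.\<close>

lemma jac_inverse:
  assumes kel: "keller_cubic N a"
  shows "\<exists>K>0. \<forall>x. nrm N x \<le> B \<longrightarrow> (\<exists>b. (\<forall>i<N. \<forall>j<N. cmod (b i j) \<le> K) \<and>
    (\<forall>v. \<forall>i<N. lin N b (jac N a x v) i = v i) \<and> (\<forall>w. \<forall>i<N. jac N a x (lin N b w) i = w i))"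
proof -
  obtain A where A: "A > 0" "\<And>i j. i < N \<Longrightarrow> j < N \<Longrightarrow> cmod (a i j) \<le> A"
    using ex_entry_bound[of N a] by blast
  \<comment> \<open>\<open>C\<close> bounds the entries of the Jacobian matrix; a cofactor is a sum
    of (N - 1)! products of N - 1 entries. The 1 in \<open>K\<close> ensures positivity.\<close>
  define C where "C = 1 + 3 * (A * B) ^ 2 * A"
  have C0: "C \<ge> 0" using A(1) by (simp add: C_def)
  define K where "K = 1 + fact (N - 1) * C ^ (N - 1)"
  have "\<exists>b. (\<forall>i<N. \<forall>j<N. cmod (b i j) \<le> K) \<and>
    (\<forall>v. \<forall>i<N. lin N b (jac N a x v) i = v i) \<and> (\<forall>w. \<forall>i<N. jac N a x (lin N b w) i = w i)"
    if x: "nrm N x \<le> B" for x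
  proof -
    define m where "m = (\<lambda>i j. 3 * lin N a x i ^ 2 * a i j)"
    define M where "M = mat N N (\<lambda>(i, j). (if i = j then 1 else 0) + m i j)"
    have linm: "lin N m v i = 3 * lin N a x i ^ 2 * lin N a v i" for v i
      by (simp add: lin_def[of N m] lin_def[of N a v] sum_distrib_left mult_ac) (simp add: m_def mult_ac)
    have M: "M \<in> carrier_mat N N" by (simp add: M_def)
    have detM: "det M = 1"
      unfolding M_def
    proof (rule det_eq_1_if_kernels_trivial)
      fix c v assume v: "\<And>i. i < N \<Longrightarrow> v i + c * lin N m v i = 0"
      \<comment> \<open>Scaling the point by a square root of \<open>c\<close> multiplies the
        quadratic factor by \<open>c\<close>, so the Keller condition covers the whole pencil 1 + c
        m.\<close>
      have "jac N a (\<lambda>j. csqrt c * x j) v i = v i + c * lin N m v i" for i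
        by (simp add: jac_def lin_scale linm power_mult_distrib)
      then show "\<forall>i<N. v i = 0" using kel v unfolding keller_cubic_def by metis
    qed
    have jacM: "jac N a x v i = (M *\<^sub>v vec N v) $ i" if "i < N" for v i
    proof -
      have "(M *\<^sub>v vec N v) $ i = (\<Sum>j<N. ((if i = j then 1 else 0) + m i j) * v j)"
        using that by (simp add: M_def scalar_prod_def atLeast0LessThan)
      also have "\<dots> = (\<Sum>j<N. if i = j then v j else 0) + lin N m v i"
        unfolding lin_def sum.distrib[symmetric] by (intro sum.cong) (auto simp: algebra_simps)
      also have "(\<Sum>j<N. if i = j then v j else 0) = v i" using that by simp
      finally show ?thesis by (simp add: jac_def linm)
    qed
    define b where "b = (\<lambda>i j. adj_mat M $$ (i, j))"
    have adj: "adj_mat M \<in> carrier_mat N N" "M * adj_mat M = 1\<^sub>m N" "adj_mat M * M = 1\<^sub>m N"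
    proof -
      have "(1 :: complex) \<cdot>\<^sub>m 1\<^sub>m N = 1\<^sub>m N" by (rule eq_matI) auto
      then show "adj_mat M \<in> carrier_mat N N" "M * adj_mat M = 1\<^sub>m N" "adj_mat M * M = 1\<^sub>m N"
        using adj_mat[OF M] by (simp_all add: detM)
    qed
    have linb: "lin N b w i = (adj_mat M *\<^sub>v vec N w) $ i" if "i < N" for w i
      using that adj(1) by (simp add: lin_def b_def scalar_prod_def atLeast0LessThan)
    have "lin N b (jac N a x v) i = v i" if i: "i < N" for v i
    proof -
      have "vec N (jac N a x v) = M *\<^sub>v vec N v" using jacM M by (intro eq_vecI) auto
      then have "lin N b (jac N a x v) i = (adj_mat M *\<^sub>v (M *\<^sub>v vec N v)) $ i" by (simp add: linb i)
      also have "adj_mat M *\<^sub>v (M *\<^sub>v vec N v) = (adj_mat M * M) *\<^sub>v vec N v"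
        by (rule assoc_mult_mat_vec[symmetric, OF adj(1) M]) simp
      finally show ?thesis by (simp add: adj i)
    qed
    moreover have "jac N a x (lin N b w) i = w i" if i: "i < N" for w i
    proof -
      have "vec N (lin N b w) = adj_mat M *\<^sub>v vec N w" using linb adj(1) by (intro eq_vecI) auto
      then have "jac N a x (lin N b w) i = (M *\<^sub>v (adj_mat M *\<^sub>v vec N w)) $ i" by (simp add: jacM i)
      also have "M *\<^sub>v (adj_mat M *\<^sub>v vec N w) = (M * adj_mat M) *\<^sub>v vec N w"
        by (rule assoc_mult_mat_vec[symmetric, OF M adj(1)]) simp
      finally show ?thesis by (simp add: adj i)
    qed
    moreover have "cmod (b i j) \<le> K" if ij: "i < N" "j < N" for i j
    proof -
      have ent: "cmod (M $$ (k, l)) \<le> C" if kl: "k < N" "l < N" for k l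
      proof -
        have "cmod (lin N a x k) \<le> A * nrm N x" using A kl by (intro norm_matvec_le) auto
        also have "\<dots> \<le> A * B" using A(1) x by (intro mult_left_mono) auto
        finally have "cmod (m k l) \<le> 3 * (A * B) ^ 2 * A"
          using A kl by (auto simp: m_def norm_mult norm_power intro!: mult_mono power_mono)
        then have "cmod ((if k = l then 1 else 0) + m k l) \<le> C"
          unfolding C_def by (intro order.trans[OF norm_triangle_ineq] add_mono) auto
        then show ?thesis using kl by (simp add: M_def)
      qed
      have "cmod (b i j) = cmod (det (mat_delete M j i))"
        using ij M by (simp add: b_def adj_mat_def cofactor_def norm_mult norm_power)
      also have "\<dots> \<le> fact (N - 1) * C ^ (N - 1)"
      proof (rule norm_det_le)
        show "mat_delete M j i \<in> carrier_mat (N - 1) (N - 1)" by (rule mat_delete_carrier[OF M])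
        show "cmod (mat_delete M j i $$ (k, l)) \<le> C" if "k < N - 1" "l < N - 1" for k l
          using that M by (auto simp: mat_delete_def intro!: ent)
      qed
      finally show ?thesis by (simp add: K_def)
    qed
    ultimately show ?thesis by (intro exI[of _ b]) simp
  qed
  moreover have "K > 0" unfolding K_def using C0 by (intro add_pos_nonneg) auto
  ultimately show ?thesis by blast
qed

lemma cubic_expand:
  "cubic N a (\<lambda>j. x j + u j) i = cubic N a x i + jac N a x u i
     + (3 * lin N a x i * lin N a u i ^ 2 + lin N a u i ^ 3)"
  by (simp add: cubic_def jac_def lin_add power3_eq_cube power2_eq_square algebra_simps)

text \<open>Newton's method with the Jacobian frozen at \<open>x\<close>: \<open>u\<close> is a
  fixed point of \<open>u \<mapsto> b (h - q u)\<close>, where \<open>b\<close> inverts the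
  Jacobian, \<open>h = y - F x\<close>, and \<open>q\<close> collects the terms of degree 2 and 3 in
  \<open>u\<close>. The gain over the inverse function theorem is uniformity: \<open>K\<close> and
  \<open>e\<close> depend on \<open>x\<close> through the bound \<open>B\<close> only.\<close>

lemma cubic_local_inverse:
  assumes kel: "keller_cubic N a"
  shows "\<exists>K>0. \<exists>e>0. \<forall>x y. nrm N x \<le> B \<longrightarrow> nrm N (\<lambda>i. y i - cubic N a x i) \<le> e \<longrightarrow>
    (\<exists>u. (\<forall>i<N. cubic N a (\<lambda>j. x j + u j) i = y i) \<and> nrm N u \<le> K * nrm N (\<lambda>i. y i - cubic N a x i))"
proof (cases "B \<ge> 0")
  case False
  then have "\<not> nrm N x \<le> B" for x using nrm_nonneg[of N x] by linarith
  then show ?thesis by (intro exI[of _ 1]) (auto intro: exI[of _ "1::real"])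
next
  case B: True
  obtain A where A: "A > 0" "\<And>i j. i < N \<Longrightarrow> j < N \<Longrightarrow> cmod (a i j) \<le> A"
    using ex_entry_bound[of N a] by blast
  obtain K where K: "K > 0" and inv: "\<And>x. nrm N x \<le> B \<Longrightarrow> \<exists>b. (\<forall>i<N. \<forall>j<N. cmod (b i j) \<le> K) \<and>
    (\<forall>v. \<forall>i<N. lin N b (jac N a x v) i = v i) \<and> (\<forall>w. \<forall>i<N. jac N a x (lin N b w) i = w i)"
    using jac_inverse[OF kel, of B] by blast
  \<comment> \<open>\<open>L * d\<close> will be a Lipschitz constant of each coordinate of
    \<open>q\<close> on the ball of radius \<open>d \<le> 1\<close>, and
    \<open>c * d \<le> 1 / 2\<close> one of \<open>T\<close>; the two factors \<open>real N\<close>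
    in \<open>c\<close> come from the sum norm.\<close>
  define L where "L = A * (6 * (A * B) * A + 3 * A ^ 2)"
  have L: "L \<ge> 0" using A(1) B by (simp add: L_def)
  define c where "c = real N * K * (real N * L)"
  define d where "d = min 1 (1 / (2 * c + 1))"
  have c: "c \<ge> 0" using K L by (simp add: c_def)
  have d: "d > 0" "d \<le> 1" "c * d \<le> 1 / 2"
    using c by (auto simp: d_def min_def field_simps)
  define K' where "K' = 2 * (real N * K) + 1"
  have K': "K' > 0" using K by (simp add: K'_def add_nonneg_pos)
  have main: "\<exists>u. (\<forall>i<N. cubic N a (\<lambda>j. x j + u j) i = y i) \<and> nrm N u \<le> K' * nrm N (\<lambda>i. y i - cubic N a x i)"
    if x: "nrm N x \<le> B" and y: "nrm N (\<lambda>i. y i - cubic N a x i) \<le> d / K'" for x y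
  proof -
    obtain b where b: "\<And>i j. i < N \<Longrightarrow> j < N \<Longrightarrow> cmod (b i j) \<le> K"
      "\<And>w i. i < N \<Longrightarrow> jac N a x (lin N b w) i = w i" using inv[OF x] by blast
    define h where "h = (\<lambda>i. y i - cubic N a x i)"
    define q where "q = (\<lambda>u i. 3 * lin N a x i * lin N a u i ^ 2 + lin N a u i ^ 3)"
    define T where "T = (\<lambda>u. lin N b (\<lambda>i. h i - q u i))"
    have nb: "nrm N (lin N b w) \<le> real N * K * nrm N w" for w
    proof -
      have "nrm N (lin N b w) \<le> real N * (K * nrm N w)"
        by (rule nrm_le) (use b(1) in \<open>auto intro!: norm_matvec_le\<close>)
      then show ?thesis by (simp add: mult_ac)
    qed
    have la: "cmod (lin N a w i) \<le> A * nrm N w" if "i < N" for w i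
      using A that by (intro norm_matvec_le) auto
    have qd: "cmod (q u i - q u' i) \<le> L * d * nrm N (\<lambda>i. u i - u' i)"
      if u: "nrm N u \<le> d" "nrm N u' \<le> d" and i: "i < N" for u u' i
    proof -
      define p r s where "p = lin N a u i" and "r = lin N a u' i" and "s = lin N a x i"
      have p: "cmod p \<le> A * d" and r: "cmod r \<le> A * d" and s: "cmod s \<le> A * B"
        unfolding p_def r_def s_def using u x A(1)
        by (auto intro!: order.trans[OF la[OF i]] mult_left_mono)
      have pr: "cmod (p - r) \<le> A * nrm N (\<lambda>i. u i - u' i)"
        unfolding p_def r_def lin_diff[symmetric] by (rule la[OF i])
      have "q u i - q u' i = (p - r) * (3 * s * (p + r) + (p * p + p * r + r * r))"
        by (simp add: q_def p_def r_def s_def power2_eq_square power3_eq_cube algebra_simps)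
      then have "cmod (q u i - q u' i) = cmod (p - r) * cmod (3 * s * (p + r) + (p * p + p * r + r * r))"
        by (simp add: norm_mult)
      also have "cmod (3 * s * (p + r) + (p * p + p * r + r * r)) \<le> 3 * (A * B) * (A * d + A * d)
          + ((A * d) * (A * d) + (A * d) * (A * d) + (A * d) * (A * d))"
      proof -
        have "cmod (p + r) \<le> A * d + A * d"
          using p r by (intro order.trans[OF norm_triangle_ineq] add_mono)
        then have "(3 * cmod s) * cmod (p + r) \<le> (3 * (A * B)) * (A * d + A * d)"
          using s A(1) B by (intro mult_mono) auto
        then have 1: "cmod (3 * s * (p + r)) \<le> 3 * (A * B) * (A * d + A * d)"
          by (simp only: norm_mult norm_numeral)
        have 2: "cmod (v * w) \<le> (A * d) * (A * d)" if "cmod v \<le> A * d" "cmod w \<le> A * d" for v w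
          unfolding norm_mult using that A(1) d(1) by (intro mult_mono) auto
        show ?thesis
          by (intro order.trans[OF norm_triangle_ineq] add_mono 1 2 p r)
      qed
      also have "\<dots> = (6 * (A * B) * A + 3 * A ^ 2 * d) * d" by (simp add: power2_eq_square algebra_simps)
      also have "\<dots> \<le> (6 * (A * B) * A + 3 * A ^ 2 * 1) * d"
        using d by (intro mult_right_mono add_left_mono mult_left_mono) auto
      finally have "cmod (q u i - q u' i) \<le> cmod (p - r) * ((6 * (A * B) * A + 3 * A ^ 2) * d)"
        by (simp add: mult_left_mono)
      also have "\<dots> \<le> (A * nrm N (\<lambda>i. u i - u' i)) * ((6 * (A * B) * A + 3 * A ^ 2) * d)"
        using A(1) B d(1) by (intro mult_right_mono pr) auto
      finally show ?thesis by (simp add: L_def mult_ac)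
    qed
    have T0: "nrm N (T (\<lambda>i. 0)) \<le> real N * K * nrm N h"
    proof -
      have "T (\<lambda>i. 0) = lin N b h" by (simp add: T_def q_def lin_def[of N a "\<lambda>_. 0"])
      then show ?thesis by (simp add: nb)
    qed
    have "\<exists>u. nrm N u \<le> 2 * nrm N (T (\<lambda>i. 0)) \<and> (\<forall>i<N. T u i = u i)"
    proof (rule contraction_fixed_point[OF d(1)])
      have "2 * nrm N (T (\<lambda>i. 0)) \<le> 2 * (real N * K * nrm N h)" using T0 by simp
      also have "\<dots> \<le> K' * nrm N h" by (simp add: K'_def algebra_simps)
      also have "\<dots> \<le> d" using y K' by (simp add: h_def field_simps)
      finally show "2 * nrm N (T (\<lambda>i. 0)) \<le> d" .
    next
      fix u u' assume u: "nrm N u \<le> d" "nrm N u' \<le> d"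
      have "nrm N (\<lambda>i. T u i - T u' i) = nrm N (lin N b (\<lambda>i. q u' i - q u i))"
        by (simp add: T_def lin_diff[symmetric])
      also have "\<dots> \<le> real N * K * nrm N (\<lambda>i. q u' i - q u i)" by (rule nb)
      also have "\<dots> \<le> real N * K * (real N * (L * d * nrm N (\<lambda>i. u i - u' i)))"
        using K qd[OF u] by (intro mult_left_mono nrm_le) (auto simp: norm_minus_commute)
      also have "\<dots> = (c * d) * nrm N (\<lambda>i. u i - u' i)" by (simp add: c_def mult_ac)
      also have "\<dots> \<le> 1 / 2 * nrm N (\<lambda>i. u i - u' i)" by (intro mult_right_mono d) simp
      finally show "nrm N (\<lambda>i. T u i - T u' i) \<le> nrm N (\<lambda>i. u i - u' i) / 2" by simp
    qed
    then obtain u where u: "nrm N u \<le> 2 * nrm N (T (\<lambda>i. 0))" "\<And>i. i < N \<Longrightarrow> T u i = u i" by blast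
    have "cubic N a (\<lambda>j. x j + u j) i = y i" if i: "i < N" for i
    proof -
      have "jac N a x u i = jac N a x (T u) i"
        using u(2) i by (simp add: jac_def lin_def[of N a u] lin_def[of N a "T u"])
      also have "\<dots> = h i - q u i" unfolding T_def by (rule b(2)[OF i])
      finally show ?thesis unfolding cubic_expand by (simp add: h_def q_def)
    qed
    moreover have "nrm N u \<le> K' * nrm N h"
    proof -
      have "nrm N u \<le> 2 * (real N * K) * nrm N h" using u(1) T0 by simp
      also have "\<dots> \<le> K' * nrm N h" unfolding K'_def by (intro mult_right_mono) auto
      finally show ?thesis .
    qed
    ultimately show ?thesis unfolding h_def by blast
  qed
  have "d / K' > 0" using d K' by simp
  with K' main show ?thesis by blast
qed

section \<open>The inverse of an injective map along lines\<close>

lemma polyf_prod_nonzero: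
  assumes "finite A" "\<And>i. i \<in> A \<Longrightarrow> polyf I (f i)" "\<And>i. i \<in> A \<Longrightarrow> \<exists>y. f i y \<noteq> 0"
  shows "\<exists>y. (\<Prod>i\<in>A. f i y) \<noteq> 0"
  using assms
proof (induction A rule: finite_induct)
  case (insert i A)
  then have "\<exists>y. (\<Prod>i\<in>A. f i y) \<noteq> 0" "\<exists>y. f i y \<noteq> 0" "polyf I (f i)" "polyf I (\<lambda>y. \<Prod>i\<in>A. f i y)"
    by auto
  then have "\<exists>y. f i y * (\<Prod>i\<in>A. f i y) \<noteq> 0" using polyf_mult_eq_0 by blast
  then show ?case using insert.hyps by simp
qed simp

lemma polyf_growth:
  assumes "polyf I f"
  shows "\<exists>M. \<forall>v. \<exists>C. \<forall>t. norm t \<ge> 1 \<longrightarrow> norm (f (ray t v)) \<le> C * norm t ^ M"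
proof -
  obtain M H where H: "\<And>v. degree (H v) \<le> M" "\<And>v t. poly (H v) t = f (ray t v)"
    using polyf_line[OF assms] by blast
  have "norm (f (ray t v)) \<le> (\<Sum>k\<le>degree (H v). norm (coeff (H v) k)) * norm t ^ M"
    if t: "norm t \<ge> 1" for t v
  proof -
    have "norm (f (ray t v)) \<le> (\<Sum>k\<le>degree (H v). norm (coeff (H v) k * t ^ k))"
      unfolding H(2)[symmetric] poly_altdef by (rule norm_sum)
    also have "\<dots> \<le> (\<Sum>k\<le>degree (H v). norm (coeff (H v) k) * norm t ^ M)"
      using H(1)[of v] t
      by (intro sum_mono) (auto simp: norm_mult norm_power intro!: mult_left_mono power_increasing)
    finally show ?thesis by (simp add: sum_distrib_right)
  qed
  then show ?thesis by (intro exI[of _ M]) blast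
qed

lemma polyf_line_tendsto:
  assumes "polyf I f"
  shows "((\<lambda>t. f (ray t v)) \<longlongrightarrow> f (ray s v)) (at s within S)"
proof -
  obtain M H where H: "\<And>v t. poly (H v) t = f (ray t v)"
    using polyf_line[OF assms] by blast
  have "((\<lambda>t. poly (H v) t) \<longlongrightarrow> poly (H v) s) (at s within S)" by (intro tendsto_intros)
  then show ?thesis by (simp add: H)
qed

lemma polyf_line_holomorphic:
  assumes "polyf I f"
  shows "(\<lambda>t. f (ray t v)) holomorphic_on S"
proof -
  obtain M H where H: "\<And>v t. poly (H v) t = f (ray t v)"
    using polyf_line[OF assms] by blast
  have "(\<lambda>t. poly (H v) t) holomorphic_on S" by (intro holomorphic_intros)
  then show ?thesis by (simp only: H)
qed

text \<open>If |g| > 1, divide the equation by g^(d - 1); otherwise the bound is immediate. The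
  leading coefficient stays on the left so that the estimate can be multiplied up to one by
  polynomials. Degree 0 contradicts the two hypotheses.\<close>

lemma lead_coeff_root_bound:
  fixes a :: "nat \<Rightarrow> complex"
  assumes eq: "(\<Sum>j\<le>d. a j * g ^ j) = 0" and nz: "a d \<noteq> 0"
  shows "norm (a d * g) \<le> (\<Sum>j\<le>d. norm (a j))"
proof (cases "norm g \<le> 1")
  case True
  have "norm (a d * g) \<le> norm (a d) * 1"
    using True unfolding norm_mult by (intro mult_left_mono) auto
  also have "\<dots> \<le> (\<Sum>j\<le>d. norm (a j))" by (simp, rule member_le_sum) auto
  finally show ?thesis .
next
  case False
  then have g: "norm g \<ge> 1" "norm g > 0" by linarith+
  obtain e where d: "d = Suc e" using eq nz by (cases d) auto
  have "a d * g ^ d = - (\<Sum>j\<le>e. a j * g ^ j)" using eq by (simp add: d add_eq_0_iff)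
  then have "norm (a d * g ^ d) \<le> (\<Sum>j\<le>e. norm (a j * g ^ j))"
    by (simp only: norm_minus_cancel norm_sum)
  also have "\<dots> \<le> (\<Sum>j\<le>e. norm (a j) * norm g ^ e)"
    using g by (intro sum_mono) (auto simp: norm_mult norm_power intro!: mult_left_mono power_increasing)
  finally have "norm (a d * g) * norm g ^ e \<le> (\<Sum>j\<le>e. norm (a j)) * norm g ^ e"
    unfolding sum_distrib_right by (simp add: d norm_mult norm_power mult_ac)
  then have "norm (a d * g) \<le> (\<Sum>j\<le>e. norm (a j))" using g by simp
  also have "\<dots> \<le> (\<Sum>j\<le>d. norm (a j))" by (simp add: d)
  finally show ?thesis .
qed

lemma has_fps_expansion_poly: "(\<lambda>t. poly p t) has_fps_expansion fps_of_poly (p :: complex poly)"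
proof (induction p)
  case 0
  show ?case using has_fps_expansion_0 by simp
next
  case (pCons c p)
  have "(\<lambda>t. c + t * poly p t) has_fps_expansion fps_const c + fps_X * fps_of_poly p"
    by (intro has_fps_expansion_add has_fps_expansion_mult has_fps_expansion_const has_fps_expansion_fps_X pCons)
  then show ?case by (simp add: fps_of_poly_pCons mult.commute)
qed

section \<open>The inverse on the image and along rays\<close>

locale injective_keller =
  fixes N :: nat and a :: "nat \<Rightarrow> nat \<Rightarrow> complex"
  assumes kel: "keller_cubic N a"
    and inj: "\<And>x x'. (\<And>i. i < N \<Longrightarrow> cubic N a x i = cubic N a x' i) \<Longrightarrow> i < N \<Longrightarrow> x i = x' i"
begin

abbreviation "F \<equiv> cubic N a"

definition im :: "(nat \<Rightarrow> complex) \<Rightarrow> bool" where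
  "im y \<longleftrightarrow> (\<exists>x. \<forall>i<N. F x i = y i)"

text \<open>Meaningful on the image only, where injectivity fixes the coordinates below
  \<open>N\<close>.\<close>

definition G :: "(nat \<Rightarrow> complex) \<Rightarrow> nat \<Rightarrow> complex" where
  "G y = (SOME x. \<forall>i<N. F x i = y i)"

lemma F_G: "im y \<Longrightarrow> i < N \<Longrightarrow> F (G y) i = y i"
  using someI_ex[of "\<lambda>x. \<forall>i<N. F x i = y i"] unfolding im_def G_def by blast

lemma im_G_I:
  assumes "\<And>i. i < N \<Longrightarrow> F x i = y i"
  shows "im y" "i < N \<Longrightarrow> G y i = x i"
proof -
  show im: "im y" using assms unfolding im_def by blast
  show "G y i = x i" if "i < N"
    by (rule inj[OF _ that]) (simp add: F_G[OF im] assms)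
qed

lemma G_F: "i < N \<Longrightarrow> G (F x) i = x i"
  by (rule im_G_I) auto

lemma F_cong: "(\<And>j. j < N \<Longrightarrow> x j = x' j) \<Longrightarrow> i < N \<Longrightarrow> F x i = F x' i"
  by (simp add: cubic_def lin_def)

text \<open>Injectivity identifies the local solution with the value of \<open>G\<close>. Hence the
  image is open and \<open>G\<close> is locally Lipschitz, with constants governed by the size of
  the preimage.\<close>

lemma local_inverse:
  "\<exists>K>0. \<exists>e>0. \<forall>x y. nrm N x \<le> B \<longrightarrow> nrm N (\<lambda>i. y i - F x i) \<le> e \<longrightarrow>
     im y \<and> nrm N (\<lambda>i. G y i - x i) \<le> K * nrm N (\<lambda>i. y i - F x i)"
proof -
  obtain K e where Ke: "K > 0" "e > 0" and
    *: "\<And>x y. nrm N x \<le> B \<Longrightarrow> nrm N (\<lambda>i. y i - F x i) \<le> e \<Longrightarrow>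
    (\<exists>u. (\<forall>i<N. F (\<lambda>j. x j + u j) i = y i) \<and> nrm N u \<le> K * nrm N (\<lambda>i. y i - F x i))"
    using cubic_local_inverse[OF kel, of B] by blast
  have "im y \<and> nrm N (\<lambda>i. G y i - x i) \<le> K * nrm N (\<lambda>i. y i - F x i)"
    if xy: "nrm N x \<le> B" "nrm N (\<lambda>i. y i - F x i) \<le> e" for x y
  proof -
    obtain u where u: "\<forall>i<N. F (\<lambda>j. x j + u j) i = y i" "nrm N u \<le> K * nrm N (\<lambda>i. y i - F x i)"
      using *[OF xy] by blast
    have "im y" "\<And>i. i < N \<Longrightarrow> G y i = x i + u i" using im_G_I[of "\<lambda>j. x j + u j" y] u(1) by auto
    moreover from this have "nrm N (\<lambda>i. G y i - x i) = nrm N u" by (intro nrm_cong) simp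
    ultimately show ?thesis using u(2) by simp
  qed
  with Ke show ?thesis by blast
qed

lemma F_0: "F (\<lambda>_. 0) i = 0"
  by (simp add: cubic_def lin_def)

definition dom :: "(nat \<Rightarrow> complex) \<Rightarrow> complex set" where
  "dom v = {t. im (ray t v)}"

definition g :: "(nat \<Rightarrow> complex) \<Rightarrow> nat \<Rightarrow> complex \<Rightarrow> complex" where
  "g v i t = G (ray t v) i"

lemma line_local:
  assumes t0: "t0 \<in> dom v"
  shows "\<exists>K>0. \<exists>d>0. \<forall>t. norm (t - t0) < d \<longrightarrow> t \<in> dom v \<and>
     nrm N (\<lambda>i. g v i t - g v i t0) \<le> K * norm (t - t0)"
proof -
  define x0 where "x0 = G (\<lambda>i. t0 * v i)"
  obtain K e where Ke: "K > 0" "e > 0" and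
    loc: "\<forall>x y. nrm N x \<le> nrm N x0 \<longrightarrow> nrm N (\<lambda>i. y i - F x i) \<le> e \<longrightarrow>
     im y \<and> nrm N (\<lambda>i. G y i - x i) \<le> K * nrm N (\<lambda>i. y i - F x i)"
    using local_inverse[of "nrm N x0"] by blast
  note * = loc[rule_format, OF order_refl]
  have nr: "nrm N (\<lambda>i. t * v i - F x0 i) = norm (t - t0) * nrm N v" for t
  proof -
    have "nrm N (\<lambda>i. t * v i - F x0 i) = nrm N (\<lambda>i. (t - t0) * v i)"
      using t0 by (intro nrm_cong) (simp add: x0_def F_G dom_def algebra_simps)
    then show ?thesis by (simp add: nrm_scale)
  qed
  define d where "d = e / (nrm N v + 1)"
  have pos: "nrm N v + 1 > 0" using nrm_nonneg[of N v] by linarith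
  have d: "d > 0" using Ke pos by (simp add: d_def)
  have "t \<in> dom v \<and> nrm N (\<lambda>i. g v i t - g v i t0) \<le> K * (nrm N v + 1) * norm (t - t0)"
    if t: "norm (t - t0) < d" for t
  proof -
    have "norm (t - t0) * nrm N v \<le> d * (nrm N v + 1)" using t d by (intro mult_mono) auto
    then have "nrm N (\<lambda>i. t * v i - F x0 i) \<le> e" using pos by (simp add: nr d_def)
    from *[OF this] have "t \<in> dom v" "nrm N (\<lambda>i. g v i t - g v i t0) \<le> K * (norm (t - t0) * nrm N v)"
      by (simp_all add: dom_def g_def x0_def[symmetric] nr)
    moreover have "K * (norm (t - t0) * nrm N v) \<le> K * (norm (t - t0) * (nrm N v + 1))"
      using Ke by (intro mult_left_mono) auto
    ultimately show ?thesis by (simp add: mult_ac)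
  qed
  moreover have "K * (nrm N v + 1) > 0" using Ke pos by simp
  ultimately show ?thesis using d by blast
qed

lemma open_dom: "open (dom v)"
  unfolding open_dist
proof
  fix t0 assume "t0 \<in> dom v"
  from line_local[OF this] show "\<exists>e>0. \<forall>y. dist y t0 < e \<longrightarrow> y \<in> dom v"
    by (auto simp: dist_norm)
qed

lemma zero_in_dom: "0 \<in> dom v"
  unfolding dom_def mem_Collect_eq by (rule im_G_I[of "\<lambda>_. 0"]) (simp add: F_0)

lemma g_0: "i < N \<Longrightarrow> g v i 0 = 0"
  unfolding g_def by (rule im_G_I[of "\<lambda>_. 0"]) (simp_all add: F_0)

lemma F_g: "t \<in> dom v \<Longrightarrow> i < N \<Longrightarrow> F (\<lambda>j. g v j t) i = t * v i"
  using F_G[of "\<lambda>i. t * v i" i] by (simp add: dom_def g_def)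

text \<open>The derivative is the inverse Jacobian at \<open>x0\<close> applied to \<open>v\<close>.
  The error is the remainder in \<open>cubic_expand\<close>, which the Lipschitz bound makes
  quadratic in \<open>t - t0\<close>.\<close>

lemma g_has_derivative:
  assumes t0: "t0 \<in> dom v" and i: "i < N"
  shows "\<exists>D. (g v i has_field_derivative D) (at t0)"
proof -
  define x0 where "x0 = (\<lambda>i. g v i t0)"
  obtain K d where Kd: "K > 0" "d > 0" and loc: "\<And>t. norm (t - t0) < d \<Longrightarrow> t \<in> dom v \<and>
     nrm N (\<lambda>i. g v i t - g v i t0) \<le> K * norm (t - t0)"
    using line_local[OF t0] by blast
  obtain Kb where Kb: "Kb > 0" and inv: "\<forall>x. nrm N x \<le> nrm N x0 \<longrightarrow> (\<exists>b. (\<forall>i<N. \<forall>j<N. cmod (b i j) \<le> Kb) \<and>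
    (\<forall>v. \<forall>i<N. lin N b (jac N a x v) i = v i) \<and> (\<forall>w. \<forall>i<N. jac N a x (lin N b w) i = w i))"
    using jac_inverse[OF kel, of "nrm N x0"] by blast
  obtain b where b: "\<And>i j. i < N \<Longrightarrow> j < N \<Longrightarrow> cmod (b i j) \<le> Kb"
    "\<And>v i. i < N \<Longrightarrow> lin N b (jac N a x0 v) i = v i"
    using inv[rule_format, OF order_refl] by blast
  obtain A where A: "A > 0" "\<And>i j. i < N \<Longrightarrow> j < N \<Longrightarrow> cmod (a i j) \<le> A"
    using ex_entry_bound[of N a] by blast
  define D where "D = lin N b v i"
  define C where "C = Kb * (real N * (3 * (A * nrm N x0) * (A * K) ^ 2 + (A * K) ^ 3 * d))"
  have bound: "norm (g v i t - g v i t0 - (t - t0) * D) \<le> C * norm (t - t0) ^ 2"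
    if t: "norm (t - t0) < d" for t
  proof -
    define u where "u = (\<lambda>i. g v i t - g v i t0)"
    define r where "r = (\<lambda>i. 3 * lin N a x0 i * lin N a u i ^ 2 + lin N a u i ^ 3)"
    have u: "nrm N u \<le> K * norm (t - t0)" and tt: "t \<in> dom v" using loc[OF t] by (auto simp: u_def)
    have "jac N a x0 u j = (t - t0) * v j - r j" if j: "j < N" for j
    proof -
      have "F (\<lambda>j. x0 j + u j) j = t * v j" using F_g[OF tt j] by (simp add: x0_def u_def)
      moreover have "F x0 j = t0 * v j" using F_g[OF t0 j] by (simp add: x0_def)
      ultimately show ?thesis unfolding cubic_expand by (simp add: r_def algebra_simps)
    qed
    then have "u i = lin N b (\<lambda>j. (t - t0) * v j - r j) i"
      using b(2)[OF i, of u] by (metis (mono_tags, lifting) lin_cong)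
    then have "u i - (t - t0) * D = - lin N b r i" by (simp add: lin_diff lin_scale D_def)
    then have "norm (u i - (t - t0) * D) = norm (lin N b r i)" by simp
    also have "\<dots> \<le> Kb * nrm N r" using b i by (intro norm_matvec_le) auto
    also have "nrm N r \<le> real N * ((3 * (A * nrm N x0) * (A * K) ^ 2 + (A * K) ^ 3 * d) * norm (t - t0) ^ 2)"
    proof (rule nrm_le)
      fix j assume j: "j < N"
      have s: "norm (lin N a x0 j) \<le> A * nrm N x0" using A j by (intro norm_matvec_le) auto
      have "norm (lin N a u j) \<le> A * nrm N u" using A j by (intro norm_matvec_le) auto
      also have "\<dots> \<le> A * (K * norm (t - t0))" using A u by (intro mult_left_mono) auto
      finally have l: "norm (lin N a u j) \<le> A * K * norm (t - t0)" by (simp add: mult_ac)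
      have "norm (3 * lin N a x0 j * lin N a u j ^ 2) \<le> 3 * (A * nrm N x0) * (A * K * norm (t - t0)) ^ 2"
        unfolding norm_mult norm_power norm_numeral using s l A(1) Kd by (intro mult_mono power_mono) auto
      moreover have "norm (lin N a u j ^ 3) \<le> (A * K) ^ 3 * d * norm (t - t0) ^ 2"
      proof -
        have "norm (lin N a u j ^ 3) \<le> (A * K * norm (t - t0)) ^ 3"
          unfolding norm_power using l by (intro power_mono) auto
        also have "\<dots> = (A * K) ^ 3 * norm (t - t0) * norm (t - t0) ^ 2"
          by (simp add: power_mult_distrib power3_eq_cube power2_eq_square mult_ac)
        also have "\<dots> \<le> (A * K) ^ 3 * d * norm (t - t0) ^ 2"
          using t A(1) Kd by (intro mult_right_mono mult_left_mono) auto
        finally show ?thesis .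
      qed
      ultimately have "norm (r j) \<le> 3 * (A * nrm N x0) * (A * K * norm (t - t0)) ^ 2 + (A * K) ^ 3 * d * norm (t - t0) ^ 2"
        unfolding r_def by (intro order.trans[OF norm_triangle_ineq] add_mono)
      then show "norm (r j) \<le> (3 * (A * nrm N x0) * (A * K) ^ 2 + (A * K) ^ 3 * d) * norm (t - t0) ^ 2"
        by (simp add: power_mult_distrib algebra_simps)
    qed
    finally show ?thesis using Kb by (simp add: u_def C_def mult_ac)
  qed
  have "(g v i has_field_derivative D) (at t0)"
    unfolding has_field_derivative_iff
  proof (subst Lim_null, rule Lim_null_comparison)
    show "((\<lambda>t. C * norm (t - t0)) \<longlongrightarrow> 0) (at t0)"
      by (intro tendsto_mult_right_zero tendsto_norm_zero) (simp add: LIM_zero)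
    have "\<forall>\<^sub>F t in at t0. t \<in> ball t0 d - {t0}"
      using Kd by (intro eventually_at_in_open) auto
    then show "\<forall>\<^sub>F t in at t0. norm ((g v i t - g v i t0) / (t - t0) - D) \<le> C * norm (t - t0)"
    proof eventually_elim
      case (elim t)
      then have t: "norm (t - t0) < d" "t - t0 \<noteq> 0" by (auto simp: dist_norm norm_minus_commute)
      have "(g v i t - g v i t0) / (t - t0) - D = (g v i t - g v i t0 - (t - t0) * D) / (t - t0)"
        using t by (simp add: field_simps)
      then have "norm ((g v i t - g v i t0) / (t - t0) - D) \<le> C * norm (t - t0) ^ 2 / norm (t - t0)"
        using bound[OF t(1)] by (simp add: norm_divide divide_right_mono)
      then show ?case using t by (simp add: power2_eq_square)
    qed
  qed
  then show ?thesis by blast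
qed

lemma g_holomorphic: "i < N \<Longrightarrow> g v i holomorphic_on dom v"
  unfolding holomorphic_on_def field_differentiable_def
  using g_has_derivative has_field_derivative_at_within by blast

definition taylor :: "nat \<Rightarrow> nat \<Rightarrow> (nat \<Rightarrow> complex) \<Rightarrow> complex" where
  "taylor i k v = fps_nth (fps_expansion (g v i) 0) k"

lemma g_has_fps_expansion: "i < N \<Longrightarrow> g v i has_fps_expansion Abs_fps (\<lambda>k. taylor i k v)"
  using has_fps_expansion_fps_expansion[OF open_dom zero_in_dom g_holomorphic, of i v]
  by (simp add: taylor_def[abs_def] fps_nth_inverse)

lemma taylor_0: "i < N \<Longrightarrow> taylor i 0 v = 0"
  using has_fps_expansion_imp_0_eq_fps_nth_0[OF g_has_fps_expansion, of i v] by (simp add: g_0)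

text \<open>The equation \<open>F(g(t)) = t v\<close>, read as an identity of power series in
  t.\<close>

lemma taylor_eq:
  assumes i: "i < N"
  shows "taylor i k v = (if k = 1 then v i else 0)
     - fps_nth ((\<Sum>j<N. fps_const (a i j) * Abs_fps (\<lambda>k. taylor j k v)) ^ 3) k"
proof -
  let ?X = "\<lambda>i. Abs_fps (\<lambda>k. taylor i k v)"
  have h1: "(\<lambda>t. g v i t + (\<Sum>j<N. a i j * g v j t) ^ 3) has_fps_expansion
      ?X i + (\<Sum>j<N. fps_const (a i j) * ?X j) ^ 3"
    using i by (intro fps_expansion_intros g_has_fps_expansion) auto
  have h2: "\<forall>\<^sub>F t in nhds 0. g v i t + (\<Sum>j<N. a i j * g v j t) ^ 3 = v i * t"
    using eventually_nhds_in_open[OF open_dom zero_in_dom, of v]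
    by eventually_elim (use F_g[OF _ i, of _ v] in \<open>simp add: cubic_def lin_def mult.commute\<close>)
  have "(\<lambda>t. v i * t) has_fps_expansion ?X i + (\<Sum>j<N. fps_const (a i j) * ?X j) ^ 3"
    using h1 unfolding has_fps_expansion_cong[OF h2 refl] .
  moreover have "(\<lambda>t. v i * t) has_fps_expansion fps_const (v i) * fps_X"
    by (intro fps_expansion_intros)
  ultimately have "?X i + (\<Sum>j<N. fps_const (a i j) * ?X j) ^ 3 = fps_const (v i) * fps_X"
    by (rule fps_expansion_unique_complex)
  then have "fps_nth (?X i + (\<Sum>j<N. fps_const (a i j) * ?X j) ^ 3) k = fps_nth (fps_const (v i) * fps_X) k"
    by simp
  then show ?thesis by (simp add: algebra_simps)
qed

text \<open>Since constant terms vanish, the coefficient of t^k in the cube involves only Taylor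
  coefficients of order below k, so the recursion never leaves the polynomials in
  \<open>v\<close>.\<close>

lemma polyf_taylor: "i < N \<Longrightarrow> polyf {..<N} (taylor i k)"
proof (induction k arbitrary: i rule: less_induct)
  case (less k)
  define L where "L = (\<lambda>m v. \<Sum>j<N. a i j * taylor j m v)"
  have L0: "L 0 v = 0" for v by (simp add: L_def taylor_0)
  have polyL: "polyf {..<N} (L m)" if "m < k" for m
    unfolding L_def by (intro polyf_sum polyf.mult polyf.const less.IH that) auto
  have prodL: "polyf {..<N} (\<lambda>v. L m v * (L m' v * L (k - m - m') v))" if m: "m \<le> k" "m' \<le> k - m" for m m'
  proof (cases "m < k \<and> m' < k \<and> k - m - m' < k")
    case True
    then show ?thesis by (intro polyf.mult polyL) auto
  next
    case False
    \<comment> \<open>If one of the three indices reaches \<open>k\<close>, another one is 0 and its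
      factor \<open>L 0\<close> vanishes.\<close>
    then have "(m = k \<and> m' = 0) \<or> (m = 0 \<and> m' = k) \<or> (m = 0 \<and> m' = 0)" using m by arith
    then have "(\<lambda>v. L m v * (L m' v * L (k - m - m') v)) = (\<lambda>v. 0)"
      by (intro ext) (auto simp: L0)
    then show ?thesis by (simp only: polyf.const)
  qed
  have "fps_nth ((\<Sum>j<N. fps_const (a i j) * Abs_fps (\<lambda>k. taylor j k v)) ^ 3) k
      = (\<Sum>m=0..k. \<Sum>m'=0..k-m. L m v * (L m' v * L (k - m - m') v))" for v
  proof -
    define S where "S = (\<Sum>j<N. fps_const (a i j) * Abs_fps (\<lambda>k. taylor j k v))"
    have "S ^ 3 = S * (S * S)" by (simp add: power3_eq_cube mult.assoc)
    moreover have "fps_nth S m = L m v" for m by (simp add: S_def L_def fps_sum_nth)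
    ultimately show ?thesis unfolding S_def[symmetric] by (simp only: fps_mult_nth sum_distrib_left)
  qed
  then have eq: "taylor i k = (\<lambda>v. (if k = 1 then v i else 0)
     - (\<Sum>m=0..k. \<Sum>m'=0..k-m. L m v * (L m' v * L (k - m - m') v)))"
    using taylor_eq[OF less.prems] by (intro ext) simp
  have "polyf {..<N} (\<lambda>v. if k = 1 then v i else 0)"
    using less.prems by (cases "k = 1") auto
  then show ?case unfolding eq by (intro polyf_diff polyf_sum prodL) auto
qed

section \<open>Rationality of the inverse\<close>

lemma pdg_F: "i < N \<Longrightarrow> pdg N 3 (\<lambda>x. F x i)"
proof -
  assume i: "i < N"
  have "pdg N (0 + 1) (\<lambda>x. a i j * x j)" if "j \<in> {..<N}" for j
    using that by (intro pdg_mult pdg_const) (auto intro: pdg_var[of _ _ 0, simplified])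
  then have "pdg N 1 (\<lambda>x. lin N a x i)"
    unfolding lin_def by (intro pdg_sum) auto
  from pdg_power[OF this, of 3] have "pdg N 3 (\<lambda>x. lin N a x i ^ 3)" by simp
  moreover have "pdg N 3 (\<lambda>x. x i)" using pdg_var[OF i, of 2] by (simp add: numeral_3_eq_3)
  ultimately show ?thesis unfolding cubic_def by (rule pdg_add)
qed

lemma coordinate_algebraic:
  assumes i: "i < N"
  shows "\<exists>d c. (\<forall>j. polyf {..<N} (c j)) \<and> (\<exists>y. c d y \<noteq> 0) \<and> (\<forall>x. (\<Sum>j\<le>d. c j (F x) * x i ^ j) = 0)"
  by (rule algebraic_dependence[where D = 3])
    (use i pdg_F pdg_var[OF i, of 2] in \<open>simp_all add: numeral_3_eq_3\<close>)

text \<open>If \<open>D0 v \<noteq> 0\<close>, then \<open>D0^2 g\<close> extends to an entire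
  function on the ray with polynomial growth, hence to a polynomial in t whose degree bound
  \<open>M\<close> does not depend on \<open>v\<close>. Its value at t = 1 is the sum of its
  coefficients up to \<open>M\<close>, and these are polynomials in \<open>v\<close> by
  \<open>polyf_taylor\<close>.\<close>

lemma birational:
  "\<exists>D P. polyf {..<N} D \<and> (\<exists>y. D y \<noteq> 0) \<and> (\<forall>i<N. polyf {..<N} (P i)) \<and>
     (\<forall>i<N. \<forall>x. P i (F x) = D (F x) * x i)"
proof -
  have "\<forall>i. \<exists>d c. i < N \<longrightarrow> (\<forall>j. polyf {..<N} (c j)) \<and> (\<exists>y. c d y \<noteq> 0) \<and>
      (\<forall>x. (\<Sum>j\<le>d. c j (F x) * x i ^ j) = 0)"
    using coordinate_algebraic by blast
  from choice[OF this] obtain dd where "\<forall>i. \<exists>c. i < N \<longrightarrow> (\<forall>j. polyf {..<N} (c j)) \<and> (\<exists>y. c (dd i) y \<noteq> 0) \<and>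
      (\<forall>x. (\<Sum>j\<le>dd i. c j (F x) * x i ^ j) = 0)" by blast
  from choice[OF this] obtain c where "\<forall>i. i < N \<longrightarrow> (\<forall>j. polyf {..<N} (c i j)) \<and> (\<exists>y. c i (dd i) y \<noteq> 0) \<and>
      (\<forall>x. (\<Sum>j\<le>dd i. c i j (F x) * x i ^ j) = 0)" by blast
  then have c: "polyf {..<N} (c i j)" "\<exists>y. c i (dd i) y \<noteq> 0" "(\<Sum>j\<le>dd i. c i j (F x) * x i ^ j) = 0"
    if "i < N" for i j x using that by blast+
  define top where "top = (\<lambda>i. c i (dd i))"
  \<comment> \<open>The product of the leading coefficients of the equations of all coordinates; at
    image points where it is nonzero, every coordinate of \<open>G\<close> is bounded by
    \<open>root\<close>.\<close>
  define D0 where "D0 = (\<lambda>y. \<Prod>i<N. top i y)"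
  define oth where "oth = (\<lambda>i y. \<Prod>k\<in>{..<N} - {i}. top k y)"
  \<comment> \<open>Of the two factors in \<open>D0^2\<close>, one supplies the leading coefficient
    \<open>top i\<close> that \<open>root\<close> needs; the other stays in \<open>num\<close> and
    makes the bound vanish at the zeros of \<open>D0\<close>.\<close>
  define num where "num = (\<lambda>i j y. D0 y * oth i y * c i j y)"
  have ptop: "polyf {..<N} (top i)" if "i < N" for i using c that by (simp add: top_def)
  have pD0: "polyf {..<N} D0" unfolding D0_def by (intro polyf_prod) (use ptop in auto)
  have poth: "polyf {..<N} (oth i)" for i unfolding oth_def by (intro polyf_prod) (use ptop in auto)
  have pnum: "polyf {..<N} (num i j)" if "i < N" for i j
    unfolding num_def by (intro polyf.mult pD0 poth c that)
  have D0_split: "D0 y = top i y * oth i y" if "i < N" for i y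
    unfolding D0_def oth_def using that by (intro prod.remove) auto
  have D0_nz: "\<exists>y. D0 y \<noteq> 0"
    unfolding D0_def by (rule polyf_prod_nonzero[where I = "{..<N}"]) (use ptop c in \<open>auto simp: top_def\<close>)
  have root: "norm (top i y * G y i) \<le> (\<Sum>j\<le>dd i. norm (c i j y))"
    if i: "i < N" and y: "im y" "top i y \<noteq> 0" for i y
    unfolding top_def
  proof (rule lead_coeff_root_bound)
    have "c i j (F (G y)) = c i j y" for j
      by (rule polyf_cong[OF c(1)[OF i]]) (use F_G[OF y(1)] in simp)
    then show "(\<Sum>j\<le>dd i. c i j y * G y i ^ j) = 0" using c(3)[OF i, of "G y"] by simp
    show "c i (dd i) y \<noteq> 0" using y(2) by (simp add: top_def)
  qed
  have "\<forall>i j. \<exists>M. i < N \<longrightarrow> (\<forall>v. \<exists>C. \<forall>t. norm t \<ge> 1 \<longrightarrow> norm (num i j (ray t v)) \<le> C * norm t ^ M)"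
    using polyf_growth[OF pnum] by blast
  then obtain Mg where Mg: "\<And>i j v. i < N \<Longrightarrow>
      \<exists>C. \<forall>t. norm t \<ge> 1 \<longrightarrow> norm (num i j (ray t v)) \<le> C * norm t ^ Mg i j"
    by metis
  define M where "M = (\<Sum>i<N. \<Sum>j\<le>dd i. Mg i j)"
  have Mg_le: "Mg i j \<le> M" if "i < N" "j \<le> dd i" for i j
  proof -
    have "Mg i j \<le> (\<Sum>j\<le>dd i. Mg i j)" using that by (intro member_le_sum) auto
    also have "\<dots> \<le> M" unfolding M_def
      using that by (intro member_le_sum[of i "{..<N}" "\<lambda>i. \<Sum>j\<le>dd i. Mg i j"]) auto
    finally show ?thesis .
  qed
  have pQ: "polyf {..<N} (\<lambda>y. D0 y ^ 2)" by (intro polyf_power pD0)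
  obtain MH H where H: "\<And>v t. poly (H v) t = D0 (ray t v) ^ 2"
    "\<And>k. polyf {..<N} (\<lambda>v. coeff (H v) k)"
    using polyf_line[OF pQ] by blast
  have line: "\<exists>w. degree w \<le> M \<and> (\<forall>t. poly w t = D0 (ray t v) ^ 2 * g v i t)"
    if i: "i < N" and v: "D0 v \<noteq> 0" for i v
  proof -
    define S where "S = {t. D0 (ray t v) = 0}"
    have "poly (H v) 1 \<noteq> 0" using v by (simp add: H)
    then have "H v \<noteq> 0" by auto
    then have "finite {t. poly (H v) t = 0}" by (rule poly_roots_finite)
    then have finS: "finite S" by (simp add: S_def H)
    have top_nz: "top i (ray t v) \<noteq> 0" if "t \<notin> S" "i < N" for t i
      using that D0_split[of i "\<lambda>i. t * v i"] by (auto simp: S_def)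
    \<comment> \<open>\<open>dom v\<close> is closed relative to the complement of \<open>S\<close>:
      the root bound keeps preimages of nearby points bounded, and the radius in
      \<open>local_inverse\<close> depends on that bound only.\<close>
    have closed: "\<exists>d>0. \<forall>t. norm (t - s) < d \<longrightarrow> t \<in> dom v \<longrightarrow> s \<in> dom v" if s: "s \<notin> S" for s
    proof -
      define Phi where "Phi = (\<lambda>i t. (\<Sum>j\<le>dd i. norm (c i j (ray t v))) / norm (top i (ray t v)))"
      have Phi: "(Phi i \<longlongrightarrow> Phi i s) (at s)" if "i < N" for i
        unfolding Phi_def using that top_nz[OF s that]
        by (intro tendsto_intros polyf_line_tendsto[where I = "{..<N}"] c ptop) auto
      have "\<forall>\<^sub>F t in at s. \<forall>i\<in>{..<N}. Phi i t < Phi i s + 1"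
        by (intro eventually_ball_finite ballI order_tendstoD(2)[OF Phi]) auto
      moreover have "\<forall>\<^sub>F t in at s. t \<notin> S" by (rule eventually_at_not_finite[OF finS])
      ultimately have "\<forall>\<^sub>F t in at s. (\<forall>i\<in>{..<N}. Phi i t < Phi i s + 1) \<and> t \<notin> S"
        by (rule eventually_conj)
      then obtain r where r: "r > 0" "\<And>t i. t \<noteq> s \<Longrightarrow> dist t s < r \<Longrightarrow> i < N \<Longrightarrow> Phi i t < Phi i s + 1"
        "\<And>t. t \<noteq> s \<Longrightarrow> dist t s < r \<Longrightarrow> t \<notin> S"
        unfolding eventually_at by auto
      define B where "B = (\<Sum>i<N. Phi i s + 1)"
      obtain K e where Ke: "K > 0" "e > 0" and
        loc: "\<forall>x y. nrm N x \<le> B \<longrightarrow> nrm N (\<lambda>i. y i - F x i) \<le> e \<longrightarrow>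
         im y \<and> nrm N (\<lambda>i. G y i - x i) \<le> K * nrm N (\<lambda>i. y i - F x i)"
        using local_inverse[of B] by blast
      have pos: "nrm N v + 1 > 0" using nrm_nonneg[of N v] by linarith
      define d where "d = min r (e / (nrm N v + 1))"
      have "s \<in> dom v" if t: "norm (t - s) < d" "t \<in> dom v" for t
      proof (cases "t = s")
        case False
        have tS: "t \<notin> S" using r(3)[OF False] t by (simp add: d_def dist_norm)
        have imt: "im (ray t v)" using t(2) by (simp add: dom_def)
        have "norm (G (ray t v) i) \<le> Phi i s + 1" if "i < N" for i
        proof -
          have "norm (top i (ray t v)) * norm (G (ray t v) i) \<le> (\<Sum>j\<le>dd i. norm (c i j (ray t v)))"
            using root[OF that imt top_nz[OF tS that]] by (simp add: norm_mult)
          then have "norm (G (ray t v) i) \<le> Phi i t"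
            using top_nz[OF tS that] by (simp add: Phi_def field_simps)
          also have "\<dots> \<le> Phi i s + 1" using r(2)[OF False _ that] t by (simp add: d_def dist_norm less_imp_le)
          finally show ?thesis .
        qed
        then have "nrm N (G (ray t v)) \<le> B" unfolding nrm_def B_def by (intro sum_mono) auto
        moreover have "nrm N (\<lambda>i. s * v i - F (G (ray t v)) i) \<le> e"
        proof -
          have "nrm N (\<lambda>i. s * v i - F (G (ray t v)) i) = nrm N (\<lambda>i. (s - t) * v i)"
            by (intro nrm_cong) (simp add: F_G[OF imt] algebra_simps)
          also have "\<dots> = norm (t - s) * nrm N v" by (simp add: nrm_scale norm_minus_commute)
          also have "\<dots> \<le> e / (nrm N v + 1) * (nrm N v + 1)"
            using t Ke pos by (intro mult_mono) (auto simp: d_def)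
          also have "\<dots> = e" using pos by simp
          finally show ?thesis .
        qed
        ultimately have "im (ray s v)"
          using loc[rule_format, of "G (ray t v)" "\<lambda>i. s * v i"] by simp
        then show ?thesis by (simp add: dom_def)
      qed (use t in simp)
      moreover have "d > 0" using r Ke pos by (simp add: d_def)
      ultimately show ?thesis by blast
    qed
    have opn1: "open (dom v - S)" by (intro open_Diff open_dom finite_imp_closed finS)
    have opn2: "open (- S - dom v)"
      unfolding open_dist
    proof
      fix s assume s: "s \<in> - S - dom v"
      then obtain d where d: "d > 0" "\<And>t. norm (t - s) < d \<Longrightarrow> t \<notin> dom v" using closed by blast
      have "open (- S)" using finS by (simp add: finite_imp_closed open_Compl)
      then obtain d' where "d' > 0" "\<And>t. dist t s < d' \<Longrightarrow> t \<in> - S"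
        using s unfolding open_dist by blast
      then show "\<exists>e>0. \<forall>t. dist t s < e \<longrightarrow> t \<in> - S - dom v"
        using d by (intro exI[of _ "min d d'"]) (auto simp: dist_norm)
    qed
    \<comment> \<open>The plane without the finite set \<open>S\<close> is connected and splits into
      the open sets \<open>dom v - S\<close> and \<open>- S - dom v\<close>; the former is nonempty,
      so the latter is empty.\<close>
    have conn: "connected (UNIV - S)"
      by (rule connected_open_delete_finite) (use finS in \<open>auto simp: connected_UNIV\<close>)
    have "dom v - S \<noteq> {}"
    proof
      assume "dom v - S = {}"
      then have "dom v \<subseteq> S" by blast
      then have "finite (dom v)" using finS finite_subset by blast
      then show False using open_dom zero_in_dom finite_imp_not_open by blast
    qed
    then have "- S - dom v = {}"
      using connectedD[OF conn opn1 opn2] by blast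
    then have sub: "UNIV - S \<subseteq> dom v" by blast
    define W where "W = (\<lambda>t. D0 (ray t v) ^ 2 * g v i t)"
    have bound: "norm (W t) \<le> (\<Sum>j\<le>dd i. norm (num i j (ray t v)))" for t
    proof (cases "t \<in> S")
      case True
      then show ?thesis by (simp add: W_def S_def sum_nonneg)
    next
      case False
      then have "im (ray t v)" using sub by (auto simp: dom_def)
      from root[OF i this top_nz[OF False i]]
      have "norm (D0 (ray t v) * oth i (ray t v)) * norm (top i (ray t v) * g v i t)
        \<le> norm (D0 (ray t v) * oth i (ray t v)) * (\<Sum>j\<le>dd i. norm (c i j (ray t v)))"
        unfolding g_def by (intro mult_left_mono) auto
      moreover have "W t = D0 (ray t v) * oth i (ray t v) * (top i (ray t v) * g v i t)"
        unfolding W_def power2_eq_square using D0_split[OF i, of "\<lambda>i. t * v i"] by (simp add: mult_ac)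
      ultimately show ?thesis
        by (simp only: norm_mult sum_distrib_left num_def mult.assoc)
    qed
    have holS: "W holomorphic_on UNIV - S"
      unfolding W_def
      by (intro holomorphic_intros polyf_line_holomorphic[OF pD0] holomorphic_on_subset[OF g_holomorphic[OF i] sub])
    \<comment> \<open>The points of \<open>S\<close> are removable singularities: \<open>W\<close>
      is 0 there, and \<open>bound\<close> forces the limit 0.\<close>
    have "W holomorphic_on UNIV"
    proof (rule no_isolated_singularity[OF _ holS open_UNIV finS])
      show "continuous_on UNIV W"
        unfolding continuous_on_def
      proof
        fix s :: complex
        show "(W \<longlongrightarrow> W s) (at s within UNIV)"
        proof (cases "s \<in> S")
          case True
          then have Ws: "W s = 0" by (simp add: W_def S_def)
          have "((\<lambda>t. \<Sum>j\<le>dd i. norm (num i j (ray t v))) \<longlongrightarrow>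
              (\<Sum>j\<le>dd i. norm (num i j (ray s v)))) (at s)"
            by (intro tendsto_intros polyf_line_tendsto[OF pnum[OF i]])
          moreover have "(\<Sum>j\<le>dd i. norm (num i j (ray s v))) = 0"
            using True by (simp add: num_def S_def)
          ultimately have "((\<lambda>t. \<Sum>j\<le>dd i. norm (num i j (ray t v))) \<longlongrightarrow> 0) (at s)" by simp
          then show ?thesis unfolding Ws
            by (rule Lim_null_comparison[rotated]) (use bound in auto)
        next
          case False
          have "open (UNIV - S)" using finS by (simp add: finite_imp_closed open_Diff)
          then have "isCont W s"
            using False holomorphic_on_imp_continuous_on[OF holS] by (simp add: continuous_on_eq_continuous_at)
          then show ?thesis by (simp add: isCont_def)
        qed
      qed
    qed
    moreover have "\<exists>C. \<forall>t. norm t \<ge> 1 \<longrightarrow> norm (W t) \<le> C * norm t ^ M"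
    proof -
      have "\<forall>j. \<exists>C. \<forall>t. norm t \<ge> 1 \<longrightarrow> norm (num i j (ray t v)) \<le> C * norm t ^ Mg i j"
        using Mg[OF i] by blast
      from choice[OF this] obtain C where
        C: "\<And>j t. norm t \<ge> 1 \<Longrightarrow> norm (num i j (ray t v)) \<le> C j * norm t ^ Mg i j" by blast
      have "norm (W t) \<le> (\<Sum>j\<le>dd i. \<bar>C j\<bar>) * norm t ^ M" if t: "norm t \<ge> 1" for t
      proof -
        have "norm (W t) \<le> (\<Sum>j\<le>dd i. norm (num i j (ray t v)))" by (rule bound)
        also have "\<dots> \<le> (\<Sum>j\<le>dd i. \<bar>C j\<bar> * norm t ^ M)"
        proof (rule sum_mono)
          fix j assume "j \<in> {..dd i}"
          then have "norm t ^ Mg i j \<le> norm t ^ M" using t Mg_le[OF i] by (intro power_increasing) auto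
          then have "\<bar>C j\<bar> * norm t ^ Mg i j \<le> \<bar>C j\<bar> * norm t ^ M" by (intro mult_left_mono) auto
          moreover have "C j * norm t ^ Mg i j \<le> \<bar>C j\<bar> * norm t ^ Mg i j" by (intro mult_right_mono) auto
          ultimately show "norm (num i j (ray t v)) \<le> \<bar>C j\<bar> * norm t ^ M"
            using C[OF t, of j] by linarith
        qed
        finally show ?thesis by (simp add: sum_distrib_right)
      qed
      then show ?thesis by blast
    qed
    ultimately obtain C where "\<And>z. W z = (\<Sum>k\<le>M. (deriv ^^ k) W 0 / fact k * z ^ k)"
      using Liouville_polynomial by blast
    note Wsum = this
    define w where "w = (\<Sum>k\<le>M. monom ((deriv ^^ k) W 0 / fact k) k)"
    have "W t = poly w t" for t
      by (subst Wsum) (simp add: w_def poly_sum poly_monom)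
    then have "poly w t = D0 (ray t v) ^ 2 * g v i t" for t
      by (simp add: W_def)
    moreover have "degree w \<le> M" unfolding w_def
      by (intro degree_sum_le) (auto intro: order.trans[OF degree_monom_le])
    ultimately show ?thesis by blast
  qed
  \<comment> \<open>The coefficients of the product of \<open>H v\<close>, which is
    \<open>D0^2\<close> on the ray, with the Taylor series of \<open>g\<close>; they are summed
    because t = 1 is substituted.\<close>
  define P0 where "P0 = (\<lambda>i v. \<Sum>k\<le>M. \<Sum>j=0..k. coeff (H v) j * taylor i (k - j) v)"
  have P0: "P0 i v = D0 v ^ 2 * G v i" if i: "i < N" and v: "D0 v \<noteq> 0" for i v
  proof -
    obtain w where w: "degree w \<le> M" "\<And>t. poly w t = D0 (ray t v) ^ 2 * g v i t"
      using line[OF i v] by blast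
    have "(\<lambda>t. poly (H v) t * g v i t) has_fps_expansion fps_of_poly (H v) * Abs_fps (\<lambda>k. taylor i k v)"
      by (intro has_fps_expansion_mult has_fps_expansion_poly g_has_fps_expansion i)
    then have "(\<lambda>t. poly w t) has_fps_expansion fps_of_poly (H v) * Abs_fps (\<lambda>k. taylor i k v)"
      by (simp add: w H)
    from fps_expansion_unique_complex[OF has_fps_expansion_poly this]
    have "fps_nth (fps_of_poly w) k = fps_nth (fps_of_poly (H v) * Abs_fps (\<lambda>k. taylor i k v)) k" for k
      by simp
    then have "coeff w k = (\<Sum>j=0..k. coeff (H v) j * taylor i (k - j) v)" for k
      by (simp add: fps_mult_nth)
    then have "P0 i v = (\<Sum>k\<le>M. coeff w k)" by (simp add: P0_def)
    also have "\<dots> = (\<Sum>k\<le>degree w. coeff w k)"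
      using w(1) by (intro sum.mono_neutral_right) (auto simp: coeff_eq_0)
    also have "\<dots> = poly w 1" by (simp add: poly_altdef)
    also have "\<dots> = D0 v ^ 2 * G v i" by (simp add: w g_def)
    finally show ?thesis .
  qed
  have pP0: "polyf {..<N} (P0 i)" if "i < N" for i
    unfolding P0_def by (intro polyf_sum polyf.mult H polyf_taylor that)
  \<comment> \<open>\<open>P0\<close> is known only where \<open>D0\<close> is nonzero; a third
    factor \<open>D0\<close> makes the identity hold where \<open>D0 (F x) = 0\<close> as
    well.\<close>
  show ?thesis
  proof (intro exI[of _ "\<lambda>y. D0 y ^ 3"] exI[of _ "\<lambda>i y. D0 y * P0 i y"] conjI allI impI)
    show "\<exists>y. D0 y ^ 3 \<noteq> 0" using D0_nz by simp
    show "D0 (F x) * P0 i (F x) = D0 (F x) ^ 3 * x i" if "i < N" for i x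
      using P0[OF that, of "F x"] G_F[OF that, of x]
      by (cases "D0 (F x) = 0") (auto simp: power3_eq_cube power2_eq_square)
  qed (intro polyf_power polyf.mult pD0 pP0; assumption)+
qed

end

section \<open>Absence of poles\<close>

lemma poly_nonvanishing_const:
  fixes p :: "complex poly"
  assumes "\<And>t. poly p t \<noteq> 0"
  shows "poly p s = poly p t"
proof -
  have "constant (poly p)" using fundamental_theorem_of_algebra assms by blast
  then show ?thesis unfolding constant_def by blast
qed

lemma has_fps_expansion_unique_fun:
  fixes f g :: "complex \<Rightarrow> complex"
  assumes "f has_fps_expansion A" "g has_fps_expansion A"
  shows "\<forall>\<^sub>F t in nhds 0. f t = g t"
proof -
  have "\<forall>\<^sub>F t in nhds 0. eval_fps A t = f t" "\<forall>\<^sub>F t in nhds 0. eval_fps A t = g t"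
    using assms by (auto simp: has_fps_expansion_def)
  then show ?thesis by eventually_elim simp
qed

context injective_keller
begin

text \<open>Let \<open>q\<close> have the greatest degree among the denominators of P/D in lowest
  terms on all rays. If \<open>q\<close> takes the value \<open>q(0)\<close> at infinitely many
  points, it is constant, and by maximality so is every reduced denominator.\<close>

lemma denominator_divides:
  assumes i: "i < N" and pD: "polyf {..<N} D" and pP: "polyf {..<N} P"
    and DP: "\<And>x. P (F x) = D (F x) * x i"
    and HD: "\<And>v t. poly (HD v) t = D (ray t v)" and HD_deg: "\<And>v. degree (HD v) \<le> M"
    and HP: "\<And>v t. poly (HP v) t = P (ray t v)"
    and v: "HD v \<noteq> 0"
  shows "HD v dvd HP v"
proof -
  define red where "red = (\<lambda>(v, p, q). HD v \<noteq> 0 \<and> q \<noteq> 0 \<and> coprime p q \<and> HD v * p = HP v * q)"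
  have ex_red: "\<exists>p q. red (v, p, q)" if "HD v \<noteq> 0" for v
  proof -
    define h where "h = gcd (HP v) (HD v)"
    have h: "h \<noteq> 0" using that by (simp add: h_def)
    have cop: "coprime (HP v div h) (HD v div h)"
      unfolding h_def by (rule div_gcd_coprime) (use that in simp)
    obtain p q where pq: "HP v = h * p" "HD v = h * q"
      unfolding h_def by (metis dvdE gcd_dvd1 gcd_dvd2)
    then have "red (v, p, q)" using that h cop by (simp add: red_def mult_ac)
    then show ?thesis by blast
  qed
  have red_dvd: "q dvd HD v" if "red (v, p, q)" for v p q
  proof -
    have "q dvd HD v * p" "coprime p q" using that by (simp_all add: red_def)
    then show ?thesis by (metis coprime_commute coprime_dvd_mult_left_iff)
  qed
  have bounded: "degree (snd (snd z)) < Suc M" if "red z" for z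
  proof -
    obtain v p q where z: "z = (v, p, q)" by (cases z)
    then have "HD v \<noteq> 0" using that by (simp add: red_def)
    then have "degree q \<le> degree (HD v)" using red_dvd[of v p q] that z by (intro dvd_imp_degree_le) auto
    then show ?thesis using HD_deg[of v] z by simp
  qed
  obtain p' q' where "red (v, p', q')" using ex_red[OF v] by blast
  then obtain z0 where z0: "red z0" "\<And>z. red z \<Longrightarrow> degree (snd (snd z)) \<le> degree (snd (snd z0))"
    using ex_has_greatest_nat[of red _ "\<lambda>z. degree (snd (snd z))" "Suc M"] bounded by blast
  obtain v0 p q where z0_eq: "z0 = (v0, p, q)" by (cases z0)
  have r0: "HD v0 \<noteq> 0" "q \<noteq> 0" "coprime p q" "HD v0 * p = HP v0 * q"
    using z0(1) by (auto simp: red_def z0_eq)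
  have max: "degree q1 \<le> degree q" if "red (v1, p1, q1)" for v1 p1 q1
    using z0(2)[OF that] by (simp add: z0_eq)
  \<comment> \<open>Near an image point, P/D is a coordinate of \<open>G\<close> and hence
    bounded.\<close>
  have local: "\<exists>e>0. \<exists>C. \<forall>y. nrm N (\<lambda>j. y j - y0 j) < e \<longrightarrow> norm (P y) \<le> C * norm (D y)"
    if y0: "im y0" for y0
  proof -
    define x0 where "x0 = G y0"
    obtain K e where Ke: "K > 0" "e > 0" and
      loc: "\<forall>x y. nrm N x \<le> nrm N x0 \<longrightarrow> nrm N (\<lambda>i. y i - F x i) \<le> e \<longrightarrow>
       im y \<and> nrm N (\<lambda>i. G y i - x i) \<le> K * nrm N (\<lambda>i. y i - F x i)"
      using local_inverse[of "nrm N x0"] by blast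
    have "norm (P y) \<le> (norm (x0 i) + K * e) * norm (D y)" if y: "nrm N (\<lambda>j. y j - y0 j) < e" for y
    proof -
      have "nrm N (\<lambda>j. y j - F x0 j) = nrm N (\<lambda>j. y j - y0 j)"
        by (intro nrm_cong) (simp add: x0_def F_G[OF y0])
      then have "nrm N (\<lambda>j. y j - F x0 j) \<le> e" using y by simp
      with loc have imy: "im y" and "nrm N (\<lambda>j. G y j - x0 j) \<le> K * nrm N (\<lambda>j. y j - F x0 j)" by auto
      then have "nrm N (\<lambda>j. G y j - x0 j) \<le> K * e"
        using \<open>nrm N (\<lambda>j. y j - F x0 j) \<le> e\<close> Ke by (meson mult_left_mono less_imp_le order.trans)
      then have "norm (G y i - x0 i) \<le> K * e" using norm_le_nrm[OF i, of "\<lambda>j. G y j - x0 j"] by simp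
      then have Gy: "norm (G y i) \<le> norm (x0 i) + K * e"
        using norm_triangle_ineq[of "x0 i" "G y i - x0 i"] by simp
      have "P (F (G y)) = P y" "D (F (G y)) = D y"
        using F_G[OF imy] by (auto intro!: polyf_cong[OF pP] polyf_cong[OF pD])
      then have "P y = D y * G y i" using DP[of "G y"] by simp
      then have "norm (P y) = norm (G y i) * norm (D y)" by (simp add: norm_mult)
      also have "\<dots> \<le> (norm (x0 i) + K * e) * norm (D y)" using Gy by (intro mult_right_mono) auto
      finally show ?thesis .
    qed
    with Ke show ?thesis by blast
  qed
  have key: "poly q l = poly q 0" if l: "l \<in> dom v0" "l \<noteq> 0" "poly (HD v0) l \<noteq> 0" for l
  proof -
    define x1 where "x1 = G (ray l v0)"
    have Fx1: "F x1 j = l * v0 j" if "j < N" for j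
      using F_G[OF _ that] l(1) by (simp add: x1_def dom_def)
    \<comment> \<open>The curve \<open>F(s x1)\<close>, whose terms have degree 1 and 3 in s. It
      runs inside the image from 0 at s = 0 to \<open>l v0\<close> at s = 1.\<close>
    define Y where "Y = (\<lambda>j. [:0, x1 j, 0, lin N a x1 j ^ 3:])"
    have Y: "poly (Y j) s = F (\<lambda>j. s * x1 j) j" for s j
      by (simp add: Y_def cubic_def lin_scale power_mult_distrib algebra_simps power3_eq_cube)
    define pp where "pp = (\<lambda>j. [:0, Y j:])"
    have "coeff (sec (pp j) s) k = coeff [:0, poly (Y j) s:] k" for j s k
      unfolding coeff_sec pp_def by (auto simp: coeff_pCons split: nat.split)
    then have pp: "sec (pp j) s = [:0, poly (Y j) s:]" for j s by (intro poly_eqI)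
    obtain Dh where Dh: "\<And>s t. poly (sec Dh s) t = D (\<lambda>j. t * poly (Y j) s)"
      using polyf_along2[OF pD, of pp] by (auto simp: pp)
    obtain Ph where Ph: "\<And>s t. poly (sec Ph s) t = P (\<lambda>j. t * poly (Y j) s)"
      using polyf_along2[OF pP, of pp] by (auto simp: pp)
    have Dh1: "poly (sec Dh 1) (t / l) = D (ray t v0)"
      and Ph1: "poly (sec Ph 1) (t / l) = P (ray t v0)" for t
      using l(2) unfolding Dh Ph
      by (auto intro!: polyf_cong[OF pD] polyf_cong[OF pP] simp: Y Fx1)
    have "Dh \<noteq> 0" using l Dh1[of l] by (auto simp: HD)
    define h where "h = gcd Dh Ph"
    have h: "h \<noteq> 0" using \<open>Dh \<noteq> 0\<close> by (simp add: h_def)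
    obtain Q R where QR: "Dh = h * Q" "Ph = h * R"
      unfolding h_def by (metis dvdE gcd_dvd1 gcd_dvd2)
    have cop: "coprime R Q"
    proof -
      have "coprime (Dh div h) (Ph div h)"
        unfolding h_def by (rule div_gcd_coprime) (use \<open>Dh \<noteq> 0\<close> in simp)
      then show ?thesis using h by (simp add: QR coprime_commute)
    qed
    have Q: "Q \<noteq> 0" using \<open>Dh \<noteq> 0\<close> QR by auto
    have nonzero: "poly (sec Q s0) t0 \<noteq> 0" if im0: "im (\<lambda>j. t0 * poly (Y j) s0)" for s0 t0
    proof -
      obtain e C where e: "e > 0" "\<And>y. nrm N (\<lambda>j. y j - t0 * poly (Y j) s0) < e \<Longrightarrow> norm (P y) \<le> C * norm (D y)"
        using local[OF im0] by blast
      define phi where "phi = (\<lambda>z. nrm N (\<lambda>j. snd z * poly (Y j) (fst z) - t0 * poly (Y j) s0))"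
      have "isCont phi (s0, t0)"
        unfolding phi_def nrm_def by (intro continuous_intros)
      then obtain d where d: "d > 0" "\<And>z. dist z (s0, t0) < d \<Longrightarrow> dist (phi z) (phi (s0, t0)) < e"
        using e(1) unfolding continuous_at_eps_delta by blast
      have phi0: "phi (s0, t0) = 0" by (simp add: phi_def nrm_def)
      show ?thesis
      proof (rule quotient_bounded_imp_nonzero[OF cop Q h, of "d / 2"])
        fix s t assume st: "norm (s - s0) < d / 2" "norm (t - t0) < d / 2"
        have "dist (s, t) (s0, t0) \<le> dist s s0 + dist t t0"
          unfolding dist_Pair_Pair by (rule sqrt_sum_squares_le_sum) auto
        then have "dist (s, t) (s0, t0) < d" using st by (simp add: dist_norm)
        from d(2)[OF this] have "nrm N (\<lambda>j. t * poly (Y j) s - t0 * poly (Y j) s0) < e"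
          by (simp add: phi0) (simp add: phi_def)
        from e(2)[OF this] show "norm (poly (sec (h * R) s) t) \<le> C * norm (poly (sec (h * Q) s) t)"
          by (simp add: QR[symmetric] Dh Ph)
      qed (use d in simp)
    qed
    \<comment> \<open>The point \<open>t Y(s)\<close> lies in the image for t = 0, for t = 1 and for
      s = 0, so \<open>Q\<close> is zero-free and thus constant on each of these three lines. As
      they meet, Q(1,0) = Q(0,0) = Q(0,1) = Q(1,1).\<close>
    have im0: "im (\<lambda>_. 0)" by (rule im_G_I(1)[of "\<lambda>_. 0"]) (rule F_0)
    have "poly (poly Q [:0:]) s \<noteq> 0" for s
      unfolding poly_sec_swap[symmetric] using nonzero[of 0 s] im0 by simp
    then have c1: "poly (sec Q 1) 0 = poly (sec Q 0) 0"
      unfolding poly_sec_swap by (rule poly_nonvanishing_const)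
    have "poly (poly Q [:1:]) s \<noteq> 0" for s
      unfolding poly_sec_swap[symmetric]
    proof (rule nonzero)
      show "im (\<lambda>j. 1 * poly (Y j) s)" by (rule im_G_I(1)[of "\<lambda>j. s * x1 j"]) (simp add: Y)
    qed
    then have c2: "poly (sec Q 1) 1 = poly (sec Q 0) 1"
      unfolding poly_sec_swap by (rule poly_nonvanishing_const)
    have nz0: "poly (sec Q 0) t \<noteq> 0" for t
      using nonzero[of t 0] im0 by (simp add: Y_def)
    have c3: "poly (sec Q 0) 0 = poly (sec Q 0) 1" "poly (sec Q 0) 0 \<noteq> 0"
      by (rule poly_nonvanishing_const[OF nz0], rule nz0)
    \<comment> \<open>For all but finitely many s the section of \<open>Q\<close> keeps its t-degree
      and, by the Bezout identity, stays coprime to that of \<open>R\<close>. It is then a reduced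
      denominator on the ray of \<open>Y(s)\<close>, to which maximality of \<open>q\<close>
      applies.\<close>
    have degQ: "degree Q \<le> degree q"
    proof -
      obtain u w r where r: "r \<noteq> 0" "u * R + w * Q = [:r:]"
        using coprime_imp_bezout_const[OF cop Q] by blast
      have "finite ({s. poly (lead_coeff Q) s = 0} \<union> {s. poly r s = 0} \<union> {s. sec Dh s = 0})"
        using Q r(1) \<open>Dh \<noteq> 0\<close> by (simp add: poly_roots_finite finite_sec_eq_0)
      from ex_new_if_finite[OF infinite_UNIV_char_0 this]
      obtain s where s: "poly (lead_coeff Q) s \<noteq> 0" "poly r s \<noteq> 0" "sec Dh s \<noteq> 0"
        by auto
      define y where "y = (\<lambda>j. poly (Y j) s)"
      have "poly (HD y) t = poly (sec Dh s) t" "poly (HP y) t = poly (sec Ph s) t" for t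
        by (simp_all add: HD HP Dh Ph y_def)
      then have eq: "HD y = sec Dh s" "HP y = sec Ph s"
        by (simp_all add: poly_eq_poly_eq_iff[symmetric] fun_eq_iff)
      have "coprime (sec R s) (sec Q s)"
      proof (rule coprimeI)
        fix k assume k: "k dvd sec R s" "k dvd sec Q s"
        have "sec (u * R + w * Q) s = sec u s * sec R s + sec w s * sec Q s"
          by (simp add: sec_add sec_mult)
        then have "k dvd sec (u * R + w * Q) s" using k by simp
        then have "k dvd [:poly r s:]" by (simp add: r)
        moreover have "is_unit [:poly r s:]" using s(2) by (simp add: is_unit_const_poly_iff dvd_field_iff)
        ultimately show "is_unit k" by (rule dvd_trans)
      qed
      moreover have "sec Q s \<noteq> 0" using s(1) by (metis coeff_0 coeff_sec)
      ultimately have "red (y, sec R s, sec Q s)"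
        using s(3) by (simp add: red_def eq) (simp add: QR sec_mult mult_ac)
      from max[OF this] show ?thesis by (simp add: degree_sec_eq[OF s(1)])
    qed
    \<comment> \<open>At s = 1 the surface is the ray of \<open>v0\<close> with parameter t / l, so
      \<open>R1 / Q1\<close> is another form of the fraction \<open>p / q\<close>.\<close>
    define Q1 R1 where "Q1 = pcompose (sec Q 1) [:0, 1 / l:]" and "R1 = pcompose (sec R 1) [:0, 1 / l:]"
    have "poly (R1 * HD v0) t = poly (Q1 * HP v0) t" for t
    proof -
      have "poly (HD v0) t = poly (sec Dh 1) (t / l)" "poly (HP v0) t = poly (sec Ph 1) (t / l)"
        by (simp_all only: HD HP Dh1 Ph1)
      then show ?thesis by (simp add: Q1_def R1_def poly_pcompose QR sec_mult)
    qed
    then have "R1 * HD v0 = Q1 * HP v0" by (simp add: poly_eq_poly_eq_iff[symmetric] fun_eq_iff)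
    then have "HD v0 * (R1 * q) = Q1 * (HP v0 * q)"
      by (metis mult.assoc mult.commute)
    then have "HD v0 * (R1 * q) = HD v0 * (Q1 * p)"
      unfolding r0(4)[symmetric] by (simp only: mult.left_commute)
    then have "R1 * q = Q1 * p" using r0(1) by simp
    then have "q dvd Q1 * p" by (metis dvd_triv_right)
    then have "q dvd Q1" using r0(3) by (metis coprime_commute coprime_dvd_mult_left_iff)
    then obtain k where k: "Q1 = q * k" by blast
    have Q1_0: "poly Q1 0 = poly (sec Q 0) 0" and Q1_l: "poly Q1 l = poly (sec Q 0) 0"
      using c1 c2 c3 l(2) by (simp_all add: Q1_def poly_pcompose)
    then have "Q1 \<noteq> 0" using c3(2) by auto
    then have "k \<noteq> 0" "degree Q1 = degree q + degree k" using r0(2) k by (auto simp: degree_mult_eq)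
    moreover have "degree Q1 \<le> degree q"
    proof -
      have "degree [:0, 1 / l:] = 1" using l(2) by (simp add: degree_pCons_eq_if)
      then have "degree Q1 \<le> degree (sec Q 1)"
        using degree_pcompose_le[of "sec Q 1" "[:0, 1 / l:]"] unfolding Q1_def by (simp only: mult_1_right)
      then show ?thesis using degQ degree_sec_le[of Q 1] by linarith
    qed
    \<comment> \<open>\<open>q\<close> divides \<open>Q1\<close>, which has no larger degree, so the
      two are proportional; \<open>Q1\<close> agrees at 0 and \<open>l\<close>, hence so does
      \<open>q\<close>.\<close>
    ultimately have "degree k = 0" by simp
    then obtain k0 where "k = [:k0:]" by (rule degree_eq_zeroE)
    then have "k0 * poly q l = k0 * poly q 0" "k0 \<noteq> 0" using Q1_0 Q1_l k \<open>k \<noteq> 0\<close> by auto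
    then show ?thesis by simp
  qed
  have "q - [:poly q 0:] = 0"
  proof (rule ccontr)
    assume "q - [:poly q 0:] \<noteq> 0"
    then have "finite {t. poly (q - [:poly q 0:]) t = 0}" by (rule poly_roots_finite)
    moreover have "finite {t. poly (HD v0) t = 0}" using r0(1) by (rule poly_roots_finite)
    moreover have "dom v0 \<subseteq> {t. poly (q - [:poly q 0:]) t = 0} \<union> {t. poly (HD v0) t = 0} \<union> {0}"
      using key by auto
    ultimately have "finite (dom v0)" by (auto intro: finite_subset)
    then show False using open_dom zero_in_dom finite_imp_not_open by blast
  qed
  then have "degree q = 0" by (metis degree_pCons_0 eq_iff_diff_eq_0)
  moreover obtain p1 q1 where r1: "red (v, p1, q1)" using ex_red[OF v] by blast
  ultimately have "degree q1 = 0" using max by (metis le_zero_eq)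
  moreover have "q1 \<noteq> 0" using r1 by (simp add: red_def)
  ultimately have "is_unit q1" by (simp add: is_unit_iff_degree)
  moreover have "HP v * q1 = HD v * p1" using r1 by (simp add: red_def)
  then have "HD v dvd HP v * q1" by simp
  ultimately show ?thesis by (simp add: dvd_mult_unit_iff)
qed

text \<open>On a ray with \<open>D v \<noteq> 0\<close> the Taylor series is the polynomial
  \<open>HP v / HD v\<close>, of degree at most the common bound \<open>MP\<close>. The other
  \<open>v\<close> are reached because \<open>D * taylor i k\<close> vanishes identically while
  \<open>D\<close> does not.\<close>

lemma taylor_eventually_0:
  assumes i: "i < N"
  shows "\<exists>M. \<forall>k>M. \<forall>v. taylor i k v = 0"
proof -
  obtain D P' where D: "polyf {..<N} D" "\<exists>y. D y \<noteq> 0" "\<forall>i<N. polyf {..<N} (P' i)"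
    "\<forall>i<N. \<forall>x. P' i (F x) = D (F x) * x i"
    using birational by blast
  define P where "P = P' i"
  have P: "polyf {..<N} P" "\<And>x. P (F x) = D (F x) * x i" using D i by (auto simp: P_def)
  obtain MD HD where HD: "\<And>v. degree (HD v) \<le> MD" "\<And>v t. poly (HD v) t = D (ray t v)"
    using polyf_line[OF D(1)] by blast
  obtain MP HP where HP: "\<And>v. degree (HP v) \<le> MP" "\<And>v t. poly (HP v) t = P (ray t v)"
    using polyf_line[OF P(1)] by blast
  have "taylor i k v = 0" if k: "k > MP" for k v
  proof -
    have "D v * taylor i k v = 0" for v
    proof (cases "D v = 0")
      case False
      then have "poly (HD v) 1 \<noteq> 0" by (simp add: HD)
      then have nz: "HD v \<noteq> 0" by auto
      then obtain p where p: "HP v = HD v * p"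
        using denominator_divides[OF i D(1) P HD(2,1) HP(2) nz] by blast
      have degp: "degree p \<le> MP"
      proof (cases "p = 0")
        case False
        then have "degree (HP v) = degree (HD v) + degree p" using nz p by (simp add: degree_mult_eq)
        then show ?thesis using HP(1)[of v] by simp
      qed simp
      have ev: "\<forall>\<^sub>F t in nhds 0. poly (HD v) t * g v i t = poly (HD v * p) t"
        using eventually_nhds_in_open[OF open_dom zero_in_dom, of v]
      proof eventually_elim
        case (elim t)
        then have imt: "im (ray t v)" by (simp add: dom_def)
        have "P (F (G (ray t v))) = P (ray t v)" "D (F (G (ray t v))) = D (ray t v)"
          using F_G[OF imt] by (auto intro!: polyf_cong[OF P(1)] polyf_cong[OF D(1)])
        then have "P (ray t v) = D (ray t v) * g v i t"
          using P(2)[of "G (ray t v)"] by (simp add: g_def)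
        then show ?case by (simp add: p[symmetric] HD HP)
      qed
      have "(\<lambda>t. poly (HD v) t * g v i t) has_fps_expansion
          fps_of_poly (HD v) * Abs_fps (\<lambda>k. taylor i k v)"
        by (intro has_fps_expansion_mult has_fps_expansion_poly g_has_fps_expansion i)
      then have "(\<lambda>t. poly (HD v * p) t) has_fps_expansion
          fps_of_poly (HD v) * Abs_fps (\<lambda>k. taylor i k v)"
        unfolding has_fps_expansion_cong[OF ev refl] .
      from fps_expansion_unique_complex[OF has_fps_expansion_poly this]
      have "fps_of_poly (HD v) * fps_of_poly p = fps_of_poly (HD v) * Abs_fps (\<lambda>k. taylor i k v)"
        by (simp add: fps_of_poly_mult)
      then have "fps_of_poly p = Abs_fps (\<lambda>k. taylor i k v)"
        using nz by simp
      from arg_cong[OF this, of "\<lambda>f. fps_nth f k"]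
      have "taylor i k v = coeff p k" by simp
      then show ?thesis using degp k by (simp add: coeff_eq_0)
    qed simp
    then show ?thesis using polyf_mult_eq_0[OF D(1) polyf_taylor[OF i]] D(2) by blast
  qed
  then show ?thesis by blast
qed

text \<open>\<open>H\<close> sums the finite Taylor series at t = 1. The identity
  \<open>F(g(t)) = t v\<close>, known for small t, is polynomial in t and so persists to t = 1
  whether or not \<open>v\<close> was known to lie in the image.\<close>

theorem polynomial_right_inverse:
  "\<exists>H. (\<forall>i<N. polyf {..<N} (H i)) \<and> (\<forall>y. \<forall>i<N. F (\<lambda>j. H j y) i = y i)"
proof -
  have "\<forall>i. \<exists>M. i < N \<longrightarrow> (\<forall>k>M. \<forall>v. taylor i k v = 0)" using taylor_eventually_0 by blast
  from choice[OF this] obtain Mi where Mi: "\<And>i k v. i < N \<Longrightarrow> k > Mi i \<Longrightarrow> taylor i k v = 0" by blast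
  define M where "M = (\<Sum>i<N. Mi i)"
  have M: "taylor i k v = 0" if "i < N" "k > M" for i k v
  proof -
    have "Mi i \<le> M" unfolding M_def using that by (intro member_le_sum) auto
    then show ?thesis using that by (intro Mi) auto
  qed
  define H where "H = (\<lambda>i v. \<Sum>k\<le>M. taylor i k v)"
  have "F (\<lambda>j. H j v) i = v i" if i: "i < N" for v i
  proof -
    define p where "p = (\<lambda>j. \<Sum>k\<le>M. monom (taylor j k v) k)"
    have pg: "\<forall>\<^sub>F t in nhds 0. poly (p j) t = g v j t" if j: "j < N" for j
    proof (rule has_fps_expansion_unique_fun[OF has_fps_expansion_poly])
      have "fps_of_poly (p j) = Abs_fps (\<lambda>k. taylor j k v)"
      proof (rule fps_ext)
        fix n
        have "coeff (p j) n = (if n \<le> M then taylor j n v else 0)"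
          by (simp add: p_def coeff_sum)
        then show "fps_nth (fps_of_poly (p j)) n = fps_nth (Abs_fps (\<lambda>k. taylor j k v)) n"
          using M[OF j, of n v] by simp
      qed
      then show "g v j has_fps_expansion fps_of_poly (p j)" using g_has_fps_expansion[OF j] by simp
    qed
    define r where "r = p i + (\<Sum>j<N. [:a i j:] * p j) ^ 3 - [:0, v i:]"
    have r: "poly r t = F (\<lambda>j. poly (p j) t) i - t * v i" for t
      by (simp add: r_def cubic_def lin_def poly_sum)
    have "\<forall>\<^sub>F t in nhds 0. \<forall>j\<in>{..<N}. poly (p j) t = g v j t"
      by (intro eventually_ball_finite ballI pg) auto
    moreover have "\<forall>\<^sub>F t in nhds 0. t \<in> dom v"
      by (rule eventually_nhds_in_open[OF open_dom zero_in_dom])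
    ultimately have "\<forall>\<^sub>F t in nhds 0. poly r t = 0"
    proof eventually_elim
      case (elim t)
      then have "F (\<lambda>j. poly (p j) t) i = F (\<lambda>j. g v j t) i" by (intro F_cong i) simp
      then show ?case using F_g[OF elim(2) i] by (simp add: r)
    qed
    then obtain S where S: "open S" "0 \<in> S" "\<And>t. t \<in> S \<Longrightarrow> poly r t = 0"
      unfolding eventually_nhds by blast
    have "r = 0"
    proof (rule ccontr)
      assume "r \<noteq> 0"
      then have "finite {t. poly r t = 0}" by (rule poly_roots_finite)
      moreover have "S \<subseteq> {t. poly r t = 0}" using S(3) by blast
      ultimately have "finite S" by (rule finite_subset[rotated])
      then show False using S finite_imp_not_open by blast
    qed
    then have "F (\<lambda>j. poly (p j) 1) i = v i" using r[of 1] by simp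
    moreover have "poly (p j) 1 = H j v" for j by (simp add: p_def H_def poly_sum poly_monom)
    ultimately show ?thesis by simp
  qed
  moreover have "polyf {..<N} (H i)" if "i < N" for i
    unfolding H_def by (intro polyf_sum polyf_taylor that)
  ultimately show ?thesis by blast
qed

end

section \<open>Injectivity of cubic linear maps\<close>

lemma jacobian_cubic_map:
  assumes x: "x \<in> carrier_vec n"
  shows "jacobian n (cubic_map (mat n n (\<lambda>(i, j). a i j))) x
    = mat n n (\<lambda>(i, j). (if i = j then 1 else 0) + 3 * lin n a (($) x) i ^ 2 * a i j)"
proof (rule eq_matI)
  fix i j assume "i < dim_row (mat n n (\<lambda>(i, j). (if i = j then 1 else 0) + 3 * lin n a (($) x) i ^ 2 * a i j))"
    "j < dim_col (mat n n (\<lambda>(i, j). (if i = j then 1 else 0) + 3 * lin n a (($) x) i ^ 2 * a i j))"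
  then have ij: "i < n" "j < n" by auto
  have val: "cubic_map (mat n n (\<lambda>(i, j). a i j)) (x |\<^sub>v j \<mapsto> t) $ i
      = ((if i = j then t else x $ i) + (lin n a (($) x) i + a i j * (t - x $ j)) ^ 3)" for t
  proof -
    have "(mat n n (\<lambda>(i, j). a i j) *\<^sub>v (x |\<^sub>v j \<mapsto> t)) $ i = (\<Sum>k<n. a i k * (if k = j then t else x $ k))"
      using ij x by (simp add: scalar_prod_def atLeast0LessThan update_vec_def)
    also have "\<dots> = (\<Sum>k<n. a i k * x $ k + (if k = j then a i j * (t - x $ j) else 0))"
      by (intro sum.cong) (auto simp: algebra_simps)
    also have "\<dots> = lin n a (($) x) i + a i j * (t - x $ j)"
      using ij by (simp add: sum.distrib lin_def)
    finally show ?thesis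
      using ij x by (simp add: cubic_map_def vec_power_def update_vec_def)
  qed
  have "((\<lambda>t. (if i = j then t else x $ i) + (lin n a (($) x) i + a i j * (t - x $ j)) ^ 3) has_field_derivative
      ((if i = j then 1 else 0) + 3 * lin n a (($) x) i ^ 2 * a i j)) (at (x $ j))"
    by (cases "i = j") (auto intro!: derivative_eq_intros simp: power2_eq_square)
  then have "deriv (\<lambda>t. (if i = j then t else x $ i) + (lin n a (($) x) i + a i j * (t - x $ j)) ^ 3) (x $ j)
      = (if i = j then 1 else 0) + 3 * lin n a (($) x) i ^ 2 * a i j"
    by (rule DERIV_imp_deriv)
  then show "jacobian n (cubic_map (mat n n (\<lambda>(i, j). a i j))) x $$ (i, j)
    = mat n n (\<lambda>(i, j). (if i = j then 1 else 0) + 3 * lin n a (($) x) i ^ 2 * a i j) $$ (i, j)"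
    using ij by (simp add: jacobian_def val)
qed (simp_all add: jacobian_def)

lemma lin_scale_rows: "lin n (\<lambda>i j. d i * a i j) v i = d i * lin n a v i"
  by (simp add: lin_def sum_distrib_left mult.assoc)

text \<open>The parameter \<open>c\<close> of the kernel criterion is absorbed by scaling
  \<open>x\<close> with a square root of \<open>c\<close>.\<close>

lemma keller_cubic_imp_druzkowski:
  assumes kel: "keller_cubic n a"
  shows "druzkowski n (mat n n (\<lambda>(i, j). a i j))"
  unfolding druzkowski_def
proof (intro conjI ballI)
  fix x :: "complex vec" assume x: "x \<in> carrier_vec n"
  show "det (jacobian n (cubic_map (mat n n (\<lambda>(i, j). a i j))) x) = 1"
    unfolding jacobian_cubic_map[OF x]
  proof (rule det_eq_1_if_kernels_trivial)
    fix c v assume v: "\<And>i. i < n \<Longrightarrow> v i + c * lin n (\<lambda>i j. 3 * lin n a (($) x) i ^ 2 * a i j) v i = 0"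
    have "jac n a (\<lambda>j. csqrt c * x $ j) v i = 0" if "i < n" for i
      using v[OF that, unfolded lin_scale_rows] by (simp add: jac_def lin_scale power_mult_distrib mult_ac)
    then show "\<forall>i<n. v i = 0" using kel unfolding keller_cubic_def by blast
  qed
qed simp

text \<open>Kernels suffice for the determinant condition, as the parameter \<open>c\<close> is
  absorbed by scaling \<open>s\<close> and \<open>t\<close> with a square root of
  \<open>c\<close>.\<close>

lemma V_memberI:
  assumes ker: "\<And>s t v. (\<And>i. i < n \<Longrightarrow> v i + (s * z i + t * y i) ^ 2 * lin n a v i = 0) \<Longrightarrow> \<forall>i<n. v i = 0"
    and eq: "\<And>i. i < n \<Longrightarrow> z i + lin n a (\<lambda>j. z j ^ 3 + z j * y j ^ 2) i = 0"
  shows "(vec n y, vec n z, mat n n (\<lambda>(i, j). a i j)) \<in> V n"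
  unfolding V_def
proof (clarify, intro conjI allI)
  fix s t
  define u where "u = (\<lambda>i. (s * z i + t * y i) ^ 2)"
  have "Diag ((s \<cdot>\<^sub>v vec n z + t \<cdot>\<^sub>v vec n y) ^\<^sub>c 2) = mat_diag n u"
    by (rule eq_matI) (auto simp: Diag_def vec_power_def mat_diag_def u_def)
  then have "Diag ((s \<cdot>\<^sub>v vec n z + t \<cdot>\<^sub>v vec n y) ^\<^sub>c 2) * mat n n (\<lambda>(i, j). a i j)
      = mat n n (\<lambda>(i, j). u i * a i j)"
    by (simp add: mat_diag_mult_left[of _ n n]) (rule cong_mat, auto)
  then have "1\<^sub>m n + Diag ((s \<cdot>\<^sub>v vec n z + t \<cdot>\<^sub>v vec n y) ^\<^sub>c 2) * mat n n (\<lambda>(i, j). a i j)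
      = mat n n (\<lambda>(i, j). (if i = j then 1 else 0) + u i * a i j)"
    by (simp only:) (rule eq_matI, auto)
  moreover have "det (mat n n (\<lambda>(i, j). (if i = j then 1 else 0) + u i * a i j)) = 1"
  proof (rule det_eq_1_if_kernels_trivial)
    fix c v assume v: "\<And>i. i < n \<Longrightarrow> v i + c * lin n (\<lambda>i j. u i * a i j) v i = 0"
    have sq: "(csqrt c * s * z i + csqrt c * t * y i) ^ 2 = c * u i" for i
    proof -
      have "csqrt c * s * z i + csqrt c * t * y i = csqrt c * (s * z i + t * y i)" by (simp add: algebra_simps)
      then show ?thesis by (simp add: u_def power_mult_distrib)
    qed
    show "\<forall>i<n. v i = 0"
    proof (rule ker)
      fix i assume "i < n"
      then show "v i + (csqrt c * s * z i + csqrt c * t * y i) ^ 2 * lin n a v i = 0"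
        using v[unfolded lin_scale_rows] unfolding sq by (simp only: mult.assoc)
    qed
  qed
  ultimately show "det (1\<^sub>m n + Diag ((s \<cdot>\<^sub>v vec n z + t \<cdot>\<^sub>v vec n y) ^\<^sub>c 2) * mat n n (\<lambda>(i, j). a i j)) = 1"
    by simp
next
  show "vec n z + mat n n (\<lambda>(i, j). a i j) *\<^sub>v (vec n z ^\<^sub>c 3 + vec n z *\<^sub>c vec n y ^\<^sub>c 2) = 0\<^sub>v n"
  proof (rule eq_vecI)
    fix i assume "i < dim_vec (0\<^sub>v n :: complex vec)"
    then have i: "i < n" by simp
    have "(mat n n (\<lambda>(i, j). a i j) *\<^sub>v (vec n z ^\<^sub>c 3 + vec n z *\<^sub>c vec n y ^\<^sub>c 2)) $ i
        = lin n a (\<lambda>j. z j ^ 3 + z j * y j ^ 2) i"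
      using i by (simp add: scalar_prod_def lin_def atLeast0LessThan vec_power_def vec_times_def)
    then show "(vec n z + mat n n (\<lambda>(i, j). a i j) *\<^sub>v (vec n z ^\<^sub>c 3 + vec n z *\<^sub>c vec n y ^\<^sub>c 2)) $ i = 0\<^sub>v n $ i"
      using i eq[OF i] by simp
  qed simp
qed simp_all

lemma ex_bij_support_first:
  assumes fin: "finite I" and S: "S \<subseteq> I"
  shows "\<exists>b. bij_betw b {..<card I} I \<and> (\<forall>i<card I. b i \<in> S \<longleftrightarrow> i < card S)"
proof -
  have finS: "finite S" using S fin finite_subset by blast
  obtain f where f: "bij_betw f {0..<card S} S" using ex_bij_betw_nat_finite[OF finS] by blast
  obtain g where g: "bij_betw g {0..<card (I - S)} (I - S)" using ex_bij_betw_nat_finite fin by blast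
  have le: "card S \<le> card I" and cd: "card (I - S) = card I - card S"
    using S fin by (simp_all add: card_mono card_Diff_subset finS)
  define b where "b = (\<lambda>i. if i < card S then f i else g (i - card S))"
  have 1: "bij_betw b {0..<card S} S"
    using f by (rule bij_betw_cong[THEN iffD1, rotated]) (simp add: b_def)
  have sh: "bij_betw (\<lambda>i. i - card S) {card S..<card I} {0..<card (I - S)}"
    by (rule bij_betw_byWitness[where f' = "\<lambda>i. i + card S"]) (use le in \<open>auto simp: cd\<close>)
  have "bij_betw (g \<circ> (\<lambda>i. i - card S)) {card S..<card I} (I - S)"
    by (rule bij_betw_trans[OF sh g])
  then have 2: "bij_betw b {card S..<card I} (I - S)"
    by (rule bij_betw_cong[THEN iffD1, rotated]) (simp add: b_def)
  have "bij_betw b ({0..<card S} \<union> {card S..<card I}) (S \<union> (I - S))"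
    by (rule bij_betw_combine[OF 1 2]) blast
  moreover have "{0..<card S} \<union> {card S..<card I} = {..<card I}" using le by auto
  moreover have "S \<union> (I - S) = I" using S by blast
  ultimately have "bij_betw b {..<card I} I" by simp
  moreover have "b i \<in> S \<longleftrightarrow> i < card S" if "i < card I" for i
  proof (cases "i < card S")
    case True
    then show ?thesis using bij_betw_apply[OF 1, of i] by simp
  next
    case False
    then show ?thesis using that bij_betw_apply[OF 2, of i] by simp
  qed
  ultimately show ?thesis by blast
qed

text \<open>Conjugating by a permutation and by the diagonal matrix with entries \<open>z\<^sub>i\<close> (or 1 where
  \<open>z\<^sub>i = 0\<close>) moves an arbitrary \<open>z\<close> to the normal form \<open>Z n k\<close>.\<close>

lemma normalised_solution:
  fixes a :: "'i \<Rightarrow> 'i \<Rightarrow> complex"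
  assumes fin: "finite I"
    and ker1: "\<And>x v. (\<And>i. i \<in> I \<Longrightarrow> v i + 3 * (\<Sum>j\<in>I. a i j * x j) ^ 2 * (\<Sum>j\<in>I. a i j * v j) = 0)
      \<Longrightarrow> \<forall>i\<in>I. v i = 0"
    and ker2: "\<And>s t v. (\<And>i. i \<in> I \<Longrightarrow> v i + (s * z i + t * y i) ^ 2 * (\<Sum>j\<in>I. a i j * v j) = 0)
      \<Longrightarrow> \<forall>i\<in>I. v i = 0"
    and eq: "\<And>i. i \<in> I \<Longrightarrow> z i + (\<Sum>j\<in>I. a i j * (z j ^ 3 + z j * y j ^ 2)) = 0"
  defines "n \<equiv> card I" and "k \<equiv> card {i \<in> I. z i \<noteq> 0}"
  shows "\<exists>A y'. druzkowski n A \<and> y' \<in> carrier_vec n \<and> (y', Z n k, A) \<in> V n"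
proof -
  obtain b where b: "bij_betw b {..<n} I" "\<And>i. i < n \<Longrightarrow> b i \<in> {i \<in> I. z i \<noteq> 0} \<longleftrightarrow> i < k"
    using ex_bij_support_first[OF fin, of "{i \<in> I. z i \<noteq> 0}"] unfolding n_def k_def by blast
  have bI: "b i \<in> I" if "i < n" for i using bij_betw_apply[OF b(1)] that by simp
  define b' where "b' = the_inv_into {..<n} b"
  have b': "b' (b i) = i" if "i < n" for i
    unfolding b'_def using that b(1) by (intro the_inv_into_f_f) (auto simp: bij_betw_def)
  have ex_b: "\<exists>i<n. j = b i" if "j \<in> I" for j
    using that b(1) unfolding bij_betw_def by (metis imageE lessThan_iff)
  define E where "E = (\<lambda>i. if i < k then z (b i) else 1)"
  have E: "E i \<noteq> 0" if "i < n" for i using b(2)[OF that] that by (auto simp: E_def)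
  have zE: "z (b i) / E i = (if i < k then 1 else 0)" if "i < n" for i
    using b(2)[OF that] bI[OF that] by (auto simp: E_def)
  \<comment> \<open>Up to renumbering by \<open>b\<close>, this is \<open>E^-1 a E^3\<close>, the
    change under which \<open>z\<close> becomes \<open>z / E\<close>. \<open>E^3\<close> times a
    kernel equation of \<open>A\<close> for \<open>v\<close> is the corresponding one of
    \<open>a\<close> for \<open>L v\<close>.\<close>
  define A where "A = (\<lambda>i j. a (b i) (b j) * E j ^ 3 / E i)"
  define L where "L = (\<lambda>v i. E (b' i) ^ 3 * v (b' i))"
  have Lb: "L v (b i) = E i ^ 3 * v i" if "i < n" for v i by (simp add: L_def b' that)
  have lin: "lin n A v i = (\<Sum>j\<in>I. a (b i) j * L v j) / E i" for v i
  proof -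
    have "(\<Sum>j\<in>I. a (b i) j * L v j) = (\<Sum>j<n. a (b i) (b j) * L v (b j))"
      by (rule sum.reindex_bij_betw[OF b(1), symmetric])
    also have "\<dots> = (\<Sum>j<n. a (b i) (b j) * (E j ^ 3 * v j))" by (intro sum.cong) (simp_all add: Lb)
    finally show ?thesis by (simp add: lin_def A_def sum_divide_distrib mult_ac)
  qed
  have L0: "\<forall>i<n. v i = 0" if "\<forall>i\<in>I. L v i = 0" for v
    using that Lb E bI by (metis mult_eq_0_iff power_eq_0_iff)
  have "keller_cubic n A"
    unfolding keller_cubic_def
  proof (intro allI impI)
    fix x v i assume v: "\<forall>i<n. jac n A x v i = 0" and i: "i < n"
    have "L v j + 3 * (\<Sum>l\<in>I. a j l * L x l) ^ 2 * (\<Sum>l\<in>I. a j l * L v l) = 0" if j: "j \<in> I" for j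
    proof -
      obtain i where i: "i < n" "j = b i" using ex_b[OF j] by blast
      have "E i ^ 3 * jac n A x v i = 0" using v i by simp
      then show ?thesis
        using E[OF i(1)] unfolding jac_def lin i(2) Lb[OF i(1)]
        by (simp add: field_simps power2_eq_square power3_eq_cube)
    qed
    from ker1[of "L v" "L x", OF this] show "v i = 0" using L0 i by blast
  qed
  then have "druzkowski n (mat n n (\<lambda>(i, j). A i j))" by (rule keller_cubic_imp_druzkowski)
  moreover have "(vec n (\<lambda>i. y (b i) / E i), vec n (\<lambda>i. z (b i) / E i), mat n n (\<lambda>(i, j). A i j)) \<in> V n"
  proof (rule V_memberI)
    fix s t v assume v: "\<And>i. i < n \<Longrightarrow> v i + (s * (z (b i) / E i) + t * (y (b i) / E i)) ^ 2 * lin n A v i = 0"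
    have "L v j + (s * z j + t * y j) ^ 2 * (\<Sum>l\<in>I. a j l * L v l) = 0" if j: "j \<in> I" for j
    proof -
      obtain i where i: "i < n" "j = b i" using ex_b[OF j] by blast
      have "E i ^ 3 * (v i + (s * (z (b i) / E i) + t * (y (b i) / E i)) ^ 2 * lin n A v i) = 0"
        using v i by simp
      moreover have "s * (z (b i) / E i) + t * (y (b i) / E i) = (s * z (b i) + t * y (b i)) / E i"
        by (simp add: add_divide_distrib)
      ultimately show ?thesis
        using E[OF i(1)] unfolding lin i(2) Lb[OF i(1)]
        by (simp add: field_simps power2_eq_square power3_eq_cube)
    qed
    from ker2[of "L v" s t, OF this] show "\<forall>i<n. v i = 0" using L0 by blast
  next
    fix i assume i: "i < n"
    define w where "w = (\<lambda>j. (z (b j) / E j) ^ 3 + z (b j) / E j * (y (b j) / E j) ^ 2)"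
    have "(\<Sum>j\<in>I. a (b i) j * L w j) = (\<Sum>j\<in>I. a (b i) j * (z j ^ 3 + z j * y j ^ 2))"
    proof (intro sum.cong refl)
      fix j assume "j \<in> I"
      then obtain l where l: "l < n" "j = b l" using ex_b by blast
      have "L w j = z j ^ 3 + z j * y j ^ 2"
        using E[OF l(1)] unfolding l(2) Lb[OF l(1)]
        by (simp add: w_def field_simps power2_eq_square power3_eq_cube)
      then show "a (b i) j * L w j = a (b i) j * (z j ^ 3 + z j * y j ^ 2)" by simp
    qed
    then have "z (b i) / E i + lin n A w i = (z (b i) + (\<Sum>j\<in>I. a (b i) j * (z j ^ 3 + z j * y j ^ 2))) / E i"
      by (simp add: lin add_divide_distrib)
    then show "z (b i) / E i + lin n A (\<lambda>j. (z (b j) / E j) ^ 3 + z (b j) / E j * (y (b j) / E j) ^ 2) i = 0"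
      using eq[OF bI[OF i]] by (simp add: w_def)
  qed
  moreover have "vec n (\<lambda>i. z (b i) / E i) = Z n k"
    by (rule eq_vecI) (simp_all add: Z_def zE)
  ultimately show ?thesis by (metis vec_carrier)
qed

lemma keller_cubic_injective:
  assumes hyp: "\<And>n k. k \<in> {3..n} \<Longrightarrow>
      \<not> (\<exists>A y. druzkowski n A \<and> y \<in> carrier_vec n \<and> (y, Z n k, A) \<in> V n)"
    and kel: "keller_cubic N a"
    and eq: "\<And>i. i < N \<Longrightarrow> cubic N a p i = cubic N a q i"
    and i0: "i0 < N"
  shows "p i0 = q i0"
proof (rule ccontr)
  assume neq: "p i0 \<noteq> q i0"
  \<comment> \<open>With P = A p and Q = A q one has
    \<open>P^3 - Q^3 = 2 (z^3 + 3 z ((P + Q) / 2)^2)\<close>; a square root of 3 in \<open>y\<close>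
    absorbs the factor 3.\<close>
  define r where "r = complex_of_real (sqrt 3)"
  have r: "r ^ 2 = 3" unfolding r_def of_real_power[symmetric] by simp
  then have r0: "r \<noteq> 0" by auto
  define z where "z = (\<lambda>i. (lin N a p i - lin N a q i) / 2)"
  define y where "y = (\<lambda>i. r * (lin N a p i + lin N a q i) / 2)"
  define h where "h = (\<lambda>i. lin N a p i ^ 3 - lin N a q i ^ 3)"
  have ph: "p i - q i = - h i" if "i < N" for i using eq[OF that] by (simp add: cubic_def h_def algebra_simps)
  have hz: "h i = 2 * (z i ^ 3 + z i * y i ^ 2)" for i
  proof -
    have "y i ^ 2 = 3 * ((lin N a p i + lin N a q i) / 2) ^ 2"
      by (simp add: y_def power_mult_distrib power_divide r)
    show ?thesis unfolding \<open>y i ^ 2 = _\<close>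
      by (simp add: h_def z_def field_simps power2_eq_square power3_eq_cube)
  qed
  have zeq: "z i + lin N a (\<lambda>j. z j ^ 3 + z j * y j ^ 2) i = 0" for i
  proof -
    have "2 * z i = lin N a (\<lambda>j. p j - q j) i" by (simp add: z_def lin_diff)
    also have "\<dots> = lin N a (\<lambda>j. (- 2) * (z j ^ 3 + z j * y j ^ 2)) i"
      by (rule lin_cong) (simp add: ph hz)
    also have "\<dots> = - 2 * lin N a (\<lambda>j. z j ^ 3 + z j * y j ^ 2) i" by (rule lin_scale)
    finally show ?thesis by simp
  qed
  have ker2: "\<forall>i<N. v i = 0" if v: "\<And>i. i < N \<Longrightarrow> v i + (s * z i + t * y i) ^ 2 * lin N a v i = 0" for s t v
  proof -
    \<comment> \<open>Chosen so that \<open>A X = (s z + t y) / r\<close>, which turns the factor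
      \<open>3 (A X)^2\<close> of the Jacobian into \<open>(s z + t y)^2\<close>.\<close>
    define X where "X = (\<lambda>j. s / (2 * r) * (p j - q j) + t / 2 * (p j + q j))"
    have "lin N a X i = (s * z i + t * y i) / r" for i
    proof -
      have "lin N a X i = s / (2 * r) * (lin N a p i - lin N a q i) + t / 2 * (lin N a p i + lin N a q i)"
        unfolding X_def lin_add lin_scale lin_diff ..
      then show ?thesis using r0 by (simp add: z_def y_def field_simps)
    qed
    then have "jac N a X v i = v i + (s * z i + t * y i) ^ 2 * lin N a v i" for i
      by (simp add: jac_def power_divide r)
    then show ?thesis using kel v unfolding keller_cubic_def by metis
  qed
  have "h i0 \<noteq> 0" using ph[OF i0] neq by auto
  then have z0: "z i0 \<noteq> 0" by (auto simp: hz)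
  define I where "I = {..<N} \<times> {..<3::nat}"
  define a3 where "a3 = (\<lambda>(i, b) (j, b'). if b = (b' :: nat) then a i j else 0)"
  have sum3: "(\<Sum>j\<in>I. a3 (i, b) j * v j) = lin N a (\<lambda>j. v (j, b)) i" if "b < 3" for i b v
  proof -
    have "(\<Sum>j\<in>I. a3 (i, b) j * v j) = (\<Sum>j<N. \<Sum>b'<3. if b = b' then a i j * v (j, b') else 0)"
      unfolding I_def sum.cartesian_product by (intro sum.cong) (auto simp: a3_def)
    then show ?thesis using that by (simp add: lin_def)
  qed
  have "\<exists>A y'. druzkowski (card I) A \<and> y' \<in> carrier_vec (card I) \<and>
      (y', Z (card I) (card {i \<in> I. z (fst i) \<noteq> 0}), A) \<in> V (card I)"
  proof (rule normalised_solution[where a = a3 and z = "\<lambda>i. z (fst i)" and y = "\<lambda>i. y (fst i)"])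
    show "finite I" by (simp add: I_def)
  next
    fix x v assume v: "\<And>i. i \<in> I \<Longrightarrow> v i + 3 * (\<Sum>j\<in>I. a3 i j * x j) ^ 2 * (\<Sum>j\<in>I. a3 i j * v j) = 0"
    show "\<forall>i\<in>I. v i = 0"
    proof
      fix ib assume "ib \<in> I"
      then obtain i b where ib: "ib = (i, b)" "i < N" "b < 3" by (auto simp: I_def)
      have "jac N a (\<lambda>j. x (j, b)) (\<lambda>j. v (j, b)) l = 0" if "l < N" for l
        using v[of "(l, b)"] that ib by (simp add: I_def[symmetric] jac_def sum3) (simp add: I_def)
      then show "v ib = 0" using kel ib unfolding keller_cubic_def by metis
    qed
  next
    fix s t v assume v: "\<And>i. i \<in> I \<Longrightarrow> v i + (s * z (fst i) + t * y (fst i)) ^ 2 * (\<Sum>j\<in>I. a3 i j * v j) = 0"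
    show "\<forall>i\<in>I. v i = 0"
    proof
      fix ib assume "ib \<in> I"
      then obtain i b where ib: "ib = (i, b)" "i < N" "b < 3" by (auto simp: I_def)
      have "v (l, b) + (s * z l + t * y l) ^ 2 * lin N a (\<lambda>j. v (j, b)) l = 0" if "l < N" for l
        using v[of "(l, b)"] that ib by (simp add: sum3) (simp add: I_def)
      from ker2[of "\<lambda>j. v (j, b)" s t, OF this] show "v ib = 0" using ib by simp
    qed
  next
    fix ib assume "ib \<in> I"
    then obtain i b where ib: "ib = (i, b)" "i < N" "b < 3" by (auto simp: I_def)
    show "z (fst ib) + (\<Sum>j\<in>I. a3 ib j * (z (fst j) ^ 3 + z (fst j) * y (fst j) ^ 2)) = 0"
      using zeq[of i] by (simp add: ib sum3)
  qed
  moreover have "card {i \<in> I. z (fst i) \<noteq> 0} \<in> {3..card I}"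
  proof -
    have fin: "finite {i \<in> I. z (fst i) \<noteq> 0}" by (simp add: I_def)
    have "{i0} \<times> {..<3} \<subseteq> {i \<in> I. z (fst i) \<noteq> 0}" using z0 i0 by (auto simp: I_def)
    from card_mono[OF fin this] have "3 \<le> card {i \<in> I. z (fst i) \<noteq> 0}"
      by (simp add: card_cartesian_product)
    moreover have "card {i \<in> I. z (fst i) \<noteq> 0} \<le> card I" by (intro card_mono) (auto simp: I_def)
    ultimately show ?thesis by simp
  qed
  ultimately show False using hyp by blast
qed

section \<open>Reduction to cubic linear maps\<close>

primrec wmon :: "'i list \<Rightarrow> ('i \<Rightarrow> complex) \<Rightarrow> complex" where
  "wmon [] x = 1"
| "wmon (i # w) x = x i * wmon w x"

text \<open>The Leibniz rule for the derivative of \<open>wmon w\<close> at \<open>x\<close> in the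
  direction \<open>v\<close>.\<close>

primrec dwmon :: "'i list \<Rightarrow> ('i \<Rightarrow> complex) \<Rightarrow> ('i \<Rightarrow> complex) \<Rightarrow> complex" where
  "dwmon [] x v = 0"
| "dwmon (i # w) x v = v i * wmon w x + x i * dwmon w x v"

lemma wmon_append: "wmon (u @ w) x = wmon u x * wmon w x"
  by (induction u) auto

lemma dwmon_append: "dwmon (u @ w) x v = dwmon u x v * wmon w x + wmon u x * dwmon w x v"
  by (induction u) (auto simp: wmon_append algebra_simps)

lemma wmon_map: "wmon (map h w) x = wmon w (\<lambda>i. x (h i))"
  by (induction w) auto

lemma dwmon_map: "dwmon (map h w) x v = dwmon w (\<lambda>i. x (h i)) (\<lambda>i. v (h i))"
  by (induction w) (auto simp: wmon_map)

lemma wmon_cong: "(\<And>i. i \<in> set w \<Longrightarrow> x i = y i) \<Longrightarrow> wmon w x = wmon w y"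
  by (induction w) auto

lemma wmon_scale: "wmon w (ray t x) = t ^ length w * wmon w x"
  by (induction w) auto

lemma dwmon_scale: "length w = Suc k \<Longrightarrow> dwmon w (ray t x) v = t ^ k * dwmon w x v"
proof (induction w arbitrary: k)
  case (Cons i w)
  show ?case
  proof (cases k)
    case 0
    then show ?thesis using Cons by simp
  next
    case (Suc l)
    then have "dwmon w (ray t x) v = t ^ l * dwmon w x v" using Cons by simp
    then show ?thesis using Suc Cons.prems by (simp add: wmon_scale algebra_simps)
  qed
qed simp

lemma polyf_mon: "set w \<subseteq> I \<Longrightarrow> polyf I (wmon w)"
proof (induction w)
  case Nil
  have "wmon [] = (\<lambda>x. 1)" by (rule ext) simp
  then show ?case by simp
next
  case (Cons i w)
  have "wmon (i # w) = (\<lambda>x. x i * wmon w x)" by (rule ext) simp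
  then show ?case using Cons by (auto intro!: polyf.mult polyf.var)
qed

text \<open>Sharing the coefficients makes \<open>df\<close> the formal derivative of
  \<open>f\<close>. Words show the degree as length and factors as prefix and suffix; a monomial may
  be spelt by several words, so \<open>c\<close> need not be unique.\<close>

definition wpoly :: "'i list set \<Rightarrow> (('i \<Rightarrow> complex) \<Rightarrow> complex) \<Rightarrow> (('i \<Rightarrow> complex) \<Rightarrow> ('i \<Rightarrow> complex) \<Rightarrow> complex) \<Rightarrow> bool" where
  "wpoly W f df \<longleftrightarrow> (\<exists>c. (\<forall>x. f x = (\<Sum>w\<in>W. c w * wmon w x)) \<and> (\<forall>x v. df x v = (\<Sum>w\<in>W. c w * dwmon w x v)))"

lemma wpoly_zero: "wpoly W (\<lambda>x. 0) (\<lambda>x v. 0)"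
  unfolding wpoly_def by (intro exI[of _ "\<lambda>_. 0"]) simp

lemma wpoly_add:
  assumes "wpoly W f df" "wpoly W g dg"
  shows "wpoly W (\<lambda>x. f x + g x) (\<lambda>x v. df x v + dg x v)"
proof -
  obtain c c' where "\<And>x. f x = (\<Sum>w\<in>W. c w * wmon w x)" "\<And>x v. df x v = (\<Sum>w\<in>W. c w * dwmon w x v)"
    "\<And>x. g x = (\<Sum>w\<in>W. c' w * wmon w x)" "\<And>x v. dg x v = (\<Sum>w\<in>W. c' w * dwmon w x v)"
    using assms unfolding wpoly_def by blast
  then show ?thesis unfolding wpoly_def
    by (intro exI[of _ "\<lambda>w. c w + c' w"]) (simp add: sum.distrib distrib_right)
qed

lemma wpoly_scale:
  assumes "wpoly W f df"
  shows "wpoly W (\<lambda>x. k * f x) (\<lambda>x v. k * df x v)"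
proof -
  obtain c where "\<And>x. f x = (\<Sum>w\<in>W. c w * wmon w x)" "\<And>x v. df x v = (\<Sum>w\<in>W. c w * dwmon w x v)"
    using assms unfolding wpoly_def by blast
  then show ?thesis unfolding wpoly_def
    by (intro exI[of _ "\<lambda>w. k * c w"]) (simp add: sum_distrib_left mult.assoc)
qed

lemma wpoly_diff:
  assumes "wpoly W f df" "wpoly W g dg"
  shows "wpoly W (\<lambda>x. f x - g x) (\<lambda>x v. df x v - dg x v)"
  using wpoly_add[OF assms(1) wpoly_scale[OF assms(2), of "-1"]] by simp

lemma wpoly_sum:
  "(\<And>k. k \<in> A \<Longrightarrow> wpoly W (f k) (df k)) \<Longrightarrow> wpoly W (\<lambda>x. \<Sum>k\<in>A. f k x) (\<lambda>x v. \<Sum>k\<in>A. df k x v)"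
  by (induction A rule: infinite_finite_induct) (auto intro: wpoly_add wpoly_zero)

lemma wpoly_mon:
  assumes "finite W" "w \<in> W"
  shows "wpoly W (wmon w) (dwmon w)"
  unfolding wpoly_def
proof (intro exI[of _ "\<lambda>u. if u = w then 1 else 0"] conjI allI)
  show "wmon w x = (\<Sum>u\<in>W. (if u = w then 1 else 0) * wmon u x)" for x
    using assms by (simp add: if_distrib[of "\<lambda>c. c * _"] cong: if_cong)
  show "dwmon w x v = (\<Sum>u\<in>W. (if u = w then 1 else 0) * dwmon u x v)" for x v
    using assms by (simp add: if_distrib[of "\<lambda>c. c * _"] cong: if_cong)
qed

text \<open>Covers both renaming of variables (\<open>u\<close> empty) and multiplication by a
  monomial, the operations of homogenisation and degree lowering.\<close>

lemma wpoly_image: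
  assumes f: "wpoly W f df" and W': "finite W'" "\<And>w. w \<in> W \<Longrightarrow> u @ map h w \<in> W'"
  shows "wpoly W' (\<lambda>x. wmon u x * f (\<lambda>i. x (h i)))
    (\<lambda>x v. dwmon u x v * f (\<lambda>i. x (h i)) + wmon u x * df (\<lambda>i. x (h i)) (\<lambda>i. v (h i)))"
proof -
  obtain c where c: "\<And>x. f x = (\<Sum>w\<in>W. c w * wmon w x)" "\<And>x v. df x v = (\<Sum>w\<in>W. c w * dwmon w x v)"
    using f unfolding wpoly_def by blast
  have "wpoly W' (\<lambda>x. \<Sum>w\<in>W. c w * wmon (u @ map h w) x) (\<lambda>x v. \<Sum>w\<in>W. c w * dwmon (u @ map h w) x v)"
    by (intro wpoly_sum wpoly_scale wpoly_mon W')
  moreover have "(\<Sum>w\<in>W. c w * wmon (u @ map h w) x) = wmon u x * f (\<lambda>i. x (h i))" for x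
    by (simp add: c wmon_append wmon_map sum_distrib_left mult_ac)
  moreover have "(\<Sum>w\<in>W. c w * dwmon (u @ map h w) x v)
      = dwmon u x v * f (\<lambda>i. x (h i)) + wmon u x * df (\<lambda>i. x (h i)) (\<lambda>i. v (h i))" for x v
    by (simp add: c dwmon_append wmon_map dwmon_map sum_distrib_left sum.distrib distrib_left mult_ac)
  ultimately show ?thesis by simp
qed

definition words :: "'i set \<Rightarrow> nat set \<Rightarrow> 'i list set" where
  "words I L = {w. set w \<subseteq> I \<and> length w \<in> L}"

lemma finite_words: "finite I \<Longrightarrow> finite L \<Longrightarrow> finite (words I L)"
proof -
  assume "finite I" "finite L"
  moreover have "words I L = (\<Union>l\<in>L. {w. set w \<subseteq> I \<and> length w = l})" by (auto simp: words_def)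
  ultimately show ?thesis by (simp add: finite_lists_length_eq)
qed

lemma wpoly_words_split:
  assumes f: "wpoly (words I L) f df" and fin: "finite I" "finite L" and L: "L = L1 \<union> L2" "L1 \<inter> L2 = {}"
  shows "\<exists>g dg h dh. wpoly (words I L1) g dg \<and> wpoly (words I L2) h dh \<and>
    (\<forall>x. f x = g x + h x) \<and> (\<forall>x v. df x v = dg x v + dh x v)"
proof -
  obtain c where c: "\<And>x. f x = (\<Sum>w\<in>words I L. c w * wmon w x)" "\<And>x v. df x v = (\<Sum>w\<in>words I L. c w * dwmon w x v)"
    using f unfolding wpoly_def by blast
  have split: "(\<Sum>w\<in>words I L. t w) = (\<Sum>w\<in>words I L1. t w) + (\<Sum>w\<in>words I L2. t w)" for t :: "_ \<Rightarrow> complex"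
  proof -
    have "words I L = words I L1 \<union> words I L2" "words I L1 \<inter> words I L2 = {}"
      using L by (auto simp: words_def)
    then show ?thesis using fin L by (simp add: sum.union_disjoint finite_words)
  qed
  show ?thesis
    unfolding c split
    by (intro exI[of _ "\<lambda>x. \<Sum>w\<in>words I L1. c w * wmon w x"] exI[of _ "\<lambda>x v. \<Sum>w\<in>words I L1. c w * dwmon w x v"]
        exI[of _ "\<lambda>x. \<Sum>w\<in>words I L2. c w * wmon w x"] exI[of _ "\<lambda>x v. \<Sum>w\<in>words I L2. c w * dwmon w x v"])
      (auto simp: wpoly_def)
qed

lemma wpoly_dscale:
  assumes "wpoly (words I {Suc k}) f df"
  shows "df (ray t x) v = t ^ k * df x v"
proof -
  obtain c where c: "\<And>x v. df x v = (\<Sum>w\<in>words I {Suc k}. c w * dwmon w x v)"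
    using assms unfolding wpoly_def by blast
  show ?thesis unfolding c sum_distrib_left
    by (intro sum.cong) (auto simp: words_def dwmon_scale)
qed

lemma dwmon_zero: "(\<And>i. i \<in> set w \<Longrightarrow> v i = 0) \<Longrightarrow> dwmon w x v = 0"
  by (induction w) auto

lemma wpoly_dzero:
  assumes "wpoly (words I L) f df" "\<And>i. i \<in> I \<Longrightarrow> v i = 0"
  shows "df x v = 0"
proof -
  obtain c where c: "\<And>x v. df x v = (\<Sum>w\<in>words I L. c w * dwmon w x v)"
    using assms(1) unfolding wpoly_def by blast
  show ?thesis unfolding c
    by (intro sum.neutral ballI) (auto simp: words_def intro!: dwmon_zero assms(2))
qed

lemma wpoly_polyf: "wpoly (words I L) f df \<Longrightarrow> polyf I f"
proof -
  assume "wpoly (words I L) f df"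
  then obtain c where c: "f = (\<lambda>x. \<Sum>w\<in>words I L. c w * wmon w x)"
    unfolding wpoly_def by blast
  show ?thesis unfolding c
    by (intro polyf_sum polyf.mult polyf.const polyf_mon) (simp add: words_def)
qed

section \<open>Keller maps and transfer of polynomial inverses\<close>

definition nonsingular :: "'i set \<Rightarrow> ('i \<Rightarrow> ('i \<Rightarrow> complex) \<Rightarrow> ('i \<Rightarrow> complex) \<Rightarrow> complex) \<Rightarrow> bool" where
  "nonsingular I df \<longleftrightarrow> (\<forall>x v. (\<forall>i\<in>I. v i + df i x v = 0) \<longrightarrow> (\<forall>i\<in>I. v i = 0))"

definition pinv :: "'i set \<Rightarrow> ('i \<Rightarrow> ('i \<Rightarrow> complex) \<Rightarrow> complex) \<Rightarrow> bool" where
  "pinv I F \<longleftrightarrow> (\<exists>G. (\<forall>i\<in>I. polyf I (G i)) \<and> (\<forall>x. \<forall>i\<in>I. G i (\<lambda>j. F j x) = x i) \<and>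
     (\<forall>y. \<forall>i\<in>I. F i (\<lambda>j. G j y) = y i))"

text \<open>The inverse is \<open>\<rho> \<circ> G \<circ> \<tau>\<close>: \<open>\<tau>\<close>
  embeds target values, \<open>\<rho>\<close> projects solutions, and \<open>\<sigma> x\<close> is a
  point over \<open>x\<close> with \<open>F' (\<sigma> x) = \<tau> (F x)\<close>, which
  \<open>G\<close> must therefore return. By the last condition every solution of
  \<open>F' X = \<tau> y\<close> projects to a solution of \<open>F x = y\<close>.\<close>

lemma pinv_transfer:
  assumes inv: "pinv J F'"
    and rho: "\<And>i. i \<in> I \<Longrightarrow> polyf J (\<rho> i)" and tau: "\<And>j. j \<in> J \<Longrightarrow> polyf I (\<tau> j)"
    and 1: "\<And>x j. j \<in> J \<Longrightarrow> F' j (\<sigma> x) = \<tau> j (\<lambda>i. F i x)"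
    and 2: "\<And>x i. i \<in> I \<Longrightarrow> \<rho> i (\<sigma> x) = x i"
    and 3: "\<And>X y i. (\<And>j. j \<in> J \<Longrightarrow> F' j X = \<tau> j y) \<Longrightarrow> i \<in> I \<Longrightarrow> F i (\<lambda>i. \<rho> i X) = y i"
  shows "pinv I F"
proof -
  obtain G where G: "\<And>j. j \<in> J \<Longrightarrow> polyf J (G j)" "\<And>x j. j \<in> J \<Longrightarrow> G j (\<lambda>k. F' k x) = x j"
    "\<And>y j. j \<in> J \<Longrightarrow> F' j (\<lambda>k. G k y) = y j"
    using inv unfolding pinv_def by blast
  define H where "H = (\<lambda>i y. \<rho> i (\<lambda>j. G j (\<lambda>k. \<tau> k y)))"
  have "polyf I (H i)" if "i \<in> I" for i
    unfolding H_def by (rule polyf_comp[OF rho[OF that]], rule polyf_comp[OF G(1) tau])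
  moreover have "H i (\<lambda>j. F j x) = x i" if "i \<in> I" for i x
  proof -
    have "G j (\<lambda>k. \<tau> k (\<lambda>i. F i x)) = \<sigma> x j" if "j \<in> J" for j
    proof -
      have "G j (\<lambda>k. \<tau> k (\<lambda>i. F i x)) = G j (\<lambda>k. F' k (\<sigma> x))"
        by (rule polyf_cong[OF G(1)[OF that]]) (simp add: 1)
      then show ?thesis using G(2)[OF that] by simp
    qed
    then have "H i (\<lambda>j. F j x) = \<rho> i (\<sigma> x)"
      unfolding H_def by (intro polyf_cong[OF rho[OF that]])
    then show ?thesis using 2[OF that] by simp
  qed
  moreover have "F i (\<lambda>j. H j y) = y i" if "i \<in> I" for i y
    unfolding H_def by (rule 3[OF _ that]) (simp add: G(3))
  ultimately show ?thesis unfolding pinv_def by blast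
qed

text \<open>The polarisation identity \<open>24xyz = (x+y+z)\<^sup>3 - (x+y-z)\<^sup>3 - (x-y+z)\<^sup>3 - (-x+y+z)\<^sup>3\<close> writes a homogeneous
  cubic map as \<open>x + B (C x)\<^sup>3\<close>. With \<open>f X = X + (C B X)\<^sup>3\<close> one has \<open>B \<circ> f = F \<circ> B\<close>, and \<open>B\<close> is made
  surjective by adding columns on which \<open>C\<close> vanishes.\<close>

definition polar_sign :: "nat \<Rightarrow> nat \<Rightarrow> complex" where
  "polar_sign s m = (if s + m = 3 then -1 else 1)"

definition polar_form :: "'i list \<Rightarrow> nat \<Rightarrow> ('i \<Rightarrow> complex) \<Rightarrow> complex" where
  "polar_form w s x = (\<Sum>m<3. polar_sign s m * x (w ! m))"

definition polar_weight :: "nat \<Rightarrow> complex" where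
  "polar_weight s = (if s = 0 then 1 else -1) / 24"

lemma polarisation:
  assumes "length w = 3"
  shows "(\<Sum>s<4. polar_weight s * polar_form w s x ^ 3) = wmon w x"
    and "(\<Sum>s<4. polar_weight s * (3 * polar_form w s x ^ 2 * polar_form w s v)) = dwmon w x v"
proof -
  obtain p q r where w: "w = [p, q, r]"
    using assms by (auto simp: numeral_3_eq_3 length_Suc_conv)
  \<comment> \<open>The rule \<open>s + m = 3\<close> puts the minus sign on the third, second or
    first factor for s = 1, 2, 3, and nowhere for s = 0.\<close>
  have form: "polar_form w 0 x = x p + x q + x r" "polar_form w 1 x = x p + x q - x r"
    "polar_form w 2 x = x p - x q + x r" "polar_form w 3 x = - x p + x q + x r" for x
    by (simp_all add: polar_form_def polar_sign_def w numeral_3_eq_3)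
  have s4: "(\<Sum>s<4. h s) = h 0 + h 1 + h 2 + h (3::nat)" for h :: "nat \<Rightarrow> complex"
    by (simp add: eval_nat_numeral)
  show "(\<Sum>s<4. polar_weight s * polar_form w s x ^ 3) = wmon w x"
    unfolding s4 form by (simp add: polar_weight_def w field_simps power3_eq_cube)
  show "(\<Sum>s<4. polar_weight s * (3 * polar_form w s x ^ 2 * polar_form w s v)) = dwmon w x v"
    unfolding s4 form by (simp add: polar_weight_def w field_simps power2_eq_square)
qed

lemma pinv_homogeneous_cubic:
  fixes I :: "'i set"
  assumes cub: "\<And>N a. keller_cubic N a \<Longrightarrow> pinv {..<N} (\<lambda>i x. cubic N a x i)"
    and fin: "finite I"
    and f: "\<And>i. i \<in> I \<Longrightarrow> wpoly (words I {3}) (f i) (df i)"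
    and ns: "nonsingular I df"
  shows "pinv I (\<lambda>i x. x i + f i x)"
proof -
  let ?W = "words I {3}"
  have finW: "finite ?W" by (simp add: finite_words fin)
  have "\<forall>i. \<exists>c. i \<in> I \<longrightarrow> (\<forall>x. f i x = (\<Sum>w\<in>?W. c w * wmon w x)) \<and> (\<forall>x v. df i x v = (\<Sum>w\<in>?W. c w * dwmon w x v))"
    using f unfolding wpoly_def by blast
  from choice[OF this] obtain c where c: "\<And>i x. i \<in> I \<Longrightarrow> f i x = (\<Sum>w\<in>?W. c i w * wmon w x)"
    "\<And>i x v. i \<in> I \<Longrightarrow> df i x v = (\<Sum>w\<in>?W. c i w * dwmon w x v)" by blast
  \<comment> \<open>Four cubes for each monomial, and one extra column for each coordinate, on which
    \<open>l\<close> is 0 and \<open>B\<close> is the identity.\<close>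
  define K where "K = (?W \<times> {..<4::nat}) <+> I"
  have "finite K" unfolding K_def using finW fin by simp
  define N where "N = card K"
  obtain h where h: "bij_betw h {..<N} K"
    using ex_bij_betw_nat_finite[OF \<open>finite K\<close>] unfolding N_def atLeast0LessThan by blast
  define l where "l = (\<lambda>\<kappa> (x :: 'i \<Rightarrow> complex). case \<kappa> of Inl (w, s) \<Rightarrow> polar_form w s x | Inr (i::'i) \<Rightarrow> 0)"
  define C where "C = (\<lambda>\<kappa> j. l \<kappa> (\<lambda>i. if i = j then 1 else 0))"
  define B where "B = (\<lambda>(i :: 'i) \<kappa>. case \<kappa> of Inl (w, s) \<Rightarrow> c i w * polar_weight s | Inr j \<Rightarrow> if i = j then 1 else 0)"
  define BX where "BX = (\<lambda>X i. \<Sum>k<N. B i (h k) * X k)"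
  have BX: "BX X i = (\<Sum>k<N. B i (h k) * X k)" for X i by (simp add: BX_def)
  define a where "a = (\<lambda>k m. \<Sum>i\<in>I. C (h k) i * B i (h m))"
  have hK: "h k \<in> K" if "k < N" for k using bij_betw_apply[OF h] that by simp
  have lC: "l \<kappa> x = (\<Sum>j\<in>I. C \<kappa> j * x j)" if \<kappa>: "\<kappa> \<in> K" for \<kappa> x
  proof (cases \<kappa>)
    case (Inl p)
    obtain w s where p: "p = (w, s)" by (cases p)
    have w: "length w = 3" "set w \<subseteq> I" using \<kappa> Inl p by (auto simp: K_def words_def)
    have "(\<Sum>j\<in>I. C \<kappa> j * x j) = (\<Sum>j\<in>I. \<Sum>m<3. if w ! m = j then polar_sign s m * x j else 0)"
      unfolding C_def l_def Inl p by (intro sum.cong) (auto simp: polar_form_def sum_distrib_right intro!: sum.cong)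
    also have "\<dots> = (\<Sum>m<3. \<Sum>j\<in>I. if w ! m = j then polar_sign s m * x j else 0)" by (rule sum.swap)
    also have "\<dots> = (\<Sum>m<3. polar_sign s m * x (w ! m))"
    proof (intro sum.cong refl)
      fix m assume "m \<in> {..<3::nat}"
      then have "w ! m \<in> I" using w by (metis lessThan_iff nth_mem subsetD)
      then show "(\<Sum>j\<in>I. if w ! m = j then polar_sign s m * x j else 0) = polar_sign s m * x (w ! m)"
        using fin by simp
    qed
    finally show ?thesis by (simp add: l_def Inl p polar_form_def)
  qed (simp add: l_def C_def)
  have l_cong: "l \<kappa> x = l \<kappa> y" if "\<kappa> \<in> K" "\<And>i. i \<in> I \<Longrightarrow> x i = y i" for \<kappa> x y
    unfolding lC[OF that(1)] using that(2) by simp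
  have lin_a: "lin N a X k = l (h k) (BX X)" if k: "k < N" for X k
  proof -
    have "lin N a X k = (\<Sum>m<N. \<Sum>i\<in>I. C (h k) i * (B i (h m) * X m))"
      by (simp add: lin_def a_def sum_distrib_right mult.assoc)
    also have "\<dots> = (\<Sum>i\<in>I. \<Sum>m<N. C (h k) i * (B i (h m) * X m))" by (rule sum.swap)
    also have "\<dots> = l (h k) (BX X)"
      unfolding lC[OF hK[OF k]] by (simp add: BX_def sum_distrib_left)
    finally show ?thesis .
  qed
  have sumB: "(\<Sum>k<N. B i (h k) * \<psi> (h k)) = (\<Sum>w\<in>?W. c i w * (\<Sum>s<4. polar_weight s * \<psi> (Inl (w, s)))) + \<psi> (Inr i)"
    if i: "i \<in> I" for i \<psi>
  proof -
    have "(\<Sum>k<N. B i (h k) * \<psi> (h k)) = (\<Sum>\<kappa>\<in>K. B i \<kappa> * \<psi> \<kappa>)"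
      by (rule sum.reindex_bij_betw[OF h])
    also have "\<dots> = (\<Sum>p\<in>?W \<times> {..<4}. B i (Inl p) * \<psi> (Inl p)) + (\<Sum>j\<in>I. B i (Inr j) * \<psi> (Inr j))"
      unfolding K_def using finW fin by (subst sum.Plus) auto
    also have "(\<Sum>j\<in>I. B i (Inr j) * \<psi> (Inr j)) = (\<Sum>j\<in>I. if i = j then \<psi> (Inr j) else 0)"
      by (intro sum.cong) (auto simp: B_def)
    also have "\<dots> = \<psi> (Inr i)" using i fin by simp
    also have "(\<Sum>p\<in>?W \<times> {..<4}. B i (Inl p) * \<psi> (Inl p)) = (\<Sum>w\<in>?W. \<Sum>s<4. B i (Inl (w, s)) * \<psi> (Inl (w, s)))"
      by (simp add: sum.cartesian_product split_def)
    also have "\<dots> = (\<Sum>w\<in>?W. c i w * (\<Sum>s<4. polar_weight s * \<psi> (Inl (w, s))))"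
      by (simp add: B_def sum_distrib_left mult.assoc)
    finally show ?thesis .
  qed
  have sumf: "(\<Sum>k<N. B i (h k) * l (h k) x ^ 3) = f i x" if i: "i \<in> I" for i x
    unfolding sumB[OF i, of "\<lambda>\<kappa>. l \<kappa> x ^ 3"] c(1)[OF i]
    by (simp add: l_def) (intro sum.cong refl, simp add: words_def polarisation)
  have sumdf: "(\<Sum>k<N. B i (h k) * (3 * l (h k) x ^ 2 * l (h k) v)) = df i x v" if i: "i \<in> I" for i x v
    unfolding sumB[OF i, of "\<lambda>\<kappa>. 3 * l \<kappa> x ^ 2 * l \<kappa> v"] c(2)[OF i]
    by (simp add: l_def) (intro sum.cong refl, simp add: words_def polarisation)
  have "keller_cubic N a"
    unfolding keller_cubic_def
  proof (intro allI impI)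
    fix X V k assume "\<forall>k<N. jac N a X V k = 0" and k: "k < N"
    then have V: "V k + 3 * l (h k) (BX X) ^ 2 * l (h k) (BX V) = 0" if "k < N" for k
      using that by (simp add: jac_def lin_a)
    \<comment> \<open>Applying \<open>B\<close> to the kernel equations gives
      \<open>(1 + df) (B V) = 0\<close>; once \<open>B V = 0\<close>, the equations themselves read
      \<open>V k = 0\<close>.\<close>
    have "BX V i + df i (BX X) (BX V) = 0" if i: "i \<in> I" for i
    proof -
      have "BX V i + df i (BX X) (BX V) = (\<Sum>k<N. B i (h k) * (V k + 3 * l (h k) (BX X) ^ 2 * l (h k) (BX V)))"
        unfolding sumdf[OF i, symmetric] by (simp add: BX[of V i] distrib_left sum.distrib)
      also have "\<dots> = 0" using V by (intro sum.neutral) simp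
      finally show ?thesis .
    qed
    then have "\<forall>i\<in>I. BX V i = 0" using ns unfolding nonsingular_def by blast
    then have "l (h k) (BX V) = 0" unfolding lC[OF hK[OF k]] by simp
    then show "V k = 0" using V[OF k] by simp
  qed
  then have inv: "pinv {..<N} (\<lambda>k X. cubic N a X k)" by (rule cub)
  have cubic_a: "cubic N a X k = X k + l (h k) (BX X) ^ 3" if "k < N" for X k
    by (simp add: cubic_def lin_a that)
  \<comment> \<open>A right inverse of \<open>B\<close>, supported on the extra columns.\<close>
  define S where "S = (\<lambda>y k. case h k of Inl p \<Rightarrow> 0 | Inr i \<Rightarrow> (y i :: complex))"
  have BS: "BX (S y) i = y i" if i: "i \<in> I" for y i
    using sumB[OF i, of "\<lambda>\<kappa>. case \<kappa> of Inl p \<Rightarrow> 0 | Inr i \<Rightarrow> y i"] by (simp add: BX_def S_def)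
  \<comment> \<open>Solves \<open>X + l (B X)^3 = S (x + f x)\<close> with \<open>B X = x\<close>:
    under \<open>B\<close> the subtracted cubes contribute \<open>- f x\<close>.\<close>
  define \<sigma> where "\<sigma> = (\<lambda>x k. S (\<lambda>i. x i + f i x) k - l (h k) x ^ 3)"
  have B\<sigma>: "BX (\<sigma> x) i = x i" if i: "i \<in> I" for x i
  proof -
    have "BX (\<sigma> x) i = BX (S (\<lambda>i. x i + f i x)) i - (\<Sum>k<N. B i (h k) * l (h k) x ^ 3)"
      by (simp add: BX_def \<sigma>_def right_diff_distrib sum_subtractf)
    then show ?thesis by (simp add: BS[OF i] sumf[OF i])
  qed
  show ?thesis
  proof (rule pinv_transfer[OF inv, where \<rho> = "\<lambda>i X. BX X i" and \<tau> = "\<lambda>k y. S y k" and \<sigma> = \<sigma>])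
    show "polyf {..<N} (\<lambda>X. BX X i)" for i
      unfolding BX_def by (intro polyf_sum polyf.mult polyf.const polyf.var)
    show "polyf I (\<lambda>y. S y k)" if "k \<in> {..<N}" for k
      using hK[of k] that by (cases "h k") (auto simp: S_def K_def intro!: polyf.var)
    show "cubic N a (\<sigma> x) k = S (\<lambda>i. x i + f i x) k" if "k \<in> {..<N}" for x k
    proof -
      have k: "k < N" using that by simp
      have "l (h k) (BX (\<sigma> x)) = l (h k) x" by (rule l_cong[OF hK[OF k] B\<sigma>])
      then show ?thesis by (simp add: cubic_a[OF k] \<sigma>_def)
    qed
    show "BX (\<sigma> x) i = x i" if "i \<in> I" for x i using that by (rule B\<sigma>)
    show "BX X i + f i (BX X) = y i" if X: "\<And>k. k \<in> {..<N} \<Longrightarrow> cubic N a X k = S y k" and i: "i \<in> I" for X y i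
    proof -
      have "BX X i + f i (BX X) = (\<Sum>k<N. B i (h k) * cubic N a X k)"
        unfolding sumf[OF i, symmetric] by (simp add: BX[of X i] cubic_a distrib_left sum.distrib)
      also have "\<dots> = BX (S y) i" unfolding BX_def by (intro sum.cong) (simp_all add: X)
      finally show ?thesis by (simp add: BS[OF i])
    qed
  qed
qed

text \<open>Homogenisation: \<open>(x, y, t) \<mapsto> (x + t F\<^sub>2(x) - t\<^sup>2 y, y + F\<^sub>3(x), t)\<close> is \<open>(x + t F\<^sub>2(x) + t\<^sup>2 F\<^sub>3(x), y, t)\<close>
  up to elementary automorphisms.\<close>

lemma pinv_cubic:
  fixes I :: "'i set"
  assumes cub: "\<And>N a. keller_cubic N a \<Longrightarrow> pinv {..<N} (\<lambda>i x. cubic N a x i)"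
    and fin: "finite I"
    and f: "\<And>i. i \<in> I \<Longrightarrow> wpoly (words I {2..3}) (f i) (df i)"
    and ns: "nonsingular I df"
  shows "pinv I (\<lambda>i x. x i + f i x)"
proof -
  have L: "{2..3} = {2::nat} \<union> {3}" "{2::nat} \<inter> {3} = {}" by auto
  have "\<forall>i. \<exists>g dg h dh. i \<in> I \<longrightarrow> wpoly (words I {2}) g dg \<and> wpoly (words I {3}) h dh \<and>
    (\<forall>x. f i x = g x + h x) \<and> (\<forall>x v. df i x v = dg x v + dh x v)"
    using wpoly_words_split[OF f fin finite_atLeastAtMost L] by blast
  then obtain g dg h dh where
    g: "\<And>i. i \<in> I \<Longrightarrow> wpoly (words I {2}) (g i) (dg i)" and h: "\<And>i. i \<in> I \<Longrightarrow> wpoly (words I {3}) (h i) (dh i)"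
    and fgh: "\<And>i x. i \<in> I \<Longrightarrow> f i x = g i x + h i x" "\<And>i x v. i \<in> I \<Longrightarrow> df i x v = dg i x v + dh i x v"
    by metis
  define X Y where "X = (\<lambda>i::'i. Some (Inl i :: 'i + 'i))" and "Y = (\<lambda>i::'i. Some (Inr i :: 'i + 'i))"
  define J where "J = insert None (X ` I \<union> Y ` I)"
  have finJ: "finite J" using fin by (simp add: J_def)
  define F where "F = (\<lambda>j (z :: ('i + 'i) option \<Rightarrow> complex). case j of None \<Rightarrow> 0
    | Some (Inl i) \<Rightarrow> z None * g i (\<lambda>i. z (X i)) - z None * (z None * z (Y i))
    | Some (Inr i) \<Rightarrow> h i (\<lambda>i. z (X i)))"
  define dF where "dF = (\<lambda>j (z :: ('i + 'i) option \<Rightarrow> complex) v. case j of None \<Rightarrow> 0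
    | Some (Inl i) \<Rightarrow> (v None * g i (\<lambda>i. z (X i)) + z None * dg i (\<lambda>i. z (X i)) (\<lambda>i. v (X i)))
        - (v None * (z None * z (Y i)) + z None * (v None * z (Y i) + z None * v (Y i)))
    | Some (Inr i) \<Rightarrow> dh i (\<lambda>i. z (X i)) (\<lambda>i. v (X i)))"
  have wF: "wpoly (words J {3}) (F j) (dF j)" if j: "j \<in> J" for j
  proof -
    have fw: "finite (words J {3})" by (simp add: finite_words finJ)
    consider "j = None" | i where "i \<in> I" "j = X i" | i where "i \<in> I" "j = Y i"
      using j by (auto simp: J_def)
    then show ?thesis
    proof cases
      case 1
      then have "F j = (\<lambda>z. 0)" "dF j = (\<lambda>z v. 0)" by (simp_all add: F_def dF_def)
      then show ?thesis by (simp add: wpoly_zero)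
    next
      case (2 i)
      have "[None] @ map X w \<in> words J {3}" if "w \<in> words I {2}" for w
        using that by (auto simp: words_def J_def)
      from wpoly_image[OF g[OF 2(1)] fw this]
      have 1: "wpoly (words J {3}) (\<lambda>z. z None * g i (\<lambda>i. z (X i)))
        (\<lambda>z v. v None * g i (\<lambda>i. z (X i)) + z None * dg i (\<lambda>i. z (X i)) (\<lambda>i. v (X i)))" by simp
      have "[None, None, Y i] \<in> words J {3}" using 2 by (simp add: words_def J_def)
      from wpoly_mon[OF fw this]
      have "wpoly (words J {3}) (\<lambda>z. z None * (z None * z (Y i)))
        (\<lambda>z v. v None * (z None * z (Y i)) + z None * (v None * z (Y i) + z None * v (Y i)))"
        by (simp add: wpoly_def)
      from wpoly_diff[OF 1 this] show ?thesis by (simp add: F_def dF_def 2 X_def)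
    next
      case (3 i)
      have "[] @ map X w \<in> words J {3}" if "w \<in> words I {3}" for w
        using that by (auto simp: words_def J_def)
      from wpoly_image[OF h[OF 3(1)] fw this] show ?thesis by (simp add: F_def dF_def 3 Y_def)
    qed
  qed
  have nsF: "nonsingular J dF"
    unfolding nonsingular_def
  proof (intro allI impI)
    fix z v assume v: "\<forall>j\<in>J. v j + dF j z v = 0"
    define x u where "x = (\<lambda>i. z (X i))" and "u = (\<lambda>i. v (X i))"
    have v0: "v None = 0" using v by (auto simp: J_def dF_def)
    have vY: "v (Y i) = - dh i x u" if "i \<in> I" for i
    proof -
      have "v (Y i) + dF (Y i) z v = 0" using v that by (simp add: J_def)
      then show ?thesis by (simp add: dF_def Y_def x_def u_def add_eq_0_iff2)
    qed
    \<comment> \<open>With t = \<open>z None\<close>, homogeneity gives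
      \<open>t dg x = dg (t x)\<close> and \<open>t^2 dh x = dh (t x)\<close>. After elimination of
      the y-part, the kernel equation is that of the given map at the point
      \<open>t x\<close>.\<close>
    have "u i + df i (\<lambda>i. z None * x i) u = 0" if i: "i \<in> I" for i
    proof -
      have "v (X i) + dF (X i) z v = 0" using v i by (simp add: J_def)
      then have "u i + z None * dg i x u + z None ^ 2 * dh i x u = 0"
        using vY[OF i] v0 by (simp add: dF_def X_def x_def u_def power2_eq_square algebra_simps)
      moreover have "dg i (\<lambda>i. z None * x i) u = z None ^ 1 * dg i x u"
        by (rule wpoly_dscale[of I]) (use g[OF i] in \<open>simp add: numeral_2_eq_2\<close>)
      moreover have "dh i (\<lambda>i. z None * x i) u = z None ^ 2 * dh i x u"
        by (rule wpoly_dscale[of I]) (use h[OF i] in \<open>simp add: numeral_3_eq_3 numeral_2_eq_2\<close>)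
      ultimately show ?thesis by (simp add: fgh[OF i] add.assoc)
    qed
    then have u0: "\<forall>i\<in>I. u i = 0" using ns unfolding nonsingular_def by blast
    show "\<forall>j\<in>J. v j = 0"
    proof
      fix j assume "j \<in> J"
      then consider "j = None" | i where "i \<in> I" "j = X i" | i where "i \<in> I" "j = Y i"
        by (auto simp: J_def)
      then show "v j = 0"
      proof cases
        case (3 i)
        then show ?thesis using vY wpoly_dzero[OF h[OF 3(1)], of u x] u0 by simp
      qed (use v0 u0 in \<open>auto simp: u_def\<close>)
    qed
  qed
  \<comment> \<open>The slice t = 1, y = \<open>- h x\<close>: there the y-output is 0 and the
    x-output is \<open>x + g x + h x\<close>.\<close>
  define \<sigma> where "\<sigma> = (\<lambda>x j. case j of None \<Rightarrow> 1 | Some (Inl i) \<Rightarrow> x i | Some (Inr i) \<Rightarrow> - h i x)"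
  define \<tau> where "\<tau> = (\<lambda>j (y :: 'i \<Rightarrow> complex). case j of None \<Rightarrow> 1 | Some (Inl i) \<Rightarrow> y i | Some (Inr (i :: 'i)) \<Rightarrow> (0 :: complex))"
  show ?thesis
  proof (rule pinv_transfer[where \<rho> = "\<lambda>i z. z (X i)" and \<tau> = \<tau> and \<sigma> = \<sigma>])
    show "pinv J (\<lambda>j z. z j + F j z)"
      by (rule pinv_homogeneous_cubic[OF cub finJ wF nsF])
    show "polyf J (\<lambda>z. z (X i))" if "i \<in> I" for i using that by (intro polyf.var) (simp add: J_def)
    show "polyf I (\<tau> j)" if "j \<in> J" for j
      using that by (auto simp: J_def \<tau>_def X_def Y_def intro!: polyf.var)
    show "\<sigma> x j + F j (\<sigma> x) = \<tau> j (\<lambda>i. x i + f i x)" if "j \<in> J" for x j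
      using that by (auto simp: J_def \<tau>_def \<sigma>_def X_def Y_def F_def fgh)
    show "\<sigma> x (X i) = x i" for x i by (simp add: \<sigma>_def X_def)
    show "z (X i) + f i (\<lambda>i. z (X i)) = y i"
      if z: "\<And>j. j \<in> J \<Longrightarrow> z j + F j z = \<tau> j y" and i: "i \<in> I" for z y i
    proof -
      have "z None = 1" using z[of None] by (simp add: J_def F_def \<tau>_def)
      moreover have "z (Y i) = - h i (\<lambda>i. z (X i))"
        using z[of "Y i"] i by (simp add: J_def F_def \<tau>_def Y_def add_eq_0_iff2)
      ultimately show ?thesis
        using z[of "X i"] i by (simp add: J_def F_def \<tau>_def X_def Y_def fgh)
    qed
  qed
qed

text \<open>Recursive, because the words processed at a later lowering step may contain auxiliary
  variables from earlier ones.\<close>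

datatype idx = Base nat | Aux bool "idx list"

text \<open>Degree lowering (Bass, Connell, Wright): a monomial \<open>PQ\<close> of top degree \<open>d\<close> with \<open>P\<close> of degree 2 is
  removed by two new variables \<open>y, z\<close>, the outputs \<open>y + P\<close>, \<open>z + Q\<close> and subtraction of \<open>(y + P)(z + Q)\<close>.
  The fresh variables are indexed by \<open>Aux True w\<close> and \<open>Aux False w\<close>, \<open>w\<close> the word of the monomial.\<close>

lemma pinv_any_degree:
  fixes I :: "idx set"
  assumes cub: "\<And>N a. keller_cubic N a \<Longrightarrow> pinv {..<N} (\<lambda>i x. cubic N a x i)"
    and d: "d \<ge> 3" and fin: "finite I" and fresh: "\<And>b w. Aux b w \<in> I \<Longrightarrow> d < length w"
    and f: "\<And>i. i \<in> I \<Longrightarrow> wpoly (words I {2..d}) (f i) (df i)"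
    and ns: "nonsingular I df"
  shows "pinv I (\<lambda>i x. x i + f i x)"
  using d fin fresh f ns
proof (induction d arbitrary: I f df rule: dec_induct)
  case base
  show ?case by (rule pinv_cubic[OF cub base(1,3,4)])
next
  case (step d)
  note fin = step.prems(1) and fresh = step.prems(2) and f = step.prems(3) and ns = step.prems(4)
  have d3: "3 \<le> d" by (rule step.hyps)
  define U where "U = words I {Suc d}"
  have finU: "finite U" by (simp add: U_def finite_words fin)
  have lenU: "length w = Suc d" "set w \<subseteq> I" if "w \<in> U" for w using that by (auto simp: U_def words_def)
  have L: "{2..Suc d} = {2..d} \<union> {Suc d}" "{2..d} \<inter> {Suc d} = {}" using d3 by auto
  have "\<forall>i. \<exists>g dg h dh. i \<in> I \<longrightarrow> wpoly (words I {2..d}) g dg \<and> wpoly U h dh \<and>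
    (\<forall>x. f i x = g x + h x) \<and> (\<forall>x v. df i x v = dg x v + dh x v)"
    unfolding U_def using wpoly_words_split[OF f fin finite_atLeastAtMost L] by blast
  then obtain g dg h dh where
    g: "\<And>i. i \<in> I \<Longrightarrow> wpoly (words I {2..d}) (g i) (dg i)" and h: "\<And>i. i \<in> I \<Longrightarrow> wpoly U (h i) (dh i)"
    and fgh: "\<And>i x. i \<in> I \<Longrightarrow> f i x = g i x + h i x" "\<And>i x v. i \<in> I \<Longrightarrow> df i x v = dg i x v + dh i x v"
    by metis
  have "\<forall>i. \<exists>c. i \<in> I \<longrightarrow> (\<forall>x. h i x = (\<Sum>w\<in>U. c w * wmon w x)) \<and> (\<forall>x v. dh i x v = (\<Sum>w\<in>U. c w * dwmon w x v))"
    using h unfolding wpoly_def by blast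
  from choice[OF this] obtain c where c: "\<And>i x. i \<in> I \<Longrightarrow> h i x = (\<Sum>w\<in>U. c i w * wmon w x)"
    "\<And>i x v. i \<in> I \<Longrightarrow> dh i x v = (\<Sum>w\<in>U. c i w * dwmon w x v)" by blast
  define J where "J = I \<union> (Aux True ` U \<union> Aux False ` U)"
  have finJ: "finite J" using fin finU by (simp add: J_def)
  have IJ: "I \<subseteq> J" by (simp add: J_def)
  have notI: "Aux b w \<notin> I" if "w \<in> U" for b w using fresh[of b w] lenU[OF that] by auto
  let ?P = "take 2 :: idx list \<Rightarrow> idx list" and ?Q = "drop 2 :: idx list \<Rightarrow> idx list"
  have wPQ: "wmon w x = wmon (?P w) x * wmon (?Q w) x"
    "dwmon w x v = dwmon (?P w) x v * wmon (?Q w) x + wmon (?P w) x * dwmon (?Q w) x v" for w x v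
    using wmon_append[of "?P w" "?Q w" x] dwmon_append[of "?P w" "?Q w" x v] by simp_all
  let ?V = "\<lambda>w. [Aux True w, Aux False w]" and ?V1 = "\<lambda>w. Aux True w # ?Q w" and ?V2 = "\<lambda>w. Aux False w # ?P w"
  let ?S = "\<lambda>w x. wmon (?V w) x + wmon (?V1 w) x + wmon (?V2 w) x"
  let ?dS = "\<lambda>w x v. dwmon (?V w) x v + dwmon (?V1 w) x v + dwmon (?V2 w) x v"
  \<comment> \<open>Subtracting \<open>c (y + P) (z + Q)\<close> cancels the top term
    \<open>c P Q\<close> and leaves \<open>y z + y Q + z P\<close>, the three words of
    \<open>?S\<close>.\<close>
  define F where "F = (\<lambda>j x. if j \<in> I then g j x - (\<Sum>w\<in>U. c j w * (?S w x))
    else case j of Aux True w \<Rightarrow> wmon (?P w) x | Aux False w \<Rightarrow> wmon (?Q w) x | Base _ \<Rightarrow> 0)"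
  define dF where "dF = (\<lambda>j x v. if j \<in> I then dg j x v - (\<Sum>w\<in>U. c j w * (?dS w x v))
    else case j of Aux True w \<Rightarrow> dwmon (?P w) x v | Aux False w \<Rightarrow> dwmon (?Q w) x v | Base _ \<Rightarrow> 0)"
  have fw: "finite (words J {2..d})" by (simp add: finite_words finJ)
  \<comment> \<open>The lengths are 2, d, 3, 2 and d - 1; all lie between 2 and d because
    \<open>3 \<le> d\<close>.\<close>
  have inW: "?V w \<in> words J {2..d}" "?V1 w \<in> words J {2..d}" "?V2 w \<in> words J {2..d}"
    "?P w \<in> words J {2..d}" "?Q w \<in> words J {2..d}" if w: "w \<in> U" for w
  proof -
    have "set (?P w) \<subseteq> J" "set (?Q w) \<subseteq> J"
      using lenU(2)[OF w] IJ set_take_subset[of 2 w] set_drop_subset[of 2 w] by auto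
    then show "?V w \<in> words J {2..d}" "?V1 w \<in> words J {2..d}" "?V2 w \<in> words J {2..d}"
      "?P w \<in> words J {2..d}" "?Q w \<in> words J {2..d}"
      using w lenU(1)[OF w] d3 by (auto simp: words_def J_def)
  qed
  have wF: "wpoly (words J {2..d}) (F j) (dF j)" if j: "j \<in> J" for j
  proof -
    consider "j \<in> I" | w where "w \<in> U" "j = Aux True w" | w where "w \<in> U" "j = Aux False w"
      using j by (auto simp: J_def)
    then show ?thesis
    proof cases
      case 1
      have "[] @ map (\<lambda>i. i) w \<in> words J {2..d}" if "w \<in> words I {2..d}" for w
        using that IJ by (auto simp: words_def)
      from wpoly_image[OF g[OF 1] fw this] have "wpoly (words J {2..d}) (g j) (dg j)" by simp
      moreover have "wpoly (words J {2..d}) (\<lambda>x. \<Sum>w\<in>U. c j w * (?S w x))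
        (\<lambda>x v. \<Sum>w\<in>U. c j w * (?dS w x v))"
        by (rule wpoly_sum, rule wpoly_scale, rule wpoly_add, rule wpoly_add)
          (rule wpoly_mon[OF fw], erule inW)+
      ultimately have "wpoly (words J {2..d})
          (\<lambda>x. g j x - (\<Sum>w\<in>U. c j w * (?S w x)))
          (\<lambda>x v. dg j x v - (\<Sum>w\<in>U. c j w * (?dS w x v)))"
        by (rule wpoly_diff)
      moreover have "F j = (\<lambda>x. g j x - (\<Sum>w\<in>U. c j w * (?S w x)))"
        "dF j = (\<lambda>x v. dg j x v - (\<Sum>w\<in>U. c j w * (?dS w x v)))"
        using 1 by (simp_all only: F_def dF_def if_True)
      ultimately show ?thesis by (simp only:)
    next
      case (2 w)
      then have "F j = wmon (?P w)" "dF j = dwmon (?P w)" using notI[OF 2(1)] by (simp_all add: F_def dF_def fun_eq_iff)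
      then show ?thesis using wpoly_mon[OF fw inW(4)[OF 2(1)]] by simp
    next
      case (3 w)
      then have "F j = wmon (?Q w)" "dF j = dwmon (?Q w)" using notI[OF 3(1)] by (simp_all add: F_def dF_def fun_eq_iff)
      then show ?thesis using wpoly_mon[OF fw inW(5)[OF 3(1)]] by simp
    qed
  qed
  have nsF: "nonsingular J dF"
    unfolding nonsingular_def
  proof (intro allI impI)
    fix x v assume v: "\<forall>j\<in>J. v j + dF j x v = 0"
    have vA: "v (Aux True w) = - dwmon (?P w) x v" "v (Aux False w) = - dwmon (?Q w) x v" if w: "w \<in> U" for w
    proof -
      have "v (Aux True w) + dF (Aux True w) x v = 0" "v (Aux False w) + dF (Aux False w) x v = 0"
        using v w by (auto simp: J_def)
      then show "v (Aux True w) = - dwmon (?P w) x v" "v (Aux False w) = - dwmon (?Q w) x v"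
        using notI[OF w] by (simp_all add: dF_def add_eq_0_iff2)
    qed
    have "v i + df i x v = 0" if i: "i \<in> I" for i
    proof -
      \<comment> \<open>In such a direction \<open>y + P\<close> and \<open>z + Q\<close> are
        stationary, so the derivative of their product is 0 and that of \<open>?S\<close> is minus
        that of \<open>P Q\<close>.\<close>
      have "(\<Sum>w\<in>U. c i w * (?dS w x v)) = - dh i x v"
        unfolding c(2)[OF i] sum_negf[symmetric]
      proof (intro sum.cong refl)
        fix w assume w: "w \<in> U"
        show "c i w * (?dS w x v) = - (c i w * dwmon w x v)"
          unfolding wPQ(2)[of w x v] by (simp add: vA[OF w] algebra_simps)
      qed
      then have "dF i x v = df i x v" using i by (simp add: dF_def fgh)
      moreover have "v i + dF i x v = 0" using v i IJ by blast
      ultimately show ?thesis by simp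
    qed
    then have vI: "\<forall>i\<in>I. v i = 0" using ns unfolding nonsingular_def by blast
    have dz: "dwmon (?P w) x v = 0" "dwmon (?Q w) x v = 0" if "w \<in> U" for w
      using lenU(2)[OF that] vI set_take_subset[of 2 w] set_drop_subset[of 2 w]
      by (auto intro!: dwmon_zero)
    show "\<forall>j\<in>J. v j = 0" using vI vA dz by (auto simp: J_def)
  qed
  \<comment> \<open>The new variables carry words of length d + 1, hence stay fresh when words of
    length d are processed next.\<close>
  have freshJ: "d < length w" if "Aux b w \<in> J" for b w
    using that fresh[of b w] lenU[of w] by (auto simp: J_def)
  have inv: "pinv J (\<lambda>j x. x j + F j x)"
    by (rule step.IH[OF finJ freshJ wF nsF])
  \<comment> \<open>The outputs \<open>y + P\<close> and \<open>z + Q\<close> are prescribed to be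
    0; by \<open>top\<close> the remaining outputs are then those of the given map.\<close>
  define \<tau> where "\<tau> = (\<lambda>j (y :: idx \<Rightarrow> complex). if j \<in> I then y j else 0)"
  define \<sigma> where "\<sigma> = (\<lambda>x j. if j \<in> I then x j else - F j x)"
  have top: "g i x - (\<Sum>w\<in>U. c i w * (?S w x)) = f i x"
    if i: "i \<in> I" and x: "\<And>w. w \<in> U \<Longrightarrow> x (Aux True w) = - wmon (?P w) x"
      "\<And>w. w \<in> U \<Longrightarrow> x (Aux False w) = - wmon (?Q w) x" for i x
  proof -
    have "(\<Sum>w\<in>U. c i w * (?S w x)) = - h i x"
      unfolding c(1)[OF i] sum_negf[symmetric]
    proof (intro sum.cong refl)
      fix w assume w: "w \<in> U"
      show "c i w * (?S w x) = - (c i w * wmon w x)"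
        unfolding wPQ(1)[of w x] by (simp add: x[OF w] algebra_simps)
    qed
    then show ?thesis by (simp add: fgh[OF i])
  qed
  have \<sigma>I: "\<sigma> x i = x i" if "i \<in> I" for x i using that by (simp add: \<sigma>_def)
  have \<sigma>PQ: "wmon (?P w) (\<sigma> x) = wmon (?P w) x" "wmon (?Q w) (\<sigma> x) = wmon (?Q w) x" if "w \<in> U" for w x
    using lenU(2)[OF that] set_take_subset[of 2 w] set_drop_subset[of 2 w]
    by (auto intro!: wmon_cong \<sigma>I)
  have \<sigma>A: "\<sigma> x (Aux True w) = - wmon (?P w) x" "\<sigma> x (Aux False w) = - wmon (?Q w) x" if "w \<in> U" for w x
    using notI[OF that] by (simp_all add: \<sigma>_def F_def)
  show ?case
  proof (rule pinv_transfer[OF inv, where \<rho> = "\<lambda>i x. x i" and \<tau> = \<tau> and \<sigma> = \<sigma>])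
    show "polyf J (\<lambda>x. x i)" if "i \<in> I" for i using that IJ by (intro polyf.var) blast
    show "polyf I (\<tau> j)" for j by (cases "j \<in> I") (auto simp: \<tau>_def intro!: polyf.var)
    show "\<sigma> x i = x i" if "i \<in> I" for x i using that by (rule \<sigma>I)
    show "\<sigma> x j + F j (\<sigma> x) = \<tau> j (\<lambda>i. x i + f i x)" if j: "j \<in> J" for x j
    proof (cases "j \<in> I")
      case True
      have "F j (\<sigma> x) = f j (\<sigma> x)"
        unfolding F_def using True by (simp only: if_True) (rule top, simp_all add: \<sigma>A \<sigma>PQ)
      also have "\<dots> = f j x"
        by (rule polyf_cong[OF wpoly_polyf[OF f[OF True]] \<sigma>I])
      finally show ?thesis using True by (simp add: \<tau>_def \<sigma>I)
    next
      case False
      then obtain b w where "w \<in> U" "j = Aux b w" using j by (auto simp: J_def)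
      then show ?thesis using False by (cases b) (simp_all add: \<tau>_def \<sigma>A \<sigma>PQ F_def)
    qed
    show "x i + f i (\<lambda>i. x i) = y i"
      if x: "\<And>j. j \<in> J \<Longrightarrow> x j + F j x = \<tau> j y" and i: "i \<in> I" for x y i
    proof -
      have "x (Aux True w) = - wmon (?P w) x" "x (Aux False w) = - wmon (?Q w) x" if w: "w \<in> U" for w
        using x[of "Aux True w"] x[of "Aux False w"] notI[OF w] w
        by (simp_all add: J_def F_def \<tau>_def add_eq_0_iff2)
      from top[OF i this] have "F i x = f i x" using i by (simp add: F_def)
      then show ?thesis using x[of i] i by (simp add: J_def \<tau>_def)
    qed
  qed
qed

section \<open>Normalisation of a general Keller map\<close>

text \<open>Several indices may share an exponent vector, whereas \<open>polynomial_fun\<close> has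
  one coefficient per vector; the terms are grouped accordingly.\<close>

lemma polynomial_funI:
  fixes c :: "'s \<Rightarrow> complex" and e :: "'s \<Rightarrow> nat \<Rightarrow> nat"
  assumes fin: "finite S" and f: "\<And>x. x \<in> carrier_vec n \<Longrightarrow> f x = (\<Sum>s\<in>S. c s * (\<Prod>i<n. (x $ i) ^ e s i))"
  shows "polynomial_fun n f"
  unfolding polynomial_fun_def
proof (intro exI[of _ "e ` S"] exI[of _ "\<lambda>m. \<Sum>s\<in>{s \<in> S. e s = m}. c s"] conjI ballI)
  fix x :: "complex vec" assume x: "x \<in> carrier_vec n"
  have "f x = (\<Sum>m\<in>e ` S. \<Sum>s\<in>{s \<in> S. e s = m}. c s * (\<Prod>i<n. (x $ i) ^ e s i))"
    unfolding f[OF x] by (rule sum.image_gen[OF fin])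
  also have "\<dots> = (\<Sum>m\<in>e ` S. (\<Sum>s\<in>{s \<in> S. e s = m}. c s) * (\<Prod>i<n. (x $ i) ^ m i))"
    by (intro sum.cong refl) (simp add: sum_distrib_right)
  finally show "f x = (\<Sum>m\<in>e ` S. (\<Sum>s\<in>{s \<in> S. e s = m}. c s) * (\<Prod>i<n. (x $ i) ^ m i))" .
qed (use fin in simp)

lemma polynomial_fun_const: "polynomial_fun n (\<lambda>x. c)"
  by (rule polynomial_funI[of "{()}" n _ "\<lambda>_. c" "\<lambda>_ _. 0"]) simp_all

lemma polynomial_fun_var: "i < n \<Longrightarrow> polynomial_fun n (\<lambda>x. x $ i)"
proof (rule polynomial_funI[of "{()}" n _ "\<lambda>_. 1" "\<lambda>_ j. if j = i then 1 else 0"])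
  fix x :: "complex vec" assume i: "i < n"
  have "(\<Prod>j<n. (x $ j) ^ (if j = i then 1 else 0)) = (\<Prod>j<n. if j = i then x $ j else 1)"
    by (intro prod.cong) auto
  then show "x $ i = (\<Sum>s\<in>{()}. 1 * (\<Prod>j<n. (x $ j) ^ (if j = i then 1 else 0)))" using i by simp
qed simp

lemma polynomial_fun_add:
  assumes "polynomial_fun n f" "polynomial_fun n g"
  shows "polynomial_fun n (\<lambda>x. f x + g x)"
proof -
  obtain M c M' c' where M: "finite (M :: (nat \<Rightarrow> nat) set)" "finite (M' :: (nat \<Rightarrow> nat) set)"
    and fg: "\<And>x. x \<in> carrier_vec n \<Longrightarrow> f x = (\<Sum>m\<in>M. c m * (\<Prod>i<n. (x $ i) ^ m i))"
      "\<And>x. x \<in> carrier_vec n \<Longrightarrow> g x = (\<Sum>m\<in>M'. c' m * (\<Prod>i<n. (x $ i) ^ m i))"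
    using assms unfolding polynomial_fun_def by blast
  show ?thesis
    by (rule polynomial_funI[of "M <+> M'" n _ "case_sum c c'" "case_sum (\<lambda>m. m) (\<lambda>m. m)"])
      (use M in \<open>simp_all add: fg sum.Plus\<close>)
qed

lemma polynomial_fun_mult:
  assumes "polynomial_fun n f" "polynomial_fun n g"
  shows "polynomial_fun n (\<lambda>x. f x * g x)"
proof -
  obtain M c M' c' where M: "finite (M :: (nat \<Rightarrow> nat) set)" "finite (M' :: (nat \<Rightarrow> nat) set)"
    and fg: "\<And>x. x \<in> carrier_vec n \<Longrightarrow> f x = (\<Sum>m\<in>M. c m * (\<Prod>i<n. (x $ i) ^ m i))"
      "\<And>x. x \<in> carrier_vec n \<Longrightarrow> g x = (\<Sum>m\<in>M'. c' m * (\<Prod>i<n. (x $ i) ^ m i))"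
    using assms unfolding polynomial_fun_def by blast
  show ?thesis
  proof (rule polynomial_funI[of "M \<times> M'" n _ "\<lambda>p. c (fst p) * c' (snd p)" "\<lambda>p i. fst p i + snd p i"])
    fix x :: "complex vec" assume x: "x \<in> carrier_vec n"
    show "f x * g x = (\<Sum>p\<in>M \<times> M'. c (fst p) * c' (snd p) * (\<Prod>i<n. (x $ i) ^ (fst p i + snd p i)))"
      unfolding fg[OF x] sum_product sum.cartesian_product
      by (intro sum.cong) (auto simp: power_add prod.distrib)
  qed (use M in simp)
qed

lemma polynomial_fun_sum:
  "(\<And>k. k \<in> A \<Longrightarrow> polynomial_fun n (f k)) \<Longrightarrow> polynomial_fun n (\<lambda>x. \<Sum>k\<in>A. f k x)"
  by (induction A rule: infinite_finite_induct) (simp_all add: polynomial_fun_const polynomial_fun_add)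

lemma polynomial_fun_polyf:
  assumes "polyf I f" "\<And>i. i \<in> I \<Longrightarrow> polynomial_fun n (\<lambda>x. g x i)"
  shows "polynomial_fun n (\<lambda>x. f (g x))"
  using assms(1)
  by induction (use assms(2) in \<open>auto intro: polynomial_fun_const polynomial_fun_add polynomial_fun_mult\<close>)

section \<open>Exponent vectors as words, and separation of the linear part\<close>

definition exponent_word :: "nat \<Rightarrow> (nat \<Rightarrow> nat) \<Rightarrow> idx list" where
  "exponent_word n m = concat (map (\<lambda>i. replicate (m i) (Base i)) [0..<n])"

lemma set_exponent_word: "set (exponent_word n m) \<subseteq> Base ` {..<n}"
  by (auto simp: exponent_word_def)

lemma wmon_replicate: "wmon (replicate k i) x = x i ^ k"
  by (induction k) auto

lemma wmon_exponent_word: "wmon (exponent_word n m) x = (\<Prod>i<n. x (Base i) ^ m i)"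
proof (induction n)
  case 0
  show ?case by (simp add: exponent_word_def)
next
  case (Suc n)
  have "exponent_word (Suc n) m = exponent_word n m @ replicate (m n) (Base n)"
    by (simp add: exponent_word_def)
  then show ?case using Suc by (simp add: wmon_append wmon_replicate mult.commute)
qed

lemma wmon_has_field_derivative:
  assumes "\<And>i. ((\<lambda>t. X t i) has_field_derivative v i) (at t0)"
  shows "((\<lambda>t. wmon w (X t)) has_field_derivative dwmon w (X t0) v) (at t0)"
proof (induction w)
  case (Cons i w)
  show ?case
    by (auto intro!: derivative_eq_intros assms Cons)
qed simp

lemma dwmon_linear:
  assumes "finite I" "set w \<subseteq> I"
  shows "dwmon w x v = (\<Sum>j\<in>I. v j * dwmon w x (\<lambda>i. if i = j then 1 else 0))"
  using assms(2)
proof (induction w)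
  case (Cons i w)
  have "(\<Sum>j\<in>I. v j * dwmon (i # w) x (\<lambda>i. if i = j then 1 else 0))
      = (\<Sum>j\<in>I. if i = j then v j * wmon w x else 0)
        + x i * (\<Sum>j\<in>I. v j * dwmon w x (\<lambda>i. if i = j then 1 else 0))"
    unfolding sum_distrib_left sum.distrib[symmetric] by (intro sum.cong) (auto simp: algebra_simps)
  also have "\<dots> = dwmon (i # w) x v" using Cons assms(1) by simp
  finally show ?case ..
qed simp

text \<open>The value at 0 sees only the empty word and the derivative at 0 only words of length
  1.\<close>

lemma wmon_low_high:
  "wmon w x = wmon w (\<lambda>_. 0) + dwmon w (\<lambda>_. 0) x + (if 2 \<le> length w then wmon w x else 0)"
  "dwmon w x v = dwmon w (\<lambda>_. 0) v + (if 2 \<le> length w then dwmon w x v else 0)"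
proof -
  consider "w = []" | i where "w = [i]" | i j u where "w = i # j # u"
    by (metis list.exhaust)
  then have "wmon w x = wmon w (\<lambda>_. 0) + dwmon w (\<lambda>_. 0) x + (if 2 \<le> length w then wmon w x else 0) \<and>
    dwmon w x v = dwmon w (\<lambda>_. 0) v + (if 2 \<le> length w then dwmon w x v else 0)"
    by cases auto
  then show "wmon w x = wmon w (\<lambda>_. 0) + dwmon w (\<lambda>_. 0) x + (if 2 \<le> length w then wmon w x else 0)"
    "dwmon w x v = dwmon w (\<lambda>_. 0) v + (if 2 \<le> length w then dwmon w x v else 0)" by blast+
qed

lemma index_mult_mat_vec_vec:
  assumes "A \<in> carrier_mat n n" "i < n"
  shows "(A *\<^sub>v vec n t) $ i = (\<Sum>k<n. A $$ (i, k) * t k)"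
  using assms by (simp add: scalar_prod_def atLeast0LessThan)

lemma mult_mat_zero_vec:
  "A \<in> carrier_mat n m \<Longrightarrow> A *\<^sub>v 0\<^sub>v m = (0\<^sub>v n :: complex vec)"
  by (intro eq_vecI) (auto simp: scalar_prod_def)

text \<open>With \<open>L\<close> the inverse Jacobian at 0, the map \<open>L (F x - F 0)\<close>
  has the form x + f(x) with \<open>f\<close> made of words of length at least 2, which is what the
  reductions require. Its inverse is then precomposed with the affine map \<open>T\<close>.\<close>

lemma JC_from_cubic:
  assumes cub: "\<And>N a. keller_cubic N a \<Longrightarrow> pinv {..<N} (\<lambda>i x. cubic N a x i)"
  shows "JC n"
  unfolding JC_def
proof (intro allI impI, elim conjE)
  fix F assume poly: "polynomial_map n F" and inv: "\<forall>x\<in>carrier_vec n. invertible_mat (jacobian n F x)"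
  have Fc: "F x \<in> carrier_vec n" if "x \<in> carrier_vec n" for x
    using poly that by (auto simp: polynomial_map_def)
  have "\<forall>k. \<exists>M c. k < n \<longrightarrow> finite (M :: (nat \<Rightarrow> nat) set) \<and>
      (\<forall>x\<in>carrier_vec n. F x $ k = (\<Sum>m\<in>M. c m * (\<Prod>i<n. (x $ i) ^ m i)))"
    using poly unfolding polynomial_map_def polynomial_fun_def by blast
  then obtain M c where M: "\<And>k. k < n \<Longrightarrow> finite (M k :: (nat \<Rightarrow> nat) set)"
    and Fk: "\<And>k x. k < n \<Longrightarrow> x \<in> carrier_vec n \<Longrightarrow> F x $ k = (\<Sum>m\<in>M k. c k m * (\<Prod>i<n. (x $ i) ^ m i))"
    by metis
  let ?w = "exponent_word n"
  define I where "I = Base ` {..<n}"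
  have finI: "finite I" by (simp add: I_def)
  define toV where "toV = (\<lambda>\<xi>. vec n (\<lambda>i. \<xi> (Base i)) :: complex vec)"
  have toV: "toV \<xi> = vec n (\<lambda>i. \<xi> (Base i))" for \<xi> by (simp add: toV_def)
  define P where "P = (\<lambda>k \<xi>. \<Sum>m\<in>M k. c k m * wmon (?w m) \<xi>)"
  define dP where "dP = (\<lambda>k \<xi> v. \<Sum>m\<in>M k. c k m * dwmon (?w m) \<xi> v)"
  define Q where "Q = (\<lambda>k \<xi>. \<Sum>m\<in>M k. c k m * (if 2 \<le> length (?w m) then wmon (?w m) \<xi> else 0))"
  define dQ where "dQ = (\<lambda>k \<xi> v. \<Sum>m\<in>M k. c k m * (if 2 \<le> length (?w m) then dwmon (?w m) \<xi> v else 0))"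
  have FP: "F (toV \<xi>) $ k = P k \<xi>" if "k < n" for k \<xi>
  proof -
    have "F (toV \<xi>) $ k = (\<Sum>m\<in>M k. c k m * (\<Prod>i<n. (toV \<xi> $ i) ^ m i))"
      by (rule Fk[OF that]) (simp add: toV_def)
    then show ?thesis by (simp add: P_def wmon_exponent_word toV_def)
  qed
  have PQ: "P k \<xi> = P k (\<lambda>_. 0) + dP k (\<lambda>_. 0) \<xi> + Q k \<xi>" for k \<xi>
    unfolding P_def dP_def Q_def sum.distrib[symmetric] distrib_left[symmetric]
    by (intro sum.cong refl arg_cong2[of _ _ _ _ "(*)"] wmon_low_high)
  have dPQ: "dP k \<xi> v = dP k (\<lambda>_. 0) v + dQ k \<xi> v" for k \<xi> v
    unfolding dP_def dQ_def sum.distrib[symmetric] distrib_left[symmetric]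
    by (intro sum.cong refl arg_cong2[of _ _ _ _ "(*)"] wmon_low_high)
  have jac: "jacobian n F (toV \<xi>) $$ (k, j) = dP k \<xi> (\<lambda>i. if i = Base j then 1 else 0)"
    if k: "k < n" and j: "j < n" for k j \<xi>
  proof -
    define X where "X = (\<lambda>t. \<xi>(Base j := t))"
    have X: "toV \<xi> |\<^sub>v j \<mapsto> t = toV (X t)" for t
      by (rule eq_vecI) (use j in \<open>auto simp: toV_def X_def update_vec_def\<close>)
    have "((\<lambda>t. X t i) has_field_derivative (if i = Base j then 1 else 0)) (at t)" for i t
      by (auto simp: X_def intro!: derivative_eq_intros)
    then have "((\<lambda>t. P k (X t)) has_field_derivative dP k (X t) (\<lambda>i. if i = Base j then 1 else 0)) (at t)" for t
      unfolding P_def dP_def by (intro DERIV_sum DERIV_cmult wmon_has_field_derivative)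
    then have "deriv (\<lambda>t. P k (X t)) (\<xi> (Base j)) = dP k (X (\<xi> (Base j))) (\<lambda>i. if i = Base j then 1 else 0)"
      by (rule DERIV_imp_deriv)
    moreover have "X (\<xi> (Base j)) = \<xi>" by (simp add: X_def)
    ultimately show ?thesis using k j by (simp add: jacobian_def X FP) (simp add: toV_def)
  qed
  have Jc: "jacobian n F x \<in> carrier_mat n n" for x by (simp add: jacobian_def)
  have dimJac [simp]: "dim_row (jacobian n F x) = n" "dim_col (jacobian n F x) = n" for x
    by (simp_all add: jacobian_def)
  have sumI: "(\<Sum>i\<in>I. t i) = (\<Sum>j<n. t (Base j))" for t :: "idx \<Rightarrow> complex"
    unfolding I_def by (subst sum.reindex) (auto simp: inj_on_def)
  have jac_vec: "(jacobian n F (toV \<xi>) *\<^sub>v toV v) $ k = dP k \<xi> v" if k: "k < n" for k \<xi> v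
  proof -
    have "(jacobian n F (toV \<xi>) *\<^sub>v toV v) $ k = (\<Sum>j<n. dP k \<xi> (\<lambda>i. if i = Base j then 1 else 0) * v (Base j))"
      unfolding toV[of v] index_mult_mat_vec_vec[OF Jc k] by (intro sum.cong refl) (simp add: jac[OF k])
    also have "\<dots> = (\<Sum>m\<in>M k. c k m * (\<Sum>j<n. v (Base j) * dwmon (?w m) \<xi> (\<lambda>i. if i = Base j then 1 else 0)))"
      unfolding dP_def sum_distrib_right sum_distrib_left by (subst sum.swap) (simp add: mult_ac)
    also have "\<dots> = dP k \<xi> v"
    proof -
      have "(\<Sum>j<n. v (Base j) * dwmon (?w m) \<xi> (\<lambda>i. if i = Base j then 1 else 0)) = dwmon (?w m) \<xi> v" for m
        using dwmon_linear[OF finI, of "?w m" \<xi> v] set_exponent_word[of n m] by (simp add: sumI) (simp add: I_def)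
      then show ?thesis by (simp only: dP_def)
    qed
    finally show ?thesis .
  qed
  define J where "J = jacobian n F (toV (\<lambda>_. 0))"
  have "invertible_mat J" using inv by (simp add: J_def toV_def)
  then obtain L where L: "L * J = 1\<^sub>m n" "J * L = 1\<^sub>m n" "L \<in> carrier_mat n n"
  proof -
    assume *: "\<And>L. L * J = 1\<^sub>m n \<Longrightarrow> J * L = 1\<^sub>m n \<Longrightarrow> L \<in> carrier_mat n n \<Longrightarrow> thesis"
    have dimJ: "dim_row J = n" "dim_col J = n" using Jc by (simp_all add: J_def jacobian_def)
    \<comment> \<open>\<open>invertible_mat\<close> leaves the size of the inverse open; it is read
      off from the two products.\<close>
    obtain L where L: "J * L = 1\<^sub>m n" "L * J = 1\<^sub>m (dim_row L)"
      using \<open>invertible_mat J\<close> dimJ by (auto simp: invertible_mat_def inverts_mat_def)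
    have "dim_row L = n" using arg_cong[OF L(2), of dim_col] dimJ by simp
    moreover have "dim_col L = n" using arg_cong[OF L(1), of dim_col] by simp
    ultimately show thesis using * L by auto
  qed
  have Lvec: "(L *\<^sub>v vec n t) $ i = (\<Sum>k<n. L $$ (i, k) * t k)" if "i < n" for t i
    using index_mult_mat_vec_vec[OF L(3) that] .
  have LJ: "(\<Sum>k<n. L $$ (i, k) * dP k (\<lambda>_. 0) v) = v (Base i)" if i: "i < n" for i v
  proof -
    have "vec n (\<lambda>k. dP k (\<lambda>_. 0) v) = J *\<^sub>v toV v"
      by (intro eq_vecI) (simp_all add: J_def jac_vec del: index_mult_mat_vec)
    then have "(\<Sum>k<n. L $$ (i, k) * dP k (\<lambda>_. 0) v) = (L *\<^sub>v (J *\<^sub>v toV v)) $ i"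
      using Lvec[OF i, of "\<lambda>k. dP k (\<lambda>_. 0) v"] by simp
    also have "L *\<^sub>v (J *\<^sub>v toV v) = (L * J) *\<^sub>v toV v"
      using L(3) Jc by (intro assoc_mult_mat_vec[symmetric]) (auto simp: J_def toV_def)
    finally show ?thesis using i by (simp add: L toV_def)
  qed
  have L_inj: "u = 0\<^sub>v n" if u: "u \<in> carrier_vec n" "L *\<^sub>v u = 0\<^sub>v n" for u
  proof -
    have "(J * L) *\<^sub>v u = J *\<^sub>v (L *\<^sub>v u)"
      using u(1) L(3) Jc by (intro assoc_mult_mat_vec) (auto simp: J_def)
    also have "\<dots> = 0\<^sub>v n" unfolding u(2) J_def by (rule mult_mat_zero_vec[OF Jc])
    finally show ?thesis using u(1) by (simp add: L(2))
  qed
  define f where "f = (\<lambda>j \<xi>. case j of Base i \<Rightarrow> (\<Sum>k<n. L $$ (i, k) * Q k \<xi>) | Aux _ _ \<Rightarrow> 0)"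
  define df where "df = (\<lambda>j \<xi> v. case j of Base i \<Rightarrow> (\<Sum>k<n. L $$ (i, k) * dQ k \<xi> v) | Aux _ _ \<Rightarrow> 0)"
  have "finite (\<Union>k<n. (\<lambda>m. length (?w m)) ` M k)" using M by simp
  then obtain d0 where d0: "\<And>k m. k < n \<Longrightarrow> m \<in> M k \<Longrightarrow> length (?w m) \<le> d0"
    unfolding finite_nat_set_iff_bounded_le by blast
  \<comment> \<open>At least 3, where the induction on the degree begins.\<close>
  define d where "d = max 3 d0"
  have fw: "finite (words I {2..d})" by (simp add: finite_words finI)
  have wQ: "wpoly (words I {2..d}) (Q k) (dQ k)" if k: "k < n" for k
    unfolding Q_def dQ_def
  proof (intro wpoly_sum wpoly_scale)
    fix m assume m: "m \<in> M k"
    show "wpoly (words I {2..d}) (\<lambda>\<xi>. if 2 \<le> length (?w m) then wmon (?w m) \<xi> else 0)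
      (\<lambda>\<xi> v. if 2 \<le> length (?w m) then dwmon (?w m) \<xi> v else 0)"
    proof (cases "2 \<le> length (?w m)")
      case True
      then have "?w m \<in> words I {2..d}"
        using d0[OF k m] set_exponent_word[of n m] by (auto simp: words_def I_def d_def)
      from wpoly_mon[OF fw this] show ?thesis using True by simp
    qed (simp add: wpoly_zero)
  qed
  have wf: "wpoly (words I {2..d}) (f j) (df j)" if j: "j \<in> I" for j
  proof -
    obtain i where i: "j = Base i" using j by (auto simp: I_def)
    have "wpoly (words I {2..d}) (\<lambda>\<xi>. \<Sum>k<n. L $$ (i, k) * Q k \<xi>) (\<lambda>\<xi> v. \<Sum>k<n. L $$ (i, k) * dQ k \<xi> v)"
      by (intro wpoly_sum wpoly_scale wQ) simp
    then show ?thesis by (simp add: f_def df_def i)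
  qed
  have \<Phi>: "\<xi> (Base i) + f (Base i) \<xi> = (L *\<^sub>v (F (toV \<xi>) - F (0\<^sub>v n))) $ i" if i: "i < n" for i \<xi>
  proof -
    have "0\<^sub>v n = toV (\<lambda>_. 0)" by (rule eq_vecI) (simp_all add: toV_def)
    then have "F (0\<^sub>v n) $ k = P k (\<lambda>_. 0)" if "k < n" for k using that by (simp only: FP)
    then have "F (toV \<xi>) - F (0\<^sub>v n) = vec n (\<lambda>k. dP k (\<lambda>_. 0) \<xi> + Q k \<xi>)"
      using Fc[of "0\<^sub>v n"] by (intro eq_vecI) (auto simp: FP PQ[of _ \<xi>])
    then have "(L *\<^sub>v (F (toV \<xi>) - F (0\<^sub>v n))) $ i = (\<Sum>k<n. L $$ (i, k) * (dP k (\<lambda>_. 0) \<xi> + Q k \<xi>))"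
      by (simp only: Lvec[OF i])
    also have "\<dots> = \<xi> (Base i) + (\<Sum>k<n. L $$ (i, k) * Q k \<xi>)"
      unfolding distrib_left sum.distrib LJ[OF i] ..
    finally show ?thesis by (simp add: f_def)
  qed
  have ns: "nonsingular I df"
    unfolding nonsingular_def
  proof (intro allI impI)
    fix \<xi> v assume v: "\<forall>j\<in>I. v j + df j \<xi> v = 0"
    define u where "u = jacobian n F (toV \<xi>) *\<^sub>v toV v"
    have uc: "u \<in> carrier_vec n" using Jc[of "toV \<xi>"] by (simp add: u_def toV_def)
    have u: "u = vec n (\<lambda>k. dP k \<xi> v)"
      by (intro eq_vecI) (simp_all add: u_def jac_vec del: index_mult_mat_vec)
    have "(L *\<^sub>v u) $ i = 0" if i: "i < n" for i
    proof -
      have "(L *\<^sub>v u) $ i = (\<Sum>k<n. L $$ (i, k) * dP k (\<lambda>_. 0) v) + (\<Sum>k<n. L $$ (i, k) * dQ k \<xi> v)"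
        unfolding u Lvec[OF i] sum.distrib[symmetric] distrib_left[symmetric] by (simp only: dPQ[of _ \<xi> v])
      also have "\<dots> = v (Base i) + df (Base i) \<xi> v" by (simp add: LJ[OF i] df_def)
      also have "\<dots> = 0" using v i by (auto simp: I_def)
      finally show ?thesis .
    qed
    then have "L *\<^sub>v u = 0\<^sub>v n" using L(3) by (intro eq_vecI) auto
    then have u0: "u = 0\<^sub>v n" using L_inj uc by blast
    have "invertible_mat (jacobian n F (toV \<xi>))" using inv by (simp add: toV_def)
    then obtain K where K: "jacobian n F (toV \<xi>) * K = 1\<^sub>m n" "K * jacobian n F (toV \<xi>) = 1\<^sub>m (dim_row K)"
      by (auto simp: invertible_mat_def inverts_mat_def)
    have "dim_row K = n" using arg_cong[OF K(2), of dim_col] by simp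
    moreover have "dim_col K = n" using arg_cong[OF K(1), of dim_col] by simp
    ultimately have Kc: "K \<in> carrier_mat n n" by (rule carrier_matI)
    have "K *\<^sub>v u = (K * jacobian n F (toV \<xi>)) *\<^sub>v toV v"
      unfolding u_def by (rule assoc_mult_mat_vec[symmetric, OF Kc Jc]) (simp add: toV_def)
    then have "toV v = 0\<^sub>v n"
      unfolding u0 mult_mat_zero_vec[OF Kc] K(2) using Kc by (simp add: toV_def)
    then have "v (Base i) = 0" if "i < n" for i
      using that by (metis index_vec index_zero_vec(1) toV_def)
    then show "\<forall>j\<in>I. v j = 0" by (auto simp: I_def)
  qed
  have "pinv I (\<lambda>j \<xi>. \<xi> j + f j \<xi>)"
    by (rule pinv_any_degree[OF cub _ finI _ wf ns]) (auto simp: d_def I_def)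
  then obtain G where G: "\<And>j. j \<in> I \<Longrightarrow> polyf I (G j)"
    "\<And>\<xi> j. j \<in> I \<Longrightarrow> G j (\<lambda>k. \<xi> k + f k \<xi>) = \<xi> j"
    "\<And>\<eta> j. j \<in> I \<Longrightarrow> G j \<eta> + f j (\<lambda>k. G k \<eta>) = \<eta> j"
    unfolding pinv_def by blast
  define T where "T = (\<lambda>y j. case j of Base i \<Rightarrow> (L *\<^sub>v (y - F (0\<^sub>v n))) $ i | Aux _ _ \<Rightarrow> 0)"
  define H where "H = (\<lambda>y. toV (\<lambda>j. G j (T y)))"
  have "polynomial_map n H"
    unfolding polynomial_map_def
  proof (intro conjI allI impI)
    show "H \<in> carrier_vec n \<rightarrow> carrier_vec n" by (simp add: H_def toV_def)
    fix i assume i: "i < n"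
    have "polynomial_fun n (\<lambda>y. T y j)" if "j \<in> I" for j
    proof -
      obtain l where l: "j = Base l" "l < n" using \<open>j \<in> I\<close> by (auto simp: I_def)
      have "polynomial_fun n (\<lambda>y. \<Sum>k<n. L $$ (l, k) * (y $ k + (- 1) * F (0\<^sub>v n) $ k))"
        by (intro polynomial_fun_sum polynomial_fun_mult polynomial_fun_add polynomial_fun_const polynomial_fun_var) simp
      moreover have "T y j = (\<Sum>k<n. L $$ (l, k) * (y $ k + (- 1) * F (0\<^sub>v n) $ k))" if "y \<in> carrier_vec n" for y
      proof -
        have "y - F (0\<^sub>v n) = vec n (\<lambda>k. y $ k + (- 1) * F (0\<^sub>v n) $ k)"
          using that Fc[of "0\<^sub>v n"] by (intro eq_vecI) auto
        then show ?thesis by (simp only: T_def l idx.case Lvec[OF l(2)])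
      qed
      ultimately show ?thesis by (simp add: polynomial_fun_def)
    qed
    then have "polynomial_fun n (\<lambda>y. G (Base i) (T y))"
      by (intro polynomial_fun_polyf[OF G(1)]) (use i in \<open>auto simp: I_def\<close>)
    then show "polynomial_fun n (\<lambda>y. H y $ i)" using i by (simp add: H_def toV_def)
  qed
  moreover have "H (F x) = x \<and> F (H x) = x" if x: "x \<in> carrier_vec n" for x
  proof
    define \<xi> where "\<xi> = (\<lambda>j. case j of Base i \<Rightarrow> x $ i | Aux _ _ \<Rightarrow> 0)"
    have x\<xi>: "x = toV \<xi>" using x by (intro eq_vecI) (auto simp: toV_def \<xi>_def)
    have "G j (T (F x)) = \<xi> j" if j: "j \<in> I" for j
    proof -
      have "G j (T (F x)) = G j (\<lambda>k. \<xi> k + f k \<xi>)"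
        by (rule polyf_cong[OF G(1)[OF j]]) (auto simp: I_def T_def \<Phi> x\<xi>)
      then show ?thesis using G(2)[OF j] by simp
    qed
    then show "H (F x) = x"
      unfolding H_def using x by (intro eq_vecI) (auto simp: toV_def I_def \<xi>_def)
    define \<eta> where "\<eta> = (\<lambda>j. G j (T x))"
    \<comment> \<open>The two sides agree after applying \<open>L\<close>, which is
      injective.\<close>
    define u where "u = F (toV \<eta>) - x"
    have uc: "u \<in> carrier_vec n" using x Fc[of "toV \<eta>"] by (simp add: u_def toV_def)
    have "(L *\<^sub>v u) $ i = 0" if i: "i < n" for i
    proof -
      have "u = (F (toV \<eta>) - F (0\<^sub>v n)) - (x - F (0\<^sub>v n))"
        using x Fc[of "toV \<eta>"] Fc[of "0\<^sub>v n"] unfolding u_def by (intro eq_vecI) (auto simp: toV_def)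
      then have "L *\<^sub>v u = L *\<^sub>v (F (toV \<eta>) - F (0\<^sub>v n)) - L *\<^sub>v (x - F (0\<^sub>v n))"
        using x Fc[of "toV \<eta>"] Fc[of "0\<^sub>v n"] L(3) by (simp add: mult_minus_distrib_mat_vec toV_def)
      then have "(L *\<^sub>v u) $ i = (\<eta> (Base i) + f (Base i) \<eta>) - (L *\<^sub>v (x - F (0\<^sub>v n))) $ i"
        using i L(3) by (simp add: \<Phi>)
      moreover have "\<eta> (Base i) + f (Base i) \<eta> = T x (Base i)"
        unfolding \<eta>_def by (rule G(3)) (use i in \<open>simp add: I_def\<close>)
      ultimately show ?thesis by (simp add: T_def)
    qed
    then have "L *\<^sub>v u = 0\<^sub>v n" using L(3) by (intro eq_vecI) auto
    then have "u = 0\<^sub>v n" using L_inj uc by blast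
    then have "F (toV \<eta>) $ i = x $ i" if "i < n" for i
      using that x Fc[of "toV \<eta>"] unfolding u_def
      by (metis carrier_vecD eq_iff_diff_eq_0 index_minus_vec(1) index_zero_vec(1))
    then show "F (H x) = x"
      unfolding H_def \<eta>_def[symmetric] using x Fc[of "toV \<eta>"] by (intro eq_vecI) (auto simp: toV_def)
  qed
  ultimately show "\<exists>G. polynomial_map n G \<and> (\<forall>x\<in>carrier_vec n. G (F x) = x \<and> F (G x) = x)" by blast
qed

theorem theorem1p11:
  assumes "\<And>n k. k \<in> {3..n} \<Longrightarrow>
    \<not> (\<exists>A y. druzkowski n A \<and> y \<in> carrier_vec n \<and> (y, Z n k, A) \<in> V n)"
  shows "JC_infinity"
proof -
  have "pinv {..<N} (\<lambda>i x. cubic N a x i)" if kel: "keller_cubic N a" for N a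
  proof -
    interpret injective_keller N a
      by unfold_locales (use kel keller_cubic_injective[OF assms kel] in auto)
    obtain H where H: "\<And>i. i < N \<Longrightarrow> polyf {..<N} (H i)"
      "\<And>y i. i < N \<Longrightarrow> cubic N a (\<lambda>j. H j y) i = y i"
      using polynomial_right_inverse by blast
    \<comment> \<open>A right inverse of an injective map is two-sided: \<open>F\<close> takes the
      same value at \<open>H (F x)\<close> and at \<open>x\<close>.\<close>
    have "H i (cubic N a x) = x i" if "i < N" for i x
      by (rule inj[OF _ that, of "\<lambda>i. H i (cubic N a x)"]) (simp add: H(2))
    then show ?thesis unfolding pinv_def using H by (intro exI[of _ H]) auto
  qed
  then show ?thesis unfolding JC_infinity_def using JC_from_cubic by blast
qed

end
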